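(* Fix an integer $V > 0$. Let $\mathbf{p}$ and $\mathbf{q}$ be distributions on $[V] \times [V]$ and let $\epsilon > 0$ be less than a sufficiently small constant. Any tester that, for some $k \leq V$, distinguishes between $\mathbf{p} = \mathbf{q}$ and $\|\mathbf{p} - \mathbf{q}\|_{\mathcal A_k} \geq \epsilon$ with probability at least $2/3$ must use at least $m$ samples for some $m$ with $$ m \geq \Omega(1) \cdot \min \left( k^{2/3} \epsilon^{-4/3} \cdot \left( \frac{ \log \log V }{ \log \log \log V} \right)^{1/3} , \; k^{6/7} \epsilon^{-8/7} , \; k \right).$$
   Context: $[V] = \{1,\dots,V\}$. For distributions $\mathbf{p}, \mathbf{q}$ on $\mathbb{R}^2$ (or a subset such as $[V]\times[V]$) and $k \in \mathbb{Z}_+$, $\|\mathbf{p}-\mathbf{q}\|_{\mathcal A_k}$ is the maximum of $\sum_{i=1}^k |\mathbf{p}(R_i) - \mathbf{q}(R_i)|$ over all choices of $k$ pairwise non-overlapping axis-aligned rectangles $R_1,\dots,R_k$. A tester receives i.i.d. samples from $\mathbf{p}$ and from $\mathbf{q}$. *)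

theory Defs
  imports "HOL-Probability.Probability"
begin

definition axis_rectangle :: "('a::linorder \<times> 'a) set \<Rightarrow> bool" where
  "axis_rectangle R \<longleftrightarrow> (\<exists>a b c d. R = {a..b} \<times> {c..d})"

(* Non-overlapping means disjoint, since the distributions have atoms.  An empty rectangle
   (b < a or d < c) contributes nothing, so it is harmless.  For finitely supported
   distributions the sums take finitely many values, and the supremum is a maximum. *)
definition Ak_dist :: "nat \<Rightarrow> ('a::linorder \<times> 'a) pmf \<Rightarrow> ('a \<times> 'a) pmf \<Rightarrow> real" where
  "Ak_dist k p q =
     Sup {\<Sum>i<k. \<bar>measure_pmf.prob p (R i) - measure_pmf.prob q (R i)\<bar> |R.
            (\<forall>i<k. axis_rectangle (R i)) \<and> disjoint_family_on R {..<k}}"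

definition grid :: "nat \<Rightarrow> (nat \<times> nat) set" where
  "grid V = {1..V} \<times> {1..V}"

(* A randomized tester sees one list of samples from each distribution and returns a random
   verdict, where True stands for "p = q". *)
type_synonym tester = "(nat \<times> nat) list \<Rightarrow> (nat \<times> nat) list \<Rightarrow> bool pmf"

definition run_tester ::
    "tester \<Rightarrow> nat \<Rightarrow> nat \<Rightarrow> (nat \<times> nat) pmf \<Rightarrow> (nat \<times> nat) pmf \<Rightarrow> bool pmf" where
  "run_tester T m\<^sub>p m\<^sub>q p q =
     do {xs \<leftarrow> replicate_pmf m\<^sub>p p; ys \<leftarrow> replicate_pmf m\<^sub>q q; T xs ys}"

definition Ak_closeness_tester ::
    "nat \<Rightarrow> nat \<Rightarrow> real \<Rightarrow> nat \<Rightarrow> nat \<Rightarrow> tester \<Rightarrow> bool" where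
  "Ak_closeness_tester V k \<epsilon> m\<^sub>p m\<^sub>q T \<longleftrightarrow>
     (\<forall>p q. set_pmf p \<subseteq> grid V \<longrightarrow> set_pmf q \<subseteq> grid V \<longrightarrow>
        (p = q \<longrightarrow> pmf (run_tester T m\<^sub>p m\<^sub>q p q) True \<ge> 2/3) \<and>
        (Ak_dist k p q \<ge> \<epsilon> \<longrightarrow> pmf (run_tester T m\<^sub>p m\<^sub>q p q) False \<ge> 2/3))"

(* For V \<ge> 16 all iterated logarithms are positive.  For V = 1 the value is 0 by totality of
   ln and (/), so the bound is trivial, as it must be: the grid carries only one distribution.
   For 2 \<le> V \<le> 15 the value is immaterial up to constants, because of the term k \<le> V
   in the minimum. *)
definition sample_bound :: "nat \<Rightarrow> nat \<Rightarrow> real \<Rightarrow> real" where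
  "sample_bound V k \<epsilon> =
     Min {real k powr (2/3) * \<epsilon> powr (-4/3) *
            (ln (ln (real V)) / ln (ln (ln (real V)))) powr (1/3),
          real k powr (6/7) * \<epsilon> powr (-8/7),
          real k}"

end

theory Submission
  imports Defs "HOL-Real_Asymp.Real_Asymp"
begin

text \<open>The grid carries about \<open>k\<close> disjoint blocks (bins).  In a bin, \<open>p\<close> and \<open>q\<close> are
  \<open>\<rho> (r + d)\<close> and \<open>\<rho> (r - d)\<close>, or \<open>\<rho> r\<close> both; here \<open>r\<close> is uniform on the \<open>4 D\<close> atoms
  \<open>(c + \<sigma> X\<^sub>a, c' + \<sigma>' Y\<^sub>a)\<close> with signs \<open>\<sigma>, \<sigma>'\<close> and \<open>a \<le> D\<close>, and \<open>d = \<sigma> \<sigma>' r\<close>.  The scales \<open>X\<^sub>a\<close> are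
  random and grow rapidly with \<open>a\<close>, the scales \<open>Y\<^sub>a\<close> decrease.  One quadrant of the diamond
  separates \<open>p\<close> from \<open>q\<close>, but three samples do not: an expectation of \<open>r \<otimes> d \<otimes> d\<close> over samples from
  three different levels nearly vanishes, since one of the two \<open>d\<close>-atoms has the smallest scale in
  one of the two coordinates, and there its sign can be flipped without visible effect.  Only coincidences
  of levels, of probability \<open>O(1/D)\<close>, leave a trace.

  A random sign in front of \<open>d\<close> kills all odd moments, so that only bins with two or three samples
  (discrepancy \<open>\<rho>\<^sup>4 / D\<close>) or at least four samples (discrepancy \<open>\<rho>\<^sup>8\<close>) are informative.  As usual these are
  hidden among a few heavy bins in which \<open>p\<close> and \<open>q\<close> agree.  With Poissonised samples the bins are independent, and the
  chi-square divergence tensorises.  Taking \<open>D\<close> of order \<open>ln ln V\<close> gives the stated bound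
  (the construction would allow \<open>D\<close> of order \<open>ln V / ln ln V\<close>).\<close>

section \<open>Lists and shuffles\<close>

text \<open>The exponents of the bound come from one balance. With \<open>K\<close> bins and
  \<open>M\<close> samples, distance \<open>\<epsilon>\<close> forces \<open>\<rho>\<close> of order
  \<open>M * \<epsilon> / K\<close>. The heavy component alone gives a list of \<open>j\<close>
  samples in a bin a null weight of order \<open>h\<close>, so chi-square ratios are divided by
  \<open>h\<close>, of order \<open>M / K\<close>, and not by \<open>\<rho> ^ j\<close>; this is
  what hiding among heavy bins buys. The \<open>K\<close> bins together cost
  \<open>(K / h) * (\<rho> ^ 4 / D + \<rho> ^ 8)\<close>, that is \<open>M ^ 3 * \<epsilon> ^ 4 / (K
  ^ 2 * D) + M ^ 7 * \<epsilon> ^ 8 / K ^ 6\<close> up to constants. Smallness of the two terms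
  gives the first two entries of the minimum; the entry \<open>k\<close> keeps most bins light.

  A Poisson sample is encoded as an ordered list, weighted by the product of intensities over the
  factorial of its length, and lists are cut at a finite length. Every probability is then a finite
  sum, at the price of masses slightly below one. What limits \<open>D\<close> is that scales up to
  \<open>D ^ (D + 1)\<close> must fit into a block of side about \<open>sqrt V\<close>.\<close>

lemma card_shuffles_div_fact:
  assumes "set xs \<inter> set ys = {}"
  shows "real (card (shuffles xs ys)) / fact (length xs + length ys)
           = 1 / (fact (length xs) * fact (length ys))"
  using assms
  by (simp add: card_disjoint_shuffles binomial_fact)

definition short_lists :: "'a set \<Rightarrow> nat \<Rightarrow> 'a list set" where
  "short_lists A n = {xs. set xs \<subseteq> A \<and> length xs \<le> n}"

lemma finite_short_lists [simp]: "finite A \<Longrightarrow> finite (short_lists A n)"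
  unfolding short_lists_def by (rule finite_lists_length_le)

lemma short_lists_empty [simp]: "short_lists {} n = {[]}"
  by (auto simp: short_lists_def)

lemma sum_short_lists_by_length:
  assumes "finite A"
  shows "(\<Sum>xs\<in>short_lists A n. f xs) = (\<Sum>j\<le>n. \<Sum>xs | set xs \<subseteq> A \<and> length xs = j. f xs)"
proof -
  have "(\<Sum>xs\<in>short_lists A n. f xs)
      = (\<Sum>j\<le>n. \<Sum>xs\<in>{xs \<in> short_lists A n. length xs = j}. f xs)"
    by (rule sum.group [symmetric]) (use assms in \<open>auto simp: short_lists_def finite_lists_length_le\<close>)
  also have "\<dots> = (\<Sum>j\<le>n. \<Sum>xs | set xs \<subseteq> A \<and> length xs = j. f xs)"
    by (intro sum.cong refl) (auto simp: short_lists_def)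
  finally show ?thesis .
qed

lemma lists_length_0: "{xs. set xs \<subseteq> A \<and> length xs = 0} = {[]}"
  by auto

lemma sum_lists_length_Suc:
  assumes "finite A"
  shows "(\<Sum>xs | set xs \<subseteq> A \<and> length xs = Suc j. f xs)
       = (\<Sum>x\<in>A. \<Sum>xs | set xs \<subseteq> A \<and> length xs = j. f (x # xs))"
proof -
  have "{xs. set xs \<subseteq> A \<and> length xs = Suc j}
      = (\<lambda>(x, xs). x # xs) ` (A \<times> {xs. set xs \<subseteq> A \<and> length xs = j})"
    by (auto simp: length_Suc_conv image_iff)
  moreover have "inj_on (\<lambda>(x, xs). x # xs) (A \<times> {xs. set xs \<subseteq> A \<and> length xs = j})"
    by (auto simp: inj_on_def)
  ultimately show ?thesis
    by (simp add: sum.reindex sum.cartesian_product case_prod_unfold o_def)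
qed

lemma sum_lists_prod_list:
  fixes f :: "'a \<Rightarrow> 'b::comm_semiring_1"
  assumes "finite A"
  shows "(\<Sum>xs | set xs \<subseteq> A \<and> length xs = j. \<Prod>x\<leftarrow>xs. f x) = (\<Sum>x\<in>A. f x) ^ j"
  by (induction j)
     (simp_all add: lists_length_0 sum_lists_length_Suc assms sum_distrib_left [symmetric]
       sum_distrib_right [symmetric] del: length_0_conv)

text \<open>Independence of a Poisson sample on two disjoint sets. A list over the union is an
  interleaving of its two sublists, and the binomial number of interleavings turns the factorial of
  the joint length into the two separate factorials.\<close>

lemma sum_shuffles:
  fixes h :: "'a list \<Rightarrow> 'a list \<Rightarrow> real"
  assumes "finite A" "finite B" "A \<inter> B = {}"
  shows "(\<Sum>zs | set zs \<subseteq> A \<union> B \<and> length (filter (\<lambda>z. z \<in> A) zs) \<le> n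
            \<and> length (filter (\<lambda>z. z \<notin> A) zs) \<le> m.
            h (filter (\<lambda>z. z \<in> A) zs) (filter (\<lambda>z. z \<notin> A) zs) / fact (length zs))
       = (\<Sum>xs\<in>short_lists A n. \<Sum>ys\<in>short_lists B m.
            h xs ys / (fact (length xs) * fact (length ys)))"
    (is "sum ?f ?S = _")
proof -
  define g where "g zs = (filter (\<lambda>z. z \<in> A) zs, filter (\<lambda>z. z \<notin> A) zs)" for zs
  have S: "?S = {zs. set zs \<subseteq> A \<union> B \<and> fst (g zs) \<in> short_lists A n \<and> snd (g zs) \<in> short_lists B m}"
    by (auto simp: g_def short_lists_def)
  have "length zs \<le> n + m" if "zs \<in> ?S" for zs
    using that sum_length_filter_compl [of "\<lambda>z. z \<in> A" zs] by auto
  then have "?S \<subseteq> short_lists (A \<union> B) (n + m)"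
    by (auto simp: short_lists_def)
  then have fin: "finite ?S"
    by (rule finite_subset) (use assms in simp)
  have sub: "g ` ?S \<subseteq> short_lists A n \<times> short_lists B m"
    by (auto simp: g_def short_lists_def)
  have fiber: "{zs \<in> ?S. g zs = (xs, ys)} = shuffles xs ys"
    if xs: "xs \<in> short_lists A n" and ys: "ys \<in> short_lists B m" for xs ys
  proof (intro set_eqI iffI)
    fix zs assume "zs \<in> {zs \<in> ?S. g zs = (xs, ys)}"
    then show "zs \<in> shuffles xs ys"
      using partition_in_shuffles [of zs "\<lambda>z. z \<in> A"] by (auto simp: g_def)
  next
    fix zs assume zs: "zs \<in> shuffles xs ys"
    have sx: "set xs \<subseteq> A" and sy: "set ys \<subseteq> B"
      using xs ys by (auto simp: short_lists_def)
    have "filter (\<lambda>z. z \<in> A) zs \<in> shuffles (filter (\<lambda>z. z \<in> A) xs) (filter (\<lambda>z. z \<in> A) ys)"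
      using zs filter_shuffles by blast
    moreover have "filter (\<lambda>z. z \<in> A) xs = xs" "filter (\<lambda>z. z \<in> A) ys = []"
      using sx sy assms(3) by (auto simp: filter_id_conv filter_empty_conv)
    ultimately have 1: "filter (\<lambda>z. z \<in> A) zs = xs"
      by simp
    have "filter (\<lambda>z. z \<notin> A) zs \<in> shuffles (filter (\<lambda>z. z \<notin> A) xs) (filter (\<lambda>z. z \<notin> A) ys)"
      using zs filter_shuffles by blast
    moreover have "filter (\<lambda>z. z \<notin> A) ys = ys" "filter (\<lambda>z. z \<notin> A) xs = []"
      using sx sy assms(3) by (auto simp: filter_id_conv filter_empty_conv)
    ultimately have 2: "filter (\<lambda>z. z \<notin> A) zs = ys"
      by simp
    have "set zs \<subseteq> A \<union> B"
      using set_shuffles [OF zs] sx sy by auto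
    then show "zs \<in> {zs \<in> ?S. g zs = (xs, ys)}"
      using 1 2 xs ys by (auto simp: g_def short_lists_def)
  qed
  have "sum ?f ?S = (\<Sum>p\<in>short_lists A n \<times> short_lists B m. \<Sum>zs\<in>{zs \<in> ?S. g zs = p}. ?f zs)"
    by (rule sum.group [symmetric]) (use assms fin sub in auto)
  also have "\<dots> = (\<Sum>(xs, ys)\<in>short_lists A n \<times> short_lists B m.
            h xs ys / (fact (length xs) * fact (length ys)))"
  proof (intro sum.cong refl, clarify)
    fix xs ys assume xs: "xs \<in> short_lists A n" and ys: "ys \<in> short_lists B m"
    have "(\<Sum>zs\<in>{zs \<in> ?S. g zs = (xs, ys)}. ?f zs)
        = (\<Sum>zs\<in>{zs \<in> ?S. g zs = (xs, ys)}. h xs ys / fact (length xs + length ys))"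
    proof (rule sum.cong [OF refl])
      fix zs assume zs: "zs \<in> {zs \<in> ?S. g zs = (xs, ys)}"
      then have "length zs = length xs + length ys"
        using fiber [OF xs ys] length_shuffles by blast
      then show "?f zs = h xs ys / fact (length xs + length ys)"
        using zs by (simp add: g_def)
    qed
    also have "\<dots> = h xs ys * (real (card (shuffles xs ys)) / fact (length xs + length ys))"
      using fiber [OF xs ys] by simp
    also have "\<dots> = h xs ys / (fact (length xs) * fact (length ys))"
    proof -
      have "set xs \<inter> set ys = {}"
        using xs ys assms(3) by (auto simp: short_lists_def)
      then show ?thesis
        by (simp add: card_shuffles_div_fact)
    qed
    finally show "(\<Sum>zs\<in>{zs \<in> ?S. g zs = (xs, ys)}. ?f zs)
        = h xs ys / (fact (length xs) * fact (length ys))" .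
  qed
  also have "\<dots> = (\<Sum>xs\<in>short_lists A n. \<Sum>ys\<in>short_lists B m.
            h xs ys / (fact (length xs) * fact (length ys)))"
    by (rule sum.cartesian_product [symmetric])
  finally show ?thesis .
qed

section \<open>Sorting a list into bins\<close>

definition in_bin :: "'b \<Rightarrow> ('b \<times> 'y) list \<Rightarrow> 'y list" where
  "in_bin b zs = map snd (filter (\<lambda>z. fst z = b) zs)"

lemma in_bin_Nil [simp]: "in_bin b [] = []"
  by (simp add: in_bin_def)

lemma in_bin_Cons: "in_bin b (z # zs) = (if fst z = b then snd z # in_bin b zs else in_bin b zs)"
  by (simp add: in_bin_def)

lemma set_in_bin: "set zs \<subseteq> B \<times> Y \<Longrightarrow> set (in_bin b zs) \<subseteq> Y"
  by (auto simp: in_bin_def)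

text \<open>Iterated splitting, one bin at a time. The factor
  \<open>fact (length (in_bin b zs))\<close> appears because \<open>g b\<close> stands for a weight
  that already contains its own inverse factorial. Truncation leaves only an inequality: the right
  side allows \<open>n\<close> letters in each bin, the left side \<open>n\<close>
  altogether.\<close>

lemma sum_short_lists_in_bins:
  fixes g :: "'b \<Rightarrow> 'y list \<Rightarrow> real"
  assumes "finite B" "finite Y" "\<And>b l. g b l \<ge> 0"
  shows "(\<Sum>zs\<in>short_lists (B \<times> Y) n.
            (\<Prod>b\<in>B. fact (length (in_bin b zs)) * g b (in_bin b zs)) / fact (length zs))
       \<le> (\<Prod>b\<in>B. \<Sum>l\<in>short_lists Y n. g b l)"
  using assms(1)
proof (induction B rule: finite_induct)
  case empty
  then show ?case by simp
next
  case (insert b B)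
  define A where "A = {b} \<times> Y"
  let ?G = "\<lambda>zs. \<Prod>b\<in>B. fact (length (in_bin b zs)) * g b (in_bin b zs)"
  let ?h = "\<lambda>xs ys. fact (length xs) * g b (map snd xs) * ?G ys"
  have un: "insert b B \<times> Y = A \<union> B \<times> Y"
    by (auto simp: A_def)
  have dis: "A \<inter> B \<times> Y = {}"
    using insert by (auto simp: A_def)
  have fA: "finite A" and fB: "finite (B \<times> Y)"
    using insert assms by (auto simp: A_def)
  let ?S = "{zs. set zs \<subseteq> A \<union> B \<times> Y \<and> length (filter (\<lambda>z. z \<in> A) zs) \<le> n
            \<and> length (filter (\<lambda>z. z \<notin> A) zs) \<le> n}"
  have fS: "finite ?S"
  proof (rule finite_subset)
    have "length zs \<le> n + n" if "zs \<in> ?S" for zs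
      using that sum_length_filter_compl [of "\<lambda>z. z \<in> A" zs] by auto
    then show "?S \<subseteq> short_lists (A \<union> B \<times> Y) (n + n)"
      by (auto simp: short_lists_def)
    show "finite (short_lists (A \<union> B \<times> Y) (n + n))"
      using fA fB by simp
  qed
  have split: "(\<Prod>b\<in>insert b B. fact (length (in_bin b zs)) * g b (in_bin b zs))
      = ?h (filter (\<lambda>z. z \<in> A) zs) (filter (\<lambda>z. z \<notin> A) zs)"
    if zs: "set zs \<subseteq> A \<union> B \<times> Y" for zs
  proof -
    have "filter (\<lambda>z. fst z = b) zs = filter (\<lambda>z. z \<in> A) zs"
      using zs by (intro filter_cong) (auto simp: A_def)
    then have 1: "in_bin b zs = map snd (filter (\<lambda>z. z \<in> A) zs)"
      by (simp add: in_bin_def)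
    have 2: "in_bin b' (filter (\<lambda>z. z \<notin> A) zs) = in_bin b' zs" if "b' \<in> B" for b'
    proof -
      have "b' \<noteq> b" using that insert by auto
      then have "filter (\<lambda>z. fst z = b') (filter (\<lambda>z. z \<notin> A) zs) = filter (\<lambda>z. fst z = b') zs"
        unfolding filter_filter by (intro filter_cong) (auto simp: A_def)
      then show ?thesis by (simp add: in_bin_def)
    qed
    show ?thesis
      using insert by (simp add: 1 2)
  qed
  have "(\<Sum>zs\<in>short_lists (insert b B \<times> Y) n.
            (\<Prod>b\<in>insert b B. fact (length (in_bin b zs)) * g b (in_bin b zs)) / fact (length zs))
      = (\<Sum>zs\<in>short_lists (insert b B \<times> Y) n.
            ?h (filter (\<lambda>z. z \<in> A) zs) (filter (\<lambda>z. z \<notin> A) zs) / fact (length zs))"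
    by (intro sum.cong refl arg_cong2 [where f = "(/)"] split) (auto simp: short_lists_def un)
  \<comment> \<open>Separate length bounds for bin \<open>b\<close> and for the other bins only add
    nonnegative terms, and they are the shape that splits exactly.\<close>
  also have "\<dots> \<le> (\<Sum>zs\<in>?S. ?h (filter (\<lambda>z. z \<in> A) zs) (filter (\<lambda>z. z \<notin> A) zs) / fact (length zs))"
  proof (rule sum_mono2 [OF fS])
    show "short_lists (insert b B \<times> Y) n \<subseteq> ?S"
      by (auto simp: short_lists_def un intro: order_trans [OF length_filter_le])
    show "0 \<le> ?h (filter (\<lambda>z. z \<in> A) zs) (filter (\<lambda>z. z \<notin> A) zs) / fact (length zs)" for zs
      using assms by (intro divide_nonneg_nonneg mult_nonneg_nonneg prod_nonneg) auto
  qed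
  also have "\<dots> = (\<Sum>xs\<in>short_lists A n. \<Sum>ys\<in>short_lists (B \<times> Y) n.
            ?h xs ys / (fact (length xs) * fact (length ys)))"
    by (rule sum_shuffles [OF fA fB dis])
  also have "\<dots> = (\<Sum>xs\<in>short_lists A n. g b (map snd xs)) *
            (\<Sum>ys\<in>short_lists (B \<times> Y) n. ?G ys / fact (length ys))"
    unfolding sum_product by (intro sum.cong refl) (simp add: field_simps)
  also have "(\<Sum>xs\<in>short_lists A n. g b (map snd xs)) = (\<Sum>l\<in>short_lists Y n. g b l)"
    by (rule sum.reindex_bij_witness [of _ "map (Pair b)" "map snd"])
       (auto simp: short_lists_def A_def o_def intro!: map_idI)
  also have "(\<Sum>l\<in>short_lists Y n. g b l) * (\<Sum>ys\<in>short_lists (B \<times> Y) n. ?G ys / fact (length ys))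
      \<le> (\<Sum>l\<in>short_lists Y n. g b l) * (\<Prod>b\<in>B. \<Sum>l\<in>short_lists Y n. g b l)"
    by (intro mult_left_mono insert.IH sum_nonneg assms(3))
  finally show ?case
    using insert by simp
qed

section \<open>Poisson lists and products of mixtures\<close>

text \<open>Cauchy-Schwarz with the weights \<open>sqrt (P x)\<close>. The functions are meant to be
  truncated distributions, whose masses need not be one, so both masses stay in the chi-square
  factor. Points with \<open>P x = 0\<close> drop out since \<open>Q x = 0\<close> there and
  division by zero gives zero.\<close>

lemma sum_abs_diff_le_chi_square:
  fixes P Q :: "'a \<Rightarrow> real"
  assumes "finite F" "\<And>x. x \<in> F \<Longrightarrow> P x \<ge> 0" "\<And>x. x \<in> F \<Longrightarrow> P x = 0 \<Longrightarrow> Q x = 0"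
  shows "(\<Sum>x\<in>F. \<bar>P x - Q x\<bar>)\<^sup>2
       \<le> (\<Sum>x\<in>F. P x) * ((\<Sum>x\<in>F. (Q x)\<^sup>2 / P x) - 2 * (\<Sum>x\<in>F. Q x) + (\<Sum>x\<in>F. P x))"
proof -
  have "(\<Sum>x\<in>F. \<bar>P x - Q x\<bar>)\<^sup>2 = (\<Sum>x\<in>F. sqrt (P x) * (\<bar>P x - Q x\<bar> / sqrt (P x)))\<^sup>2"
    using assms by (intro arg_cong [where f = "\<lambda>x. x\<^sup>2"] sum.cong refl) (metis
        cancel_comm_monoid_add_class.diff_cancel abs_zero div_0 mult_zero_right
        nonzero_mult_div_cancel_left real_sqrt_eq_zero_cancel_iff times_divide_eq_right)
  also have "\<dots> \<le> (\<Sum>x\<in>F. (sqrt (P x))\<^sup>2) * (\<Sum>x\<in>F. (\<bar>P x - Q x\<bar> / sqrt (P x))\<^sup>2)"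
    by (rule Cauchy_Schwarz_ineq_sum)
  also have "(\<Sum>x\<in>F. (sqrt (P x))\<^sup>2) = (\<Sum>x\<in>F. P x)"
    using assms by (intro sum.cong) auto
  also have "(\<Sum>x\<in>F. (\<bar>P x - Q x\<bar> / sqrt (P x))\<^sup>2) = (\<Sum>x\<in>F. (Q x)\<^sup>2 / P x - 2 * Q x + P x)"
  proof (rule sum.cong [OF refl])
    fix x assume x: "x \<in> F"
    show "(\<bar>P x - Q x\<bar> / sqrt (P x))\<^sup>2 = (Q x)\<^sup>2 / P x - 2 * Q x + P x"
    proof (cases "P x = 0")
      case True
      then show ?thesis using assms x by simp
    next
      case False
      then show ?thesis using assms(2) [OF x]
        by (simp add: power_divide field_simps power2_eq_square)
    qed
  qed
  also have "\<dots> = (\<Sum>x\<in>F. (Q x)\<^sup>2 / P x) - 2 * (\<Sum>x\<in>F. Q x) + (\<Sum>x\<in>F. P x)"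
    by (simp add: sum.distrib sum_subtractf sum_distrib_left)
  finally show ?thesis .
qed

text \<open>Density of a Poisson process with intensity \<open>m\<close> whose points are listed in
  uniformly random order: the lists of length \<open>j\<close> have total weight
  \<open>exp (- T) * T ^ j / fact j\<close> for \<open>T = sum m Z\<close>.\<close>

definition poisson_weight :: "'z set \<Rightarrow> ('z \<Rightarrow> real) \<Rightarrow> 'z list \<Rightarrow> real" where
  "poisson_weight Z m zs = exp (- sum m Z) * (\<Prod>z\<leftarrow>zs. m z) / fact (length zs)"

lemma prod_list_map_nonneg:
  fixes f :: "'a \<Rightarrow> real"
  shows "(\<And>x. x \<in> set xs \<Longrightarrow> f x \<ge> 0) \<Longrightarrow> (\<Prod>x\<leftarrow>xs. f x) \<ge> 0"
  by (induction xs) auto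

lemma poisson_weight_nonneg:
  "(\<And>z. z \<in> Z \<Longrightarrow> m z \<ge> 0) \<Longrightarrow> set zs \<subseteq> Z \<Longrightarrow> poisson_weight Z m zs \<ge> 0"
  unfolding poisson_weight_def
  by (intro divide_nonneg_nonneg mult_nonneg_nonneg prod_list_map_nonneg) auto

lemma prod_list_in_bins:
  fixes m :: "'b \<Rightarrow> 'y \<Rightarrow> 'c::comm_semiring_1"
  assumes "finite B" "set zs \<subseteq> B \<times> Y"
  shows "(\<Prod>(b, y)\<leftarrow>zs. m b y) = (\<Prod>b\<in>B. \<Prod>y\<leftarrow>in_bin b zs. m b y)"
  using assms(2)
proof (induction zs)
  case Nil
  then show ?case by simp
next
  case (Cons z zs)
  have "(\<Prod>b\<in>B. \<Prod>y\<leftarrow>in_bin b (z # zs). m b y)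
      = (\<Prod>b\<in>B. (if b = fst z then m b (snd z) else 1) * (\<Prod>y\<leftarrow>in_bin b zs. m b y))"
    by (intro prod.cong) (auto simp: in_bin_Cons)
  also have "\<dots> = m (fst z) (snd z) * (\<Prod>b\<in>B. \<Prod>y\<leftarrow>in_bin b zs. m b y)"
    using Cons.prems assms(1) by (auto simp: prod.distrib prod.delta)
  finally show ?case using Cons by (simp add: case_prod_unfold)
qed

lemma poisson_weight_in_bins:
  assumes "finite B" "set zs \<subseteq> B \<times> Y"
  shows "poisson_weight (B \<times> Y) (\<lambda>(b, y). m b y) zs
       = (\<Prod>b\<in>B. fact (length (in_bin b zs)) * poisson_weight Y (m b) (in_bin b zs))
           / fact (length zs)"
proof -
  have "(\<Sum>(b, y)\<in>B \<times> Y. m b y) = (\<Sum>b\<in>B. \<Sum>y\<in>Y. m b y)"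
    by (simp add: sum.cartesian_product)
  then show ?thesis
    using assms
    by (simp add: poisson_weight_def prod_list_in_bins [of B zs Y] exp_sum sum_negf [symmetric]
        prod.distrib)
qed

section \<open>Mixtures over hidden parameters\<close>

definition mixture :: "'t set \<Rightarrow> ('t \<Rightarrow> real) \<Rightarrow> 'y set \<Rightarrow> ('t \<Rightarrow> 'y \<Rightarrow> real) \<Rightarrow> 'y list \<Rightarrow> real" where
  "mixture \<Theta> \<pi> Y m l = (\<Sum>t\<in>\<Theta>. \<pi> t * poisson_weight Y (m t) l)"

definition product_prior :: "'b set \<Rightarrow> ('t \<Rightarrow> real) \<Rightarrow> ('b \<Rightarrow> 't) \<Rightarrow> real" where
  "product_prior B \<pi> \<theta> = (\<Prod>b\<in>B. \<pi> (\<theta> b))"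

text \<open>With independent parameters in the bins, the product of the sums over
  \<open>\<Theta>\<close> expands into one sum over all choice functions.\<close>

lemma mixture_product_prior:
  assumes "finite B" "finite \<Theta>" "set zs \<subseteq> B \<times> Y"
  shows "mixture (B \<rightarrow>\<^sub>E \<Theta>) (product_prior B \<pi>) (B \<times> Y) (\<lambda>\<theta> (b, y). m b (\<theta> b) y) zs
       = (\<Prod>b\<in>B. fact (length (in_bin b zs)) * mixture \<Theta> \<pi> Y (m b) (in_bin b zs))
           / fact (length zs)"
proof -
  have "(\<Prod>b\<in>B. fact (length (in_bin b zs)) * mixture \<Theta> \<pi> Y (m b) (in_bin b zs))
      = (\<Prod>b\<in>B. \<Sum>t\<in>\<Theta>. fact (length (in_bin b zs)) * (\<pi> t * poisson_weight Y (m b t) (in_bin b zs)))"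
    by (simp add: mixture_def sum_distrib_left)
  also have "\<dots> = (\<Sum>\<theta>\<in>B \<rightarrow>\<^sub>E \<Theta>. \<Prod>b\<in>B. fact (length (in_bin b zs)) *
            (\<pi> (\<theta> b) * poisson_weight Y (m b (\<theta> b)) (in_bin b zs)))"
    using assms by (intro prod_sum_PiE) auto
  also have "\<dots> / fact (length zs)
      = mixture (B \<rightarrow>\<^sub>E \<Theta>) (product_prior B \<pi>) (B \<times> Y) (\<lambda>\<theta> (b, y). m b (\<theta> b) y) zs"
    unfolding mixture_def sum_divide_distrib
    by (intro sum.cong refl)
       (use assms in \<open>simp add: poisson_weight_in_bins [of B zs Y] product_prior_def prod.distrib\<close>)
  finally show ?thesis by simp
qed

lemma mixture_nonneg:
  assumes "\<And>t. t \<in> \<Theta> \<Longrightarrow> \<pi> t \<ge> 0" "\<And>t y. t \<in> \<Theta> \<Longrightarrow> y \<in> Y \<Longrightarrow> m t y \<ge> 0" "set l \<subseteq> Y"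
  shows "mixture \<Theta> \<pi> Y m l \<ge> 0"
  unfolding mixture_def using assms
  by (intro sum_nonneg mult_nonneg_nonneg poisson_weight_nonneg) auto

text \<open>Chi-square divergence is multiplicative over independent bins, the L1 distance is not;
  so closeness is measured bin by bin in chi-square and converted by Cauchy-Schwarz only once, for
  the whole list. \<open>t\<close> bounds the mass that \<open>Q\<close> loses by restriction to
  \<open>F\<close>; it enters through the term \<open>- 2 * \<Sum>Q\<close>.\<close>

lemma product_mixtures_close:
  fixes B :: "'b set" and \<Theta> :: "'t set" and Y :: "'y set"
    and \<pi> :: "'t \<Rightarrow> real" and m0 m1 :: "'b \<Rightarrow> 't \<Rightarrow> 'y \<Rightarrow> real" and t :: real and c :: "'b \<Rightarrow> real"
  defines "P \<equiv> mixture (B \<rightarrow>\<^sub>E \<Theta>) (product_prior B \<pi>) (B \<times> Y) (\<lambda>\<theta> (b, y). m0 b (\<theta> b) y)"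
    and "Q \<equiv> mixture (B \<rightarrow>\<^sub>E \<Theta>) (product_prior B \<pi>) (B \<times> Y) (\<lambda>\<theta> (b, y). m1 b (\<theta> b) y)"
  assumes fin: "finite B" "finite \<Theta>" "finite Y"
    and pos: "\<And>t. t \<in> \<Theta> \<Longrightarrow> \<pi> t \<ge> 0" "\<And>b t y. b \<in> B \<Longrightarrow> t \<in> \<Theta> \<Longrightarrow> y \<in> Y \<Longrightarrow> m0 b t y \<ge> 0"
    and ac: "\<And>b l. b \<in> B \<Longrightarrow> set l \<subseteq> Y \<Longrightarrow> mixture \<Theta> \<pi> Y (m0 b) l = 0 \<Longrightarrow> mixture \<Theta> \<pi> Y (m1 b) l = 0"
    and chi: "\<And>b. b \<in> B \<Longrightarrow>
          (\<Sum>l\<in>short_lists Y n. (mixture \<Theta> \<pi> Y (m1 b) l)\<^sup>2 / mixture \<Theta> \<pi> Y (m0 b) l) \<le> 1 + c b"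
    and F: "F \<subseteq> short_lists (B \<times> Y) n" and "(\<Sum>zs\<in>F. P zs) \<le> 1" "(\<Sum>zs\<in>F. Q zs) \<ge> 1 - t"
  shows "(\<Sum>zs\<in>F. \<bar>P zs - Q zs\<bar>)\<^sup>2 \<le> (\<Prod>b\<in>B. 1 + c b) - 1 + 2 * t"
proof -
  let ?p = "\<lambda>b l. mixture \<Theta> \<pi> Y (m0 b) l" and ?q = "\<lambda>b l. mixture \<Theta> \<pi> Y (m1 b) l"
  let ?S = "short_lists (B \<times> Y) n"
  have finS: "finite ?S" using fin by simp
  have finF: "finite F" using F finS finite_subset by blast
  have p_nonneg: "?p b l \<ge> 0" if "b \<in> B" "set l \<subseteq> Y" for b l
    using that pos by (intro mixture_nonneg) auto
  have sub: "set zs \<subseteq> B \<times> Y" if "zs \<in> ?S" for zs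
    using that by (auto simp: short_lists_def)
  have P: "P zs = (\<Prod>b\<in>B. fact (length (in_bin b zs)) * ?p b (in_bin b zs)) / fact (length zs)"
    and Q: "Q zs = (\<Prod>b\<in>B. fact (length (in_bin b zs)) * ?q b (in_bin b zs)) / fact (length zs)"
    if "zs \<in> ?S" for zs
    unfolding P_def Q_def using fin sub [OF that] by (intro mixture_product_prior; simp)+
  have P_nonneg: "P zs \<ge> 0" if "zs \<in> ?S" for zs
    unfolding P [OF that]
    by (intro divide_nonneg_nonneg prod_nonneg) (use p_nonneg set_in_bin [OF sub [OF that]] in auto)
  have PQ: "Q zs = 0" if "zs \<in> ?S" "P zs = 0" for zs
    using that fin ac set_in_bin [OF sub [OF that(1)]] by (fastforce simp: P Q)
  \<comment> \<open>The ratio is continued by zero off the alphabet because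
    \<open>sum_short_lists_in_bins\<close> asks for nonnegativity at every list.\<close>
  define g where "g b l = (if b \<in> B \<and> set l \<subseteq> Y then (?q b l)\<^sup>2 / ?p b l else 0)" for b l
  have "(\<Sum>zs\<in>F. (Q zs)\<^sup>2 / P zs) \<le> (\<Sum>zs\<in>?S. (Q zs)\<^sup>2 / P zs)"
    by (rule sum_mono2 [OF finS F]) (use P_nonneg in auto)
  also have "\<dots> = (\<Sum>zs\<in>?S. (\<Prod>b\<in>B. fact (length (in_bin b zs)) * g b (in_bin b zs)) / fact (length zs))"
  proof (rule sum.cong [OF refl])
    fix zs assume zs: "zs \<in> ?S"
    have "(Q zs)\<^sup>2 / P zs = (\<Prod>b\<in>B. fact (length (in_bin b zs))) *
        ((\<Prod>b\<in>B. ?q b (in_bin b zs))\<^sup>2 / (\<Prod>b\<in>B. ?p b (in_bin b zs))) / fact (length zs)"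
      unfolding P [OF zs] Q [OF zs] prod.distrib
      by (simp add: power2_eq_square mult_ac)
    also have "\<dots> = (\<Prod>b\<in>B. fact (length (in_bin b zs)) *
        ((?q b (in_bin b zs))\<^sup>2 / ?p b (in_bin b zs))) / fact (length zs)"
      unfolding prod.distrib prod_dividef prod_power_distrib by simp
    also have "\<dots> = (\<Prod>b\<in>B. fact (length (in_bin b zs)) * g b (in_bin b zs)) / fact (length zs)"
      using set_in_bin [OF sub [OF zs]] by (simp add: g_def)
    finally show "(Q zs)\<^sup>2 / P zs = \<dots>" .
  qed
  also have "\<dots> \<le> (\<Prod>b\<in>B. \<Sum>l\<in>short_lists Y n. g b l)"
    by (rule sum_short_lists_in_bins) (use fin p_nonneg in \<open>auto simp: g_def\<close>)
  also have "\<dots> \<le> (\<Prod>b\<in>B. 1 + c b)"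
  proof (rule prod_mono, intro conjI)
    fix b assume b: "b \<in> B"
    show "0 \<le> (\<Sum>l\<in>short_lists Y n. g b l)"
      by (intro sum_nonneg) (use p_nonneg in \<open>auto simp: g_def\<close>)
    have "(\<Sum>l\<in>short_lists Y n. g b l) = (\<Sum>l\<in>short_lists Y n. (?q b l)\<^sup>2 / ?p b l)"
      using b by (intro sum.cong) (auto simp: g_def short_lists_def)
    then show "(\<Sum>l\<in>short_lists Y n. g b l) \<le> 1 + c b"
      using chi [OF b] by simp
  qed
  finally have chiF: "(\<Sum>zs\<in>F. (Q zs)\<^sup>2 / P zs) \<le> (\<Prod>b\<in>B. 1 + c b)" .
  let ?X = "(\<Sum>zs\<in>F. (Q zs)\<^sup>2 / P zs) - 2 * (\<Sum>zs\<in>F. Q zs) + (\<Sum>zs\<in>F. P zs)"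
  have 1: "(\<Sum>zs\<in>F. \<bar>P zs - Q zs\<bar>)\<^sup>2 \<le> (\<Sum>zs\<in>F. P zs) * ?X"
    by (rule sum_abs_diff_le_chi_square) (use finF F P_nonneg PQ in auto)
  have sP: "0 \<le> (\<Sum>zs\<in>F. P zs)"
    using F P_nonneg by (intro sum_nonneg) auto
  have "(\<Sum>zs\<in>F. P zs) * ?X \<le> (\<Sum>zs\<in>F. P zs) * ((\<Prod>b\<in>B. 1 + c b) - 1 + 2 * t)"
    using chiF assms by (intro mult_left_mono sP) linarith
  also have "\<dots> \<le> (\<Prod>b\<in>B. 1 + c b) - 1 + 2 * t" if "(\<Prod>b\<in>B. 1 + c b) - 1 + 2 * t \<ge> 0"
    using mult_right_mono [OF \<open>(\<Sum>zs\<in>F. P zs) \<le> 1\<close> that] by simp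
  \<comment> \<open>\<open>?X\<close> is a sum of terms \<open>(Q - P)\<^sup>2 / P\<close>. Its sign
    shows that the final bound is nonnegative, so that the factor \<open>\<Sum>P \<le> 1\<close> may
    be dropped.\<close>
  moreover have "?X \<ge> 0"
  proof -
    have "?X = (\<Sum>zs\<in>F. (Q zs)\<^sup>2 / P zs - 2 * Q zs + P zs)"
      by (simp add: sum.distrib sum_subtractf sum_distrib_left)
    also have "\<dots> \<ge> 0"
    proof (rule sum_nonneg)
      fix zs assume "zs \<in> F"
      then have zs: "zs \<in> ?S" using F by auto
      show "(Q zs)\<^sup>2 / P zs - 2 * Q zs + P zs \<ge> 0"
      proof (cases "P zs = 0")
        case True then show ?thesis using PQ zs by simp
      next
        case False
        then have "(Q zs)\<^sup>2 / P zs - 2 * Q zs + P zs = (Q zs - P zs)\<^sup>2 / P zs"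
          by (simp add: field_simps power2_eq_square)
        then show ?thesis using P_nonneg [OF zs] by simp
      qed
    qed
    finally show ?thesis .
  qed
  then have "(\<Prod>b\<in>B. 1 + c b) - 1 + 2 * t \<ge> 0"
    using chiF assms by linarith
  ultimately show ?thesis using 1 by linarith
qed

section \<open>A single bin\<close>

definition poisson_cdf :: "real \<Rightarrow> nat \<Rightarrow> real" where
  "poisson_cdf T n = exp (- T) * (\<Sum>j\<le>n. T ^ j / fact j)"

lemma sum_exp_series_le:
  fixes T :: real
  assumes "T \<ge> 0" "finite J"
  shows "(\<Sum>j\<in>J. T ^ j / fact j) \<le> exp T"
proof -
  have "(\<Sum>j\<in>J. T ^ j /\<^sub>R fact j) \<le> (\<Sum>j. T ^ j /\<^sub>R fact j)"
    using assms by (intro sum_le_suminf summable_exp_generic) auto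
  then show ?thesis
    by (simp add: exp_def divide_inverse mult.commute)
qed

lemma poisson_cdf_le_1: "T \<ge> 0 \<Longrightarrow> poisson_cdf T n \<le> 1"
  using mult_left_mono [OF sum_exp_series_le [of T "{..n}"], of "exp (- T)"]
  by (simp add: poisson_cdf_def exp_minus field_simps)

lemma sum_poisson_weight:
  assumes "finite Z"
  shows "(\<Sum>l\<in>short_lists Z n. poisson_weight Z m l) = poisson_cdf (sum m Z) n"
proof -
  have "(\<Sum>l | set l \<subseteq> Z \<and> length l = j. poisson_weight Z m l)
      = exp (- sum m Z) * (sum m Z ^ j / fact j)" for j
  proof -
    have "(\<Sum>l | set l \<subseteq> Z \<and> length l = j. poisson_weight Z m l)
        = (\<Sum>l | set l \<subseteq> Z \<and> length l = j. exp (- sum m Z) / fact j * (\<Prod>z\<leftarrow>l. m z))"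
      by (intro sum.cong) (auto simp: poisson_weight_def)
    also have "\<dots> = exp (- sum m Z) / fact j * sum m Z ^ j"
      by (simp only: sum_distrib_left [symmetric] sum_lists_prod_list assms)
    finally show ?thesis by simp
  qed
  then show ?thesis
    by (simp add: sum_short_lists_by_length assms poisson_cdf_def sum_distrib_left)
qed

lemma sum_mixture:
  assumes "finite Y"
  shows "(\<Sum>l\<in>short_lists Y n. mixture \<Theta> \<pi> Y m l) = (\<Sum>t\<in>\<Theta>. \<pi> t * poisson_cdf (sum (m t) Y) n)"
  unfolding mixture_def
  by (subst sum.swap) (simp add: sum_distrib_left [symmetric] sum_poisson_weight assms)

section \<open>The two hypotheses inside one bin\<close>

lemma prod_list_const_mult:
  fixes c :: real
  shows "(\<Prod>(x, \<tau>)\<leftarrow>l. c * f x \<tau>) = c ^ length l * (\<Prod>(x, \<tau>)\<leftarrow>l. f x \<tau>)"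
  by (induction l) auto

text \<open>The label \<open>True\<close> marks a sample of \<open>p\<close>, \<open>False\<close>
  one of \<open>q\<close>; the perturbation enters the two with opposite signs.\<close>

definition label_sign :: "bool \<Rightarrow> real" where
  "label_sign \<tau> = (if \<tau> then 1 else - 1)"

lemma label_sign_simps [simp]: "label_sign True = 1" "label_sign False = - 1"
  by (simp_all add: label_sign_def)

text \<open>Mean over the hidden scales of the density of the whole list given the scales. The
  factors that depend on \<open>h\<close> and \<open>\<rho>\<close> are split off in
  \<open>mixture_null\<close> and \<open>mixture_alt\<close>.\<close>

definition avg_null :: "'w set \<Rightarrow> ('w \<Rightarrow> 'x \<Rightarrow> real) \<Rightarrow> ('x \<times> bool) list \<Rightarrow> real" where
  "avg_null W r l = (\<Sum>w\<in>W. \<Prod>(x, \<tau>)\<leftarrow>l. r w x) / card W"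

definition avg_alt ::
  "'w set \<Rightarrow> ('w \<Rightarrow> 'x \<Rightarrow> real) \<Rightarrow> ('w \<Rightarrow> 'x \<Rightarrow> real) \<Rightarrow> ('x \<times> bool) list \<Rightarrow> real" where
  "avg_alt W r d l =
     (\<Sum>w\<in>W. \<Sum>s\<in>{-1, 1}. \<Prod>(x, \<tau>)\<leftarrow>l. r w x + s * label_sign \<tau> * d w x) / (2 * card W)"

text \<open>A parameter says whether the bin is heavy, which scales are hidden in it, and which sign
  the perturbation has. Both hypotheses use the same parameters, so one prior serves for both
  mixtures and the masses can be compared parameter by parameter.\<close>

definition params :: "'w set \<Rightarrow> (bool \<times> 'w \<times> real) set" where
  "params W = UNIV \<times> W \<times> {-1, 1}"

definition prior :: "real \<Rightarrow> 'w set \<Rightarrow> bool \<times> 'w \<times> real \<Rightarrow> real" where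
  "prior h W = (\<lambda>(hv, w, s). (if hv then h else 1 - h) / (2 * card W))"

definition null_intensity ::
  "real \<Rightarrow> ('w \<Rightarrow> 'x \<Rightarrow> real) \<Rightarrow> bool \<times> 'w \<times> real \<Rightarrow> 'x \<times> bool \<Rightarrow> real" where
  "null_intensity \<rho> r = (\<lambda>(hv, w, s) (x, \<tau>). if hv then r w x else \<rho> * r w x)"

definition alt_intensity ::
  "real \<Rightarrow> ('w \<Rightarrow> 'x \<Rightarrow> real) \<Rightarrow> ('w \<Rightarrow> 'x \<Rightarrow> real) \<Rightarrow> bool \<times> 'w \<times> real \<Rightarrow> 'x \<times> bool \<Rightarrow> real" where
  "alt_intensity \<rho> r d =
     (\<lambda>(hv, w, s) (x, \<tau>). if hv then r w x else \<rho> * (r w x + s * label_sign \<tau> * d w x))"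

lemma finite_params [simp]: "finite W \<Longrightarrow> finite (params W)"
  by (simp add: params_def)

lemma sum_params:
  assumes "finite W"
  shows "(\<Sum>t\<in>params W. f t)
       = (\<Sum>w\<in>W. \<Sum>s\<in>{-1, 1}. f (True, w, s)) + (\<Sum>w\<in>W. \<Sum>s\<in>{-1, 1}. f (False, w, s))"
  by (simp add: params_def sum.cartesian_product' UNIV_bool add.commute)

lemma sum_prior:
  assumes "finite W" "W \<noteq> {}"
  shows "sum (prior h W) (params W) = 1"
  using assms by (simp add: sum_params prior_def card_gt_0_iff field_simps)

lemma prior_nonneg: "0 \<le> h \<Longrightarrow> h \<le> 1 \<Longrightarrow> prior h W t \<ge> 0"
  by (auto simp: prior_def case_prod_unfold)

text \<open>All that the chi-square bound needs from the construction. \<open>triple\<close> bounds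
  by \<open>\<eta>\<close> the l1 norm of the average of \<open>r \<otimes> d \<otimes> d\<close>
  over the scales, the only moment in which cancellation is used; \<open>sum_d\<close> makes the
  total intensities under the two hypotheses equal.\<close>

locale gadget =
  fixes W :: "'w set" and X :: "'x set" and r d :: "'w \<Rightarrow> 'x \<Rightarrow> real" and \<eta> :: real
  assumes finite_W: "finite W" and W_nonempty: "W \<noteq> {}" and finite_X: "finite X"
    and abs_d_le_r: "\<And>w x. w \<in> W \<Longrightarrow> x \<in> X \<Longrightarrow> \<bar>d w x\<bar> \<le> r w x"
    and sum_r: "\<And>w. w \<in> W \<Longrightarrow> (\<Sum>x\<in>X. r w x) = 1"
    and sum_d: "\<And>w. w \<in> W \<Longrightarrow> (\<Sum>x\<in>X. d w x) = 0"
    and triple: "(\<Sum>x\<in>X. \<Sum>y\<in>X. \<Sum>z\<in>X. \<bar>\<Sum>w\<in>W. r w x * d w y * d w z\<bar>) \<le> \<eta> * card W"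
begin

abbreviation "letters \<equiv> X \<times> (UNIV :: bool set)"

lemma r_nonneg: "w \<in> W \<Longrightarrow> x \<in> X \<Longrightarrow> 0 \<le> r w x"
  using abs_d_le_r [of w x] by linarith

lemma card_W_pos: "real (card W) > 0"
  using finite_W W_nonempty by (simp add: card_gt_0_iff)

lemma \<eta>_nonneg: "\<eta> \<ge> 0"
proof -
  have "0 \<le> (\<Sum>x\<in>X. \<Sum>y\<in>X. \<Sum>z\<in>X. \<bar>\<Sum>w\<in>W. r w x * d w y * d w z\<bar>)"
    by (intro sum_nonneg) auto
  also note triple
  finally show ?thesis
    using card_W_pos by (simp add: zero_le_mult_iff)
qed

lemma alt_bounds:
  assumes "w \<in> W" "x \<in> X" "s \<in> {-1, 1}"
  shows "0 \<le> r w x + s * label_sign \<tau> * d w x" "r w x + s * label_sign \<tau> * d w x \<le> 2 * r w x"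
  using abs_d_le_r [OF assms(1,2)] assms(3) by (cases \<tau>; auto)+

lemma sum_null_intensity:
  assumes "t \<in> params W"
  shows "sum (null_intensity \<rho> r t) letters = (if fst t then 2 else 2 * \<rho>)"
  using assms sum_r
  by (auto simp: params_def null_intensity_def case_prod_unfold sum.cartesian_product' UNIV_bool
      sum.distrib sum_distrib_left [symmetric])

lemma sum_alt_intensity:
  assumes "t \<in> params W"
  shows "sum (alt_intensity \<rho> r d t) letters = (if fst t then 2 else 2 * \<rho>)"
  using assms sum_r sum_d
  by (auto simp: params_def alt_intensity_def case_prod_unfold sum.cartesian_product' UNIV_bool
      sum.distrib sum_distrib_left [symmetric] sum_subtractf)

lemma null_intensity_nonneg:
  "t \<in> params W \<Longrightarrow> y \<in> letters \<Longrightarrow> \<rho> \<ge> 0 \<Longrightarrow> null_intensity \<rho> r t y \<ge> 0"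
  by (auto simp: params_def null_intensity_def r_nonneg)

lemma alt_intensity_nonneg:
  "t \<in> params W \<Longrightarrow> y \<in> letters \<Longrightarrow> \<rho> \<ge> 0 \<Longrightarrow> alt_intensity \<rho> r d t y \<ge> 0"
  using alt_bounds(1)
  by (fastforce simp: params_def alt_intensity_def r_nonneg intro!: mult_nonneg_nonneg)

lemma mixture_null:
  "mixture (params W) (prior h W) letters (null_intensity \<rho> r) l
     = (h * exp (-2) + (1 - h) * exp (-2 * \<rho>) * \<rho> ^ length l) * avg_null W r l / fact (length l)"
proof -
  have heavy: "poisson_weight letters (null_intensity \<rho> r (True, w, s)) l
      = exp (-2) * (\<Prod>(x, \<tau>)\<leftarrow>l. r w x) / fact (length l)"
    if "w \<in> W" "s \<in> {-1, 1}" for w s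
    using that sum_null_intensity [of "(True, w, s)" \<rho>]
    by (simp add: poisson_weight_def params_def) (simp add: null_intensity_def case_prod_unfold)
  have light: "poisson_weight letters (null_intensity \<rho> r (False, w, s)) l
      = exp (-2 * \<rho>) * \<rho> ^ length l * (\<Prod>(x, \<tau>)\<leftarrow>l. r w x) / fact (length l)"
    if "w \<in> W" "s \<in> {-1, 1}" for w s
    using that sum_null_intensity [of "(False, w, s)" \<rho>] prod_list_const_mult [of \<rho> "\<lambda>x \<tau>. r w x" l]
    by (simp add: poisson_weight_def params_def) (simp add: null_intensity_def case_prod_unfold)
  have "mixture (params W) (prior h W) letters (null_intensity \<rho> r) l
      = (\<Sum>w\<in>W. \<Sum>s\<in>{-1, 1::real}. h / (2 * card W) * (exp (-2) * (\<Prod>(x, \<tau>)\<leftarrow>l. r w x) / fact (length l)))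
      + (\<Sum>w\<in>W. \<Sum>s\<in>{-1, 1::real}. (1 - h) / (2 * card W) *
          (exp (-2 * \<rho>) * \<rho> ^ length l * (\<Prod>(x, \<tau>)\<leftarrow>l. r w x) / fact (length l)))"
    unfolding mixture_def sum_params [OF finite_W]
    by (intro arg_cong2 [where f = "(+)"] sum.cong refl) (simp_all add: prior_def heavy light)
  also have "\<dots> = (\<Sum>w\<in>W. (h * exp (-2) + (1 - h) * exp (-2 * \<rho>) * \<rho> ^ length l)
      / (card W * fact (length l)) * (\<Prod>(x, \<tau>)\<leftarrow>l. r w x))"
    unfolding sum.distrib [symmetric] using card_W_pos
    by (intro sum.cong refl) (simp add: divide_simps, simp add: algebra_simps)
  also have "\<dots> = (h * exp (-2) + (1 - h) * exp (-2 * \<rho>) * \<rho> ^ length l)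
      * avg_null W r l / fact (length l)"
    unfolding sum_distrib_left [symmetric] avg_null_def by simp
  finally show ?thesis .
qed

lemma mixture_alt:
  "mixture (params W) (prior h W) letters (alt_intensity \<rho> r d) l
     = (h * exp (-2) * avg_null W r l + (1 - h) * exp (-2 * \<rho>) * \<rho> ^ length l * avg_alt W r d l)
         / fact (length l)"
proof -
  have heavy: "poisson_weight letters (alt_intensity \<rho> r d (True, w, s)) l
      = exp (-2) * (\<Prod>(x, \<tau>)\<leftarrow>l. r w x) / fact (length l)"
    if "w \<in> W" "s \<in> {-1, 1}" for w s
    using that sum_alt_intensity [of "(True, w, s)" \<rho>]
    by (simp add: poisson_weight_def params_def) (simp add: alt_intensity_def case_prod_unfold)
  have light: "poisson_weight letters (alt_intensity \<rho> r d (False, w, s)) l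
      = exp (-2 * \<rho>) * \<rho> ^ length l * (\<Prod>(x, \<tau>)\<leftarrow>l. r w x + s * label_sign \<tau> * d w x) / fact (length l)"
    if "w \<in> W" "s \<in> {-1, 1}" for w s
    using that sum_alt_intensity [of "(False, w, s)" \<rho>]
      prod_list_const_mult [of \<rho> "\<lambda>x \<tau>. r w x + s * label_sign \<tau> * d w x" l]
    by (simp add: poisson_weight_def params_def) (simp add: alt_intensity_def case_prod_unfold)
  have "mixture (params W) (prior h W) letters (alt_intensity \<rho> r d) l
      = (\<Sum>w\<in>W. \<Sum>s\<in>{-1, 1::real}. h / (2 * card W) * (exp (-2) * (\<Prod>(x, \<tau>)\<leftarrow>l. r w x) / fact (length l)))
      + (\<Sum>w\<in>W. \<Sum>s\<in>{-1, 1}. (1 - h) / (2 * card W) * (exp (-2 * \<rho>) * \<rho> ^ length l *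
          (\<Prod>(x, \<tau>)\<leftarrow>l. r w x + s * label_sign \<tau> * d w x) / fact (length l)))"
    unfolding mixture_def sum_params [OF finite_W]
    by (intro arg_cong2 [where f = "(+)"] sum.cong refl) (simp_all add: prior_def heavy light)
  also have "(\<Sum>w\<in>W. \<Sum>s\<in>{-1, 1::real}. h / (2 * card W) * (exp (-2) * (\<Prod>(x, \<tau>)\<leftarrow>l. r w x) / fact (length l)))
      = h * exp (-2) * avg_null W r l / fact (length l)"
    using card_W_pos
    by (simp add: avg_null_def sum_distrib_left [symmetric] sum_divide_distrib [symmetric] field_simps)
  also have "(\<Sum>w\<in>W. \<Sum>s\<in>{-1, 1}. (1 - h) / (2 * card W) * (exp (-2 * \<rho>) * \<rho> ^ length l *
          (\<Prod>(x, \<tau>)\<leftarrow>l. r w x + s * label_sign \<tau> * d w x) / fact (length l)))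
      = (\<Sum>w\<in>W. \<Sum>s\<in>{-1, 1}. ((1 - h) * exp (-2 * \<rho>) * \<rho> ^ length l / (2 * card W * fact (length l))) *
          (\<Prod>(x, \<tau>)\<leftarrow>l. r w x + s * label_sign \<tau> * d w x))"
    by (simp add: mult_ac)
  also have "\<dots> = (1 - h) * exp (-2 * \<rho>) * \<rho> ^ length l * avg_alt W r d l / fact (length l)"
    unfolding sum_distrib_left [symmetric] avg_alt_def by simp
  finally show ?thesis
    by (simp add: add_divide_distrib)
qed

lemma avg_null_nonneg: "set l \<subseteq> letters \<Longrightarrow> avg_null W r l \<ge> 0"
  unfolding avg_null_def
  by (intro divide_nonneg_nonneg sum_nonneg prod_list_map_nonneg) (auto intro!: r_nonneg)

lemma avg_alt_bounds:
  assumes l: "set l \<subseteq> letters"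
  shows "0 \<le> avg_alt W r d l" "avg_alt W r d l \<le> 2 ^ length l * avg_null W r l"
proof -
  have 1: "0 \<le> (\<Prod>(x, \<tau>)\<leftarrow>l. r w x + s * label_sign \<tau> * d w x) \<and>
      (\<Prod>(x, \<tau>)\<leftarrow>l. r w x + s * label_sign \<tau> * d w x) \<le> 2 ^ length l * (\<Prod>(x, \<tau>)\<leftarrow>l. r w x)"
    if w: "w \<in> W" and s: "s \<in> {-1, 1}" for w s
    using l
  proof (induction l)
    case (Cons a l)
    have a: "fst a \<in> X" using Cons.prems by auto
    have IH: "0 \<le> (\<Prod>(x, \<tau>)\<leftarrow>l. r w x + s * label_sign \<tau> * d w x)"
      "(\<Prod>(x, \<tau>)\<leftarrow>l. r w x + s * label_sign \<tau> * d w x) \<le> 2 ^ length l * (\<Prod>(x, \<tau>)\<leftarrow>l. r w x)"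
      using Cons by auto
    have "(r w (fst a) + s * label_sign (snd a) * d w (fst a)) * (\<Prod>(x, \<tau>)\<leftarrow>l. r w x + s * label_sign \<tau> * d w x)
       \<le> (2 * r w (fst a)) * (2 ^ length l * (\<Prod>(x, \<tau>)\<leftarrow>l. r w x))"
      using alt_bounds [OF w a s] IH r_nonneg [OF w a] by (intro mult_mono) auto
    then show ?case
      using alt_bounds [OF w a s] IH by (simp add: case_prod_unfold mult_ac)
  qed simp
  show "0 \<le> avg_alt W r d l"
    unfolding avg_alt_def using 1 by (intro divide_nonneg_nonneg sum_nonneg) auto
  have "(\<Sum>w\<in>W. \<Sum>s\<in>{-1, 1}. \<Prod>(x, \<tau>)\<leftarrow>l. r w x + s * label_sign \<tau> * d w x)
      \<le> (\<Sum>w\<in>W. \<Sum>s\<in>{-1, 1::real}. 2 ^ length l * (\<Prod>(x, \<tau>)\<leftarrow>l. r w x))"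
    using 1 by (intro sum_mono) blast
  also have "\<dots> = 2 * card W * (2 ^ length l * avg_null W r l)"
    using card_W_pos by (simp add: avg_null_def sum_distrib_left sum_divide_distrib field_simps)
  finally show "avg_alt W r d l \<le> 2 ^ length l * avg_null W r l"
    using card_W_pos by (simp add: avg_alt_def field_simps)
qed

section \<open>Lists of two, three and more samples\<close>

lemma sum_letters: "(\<Sum>y\<in>letters. f y) = (\<Sum>x\<in>X. f (x, True) + f (x, False))"
  by (simp add: sum.cartesian_product' UNIV_bool add.commute)

text \<open>A pair is a triple whose \<open>r\<close>-sample is summed out, as \<open>r w\<close>
  has mass one; so \<open>triple\<close> also controls lists of length two.\<close>

lemma pair_correlation: "(\<Sum>x\<in>X. \<Sum>y\<in>X. \<bar>\<Sum>w\<in>W. d w x * d w y\<bar>) \<le> \<eta> * card W"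
proof -
  have "(\<Sum>y\<in>X. \<Sum>z\<in>X. \<bar>\<Sum>w\<in>W. d w y * d w z\<bar>)
      = (\<Sum>y\<in>X. \<Sum>z\<in>X. \<bar>\<Sum>w\<in>W. (\<Sum>x\<in>X. r w x) * d w y * d w z\<bar>)"
    using sum_r by simp
  also have "\<dots> = (\<Sum>y\<in>X. \<Sum>z\<in>X. \<bar>\<Sum>x\<in>X. \<Sum>w\<in>W. r w x * d w y * d w z\<bar>)"
    by (subst (2) sum.swap) (simp add: sum_distrib_right)
  also have "\<dots> \<le> (\<Sum>y\<in>X. \<Sum>z\<in>X. \<Sum>x\<in>X. \<bar>\<Sum>w\<in>W. r w x * d w y * d w z\<bar>)"
    by (intro sum_mono sum_abs)
  also have "\<dots> = (\<Sum>y\<in>X. \<Sum>x\<in>X. \<Sum>z\<in>X. \<bar>\<Sum>w\<in>W. r w x * d w y * d w z\<bar>)"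
    by (subst (2) sum.swap) simp
  also have "\<dots> = (\<Sum>x\<in>X. \<Sum>y\<in>X. \<Sum>z\<in>X. \<bar>\<Sum>w\<in>W. r w x * d w y * d w z\<bar>)"
    by (rule sum.swap)
  finally show ?thesis using triple by simp
qed

text \<open>The only deviation is linear in \<open>s\<close> and cancels in the sum over the two
  signs.\<close>

lemma avg_alt_diff_short:
  assumes "length l \<le> 1"
  shows "avg_alt W r d l = avg_null W r l"
proof -
  consider "l = []" | x \<tau> where "l = [(x, \<tau>)]"
    using assms by (cases l; cases "tl l") (auto simp: neq_Nil_conv)
  then show ?thesis
    using card_W_pos
    by cases (simp_all add: avg_alt_def avg_null_def sum.distrib sum_distrib_left [symmetric])
qed

lemma avg_alt_diff_2:
  "avg_alt W r d [(x, a), (y, b)] - avg_null W r [(x, a), (y, b)]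
     = label_sign a * label_sign b * (\<Sum>w\<in>W. d w x * d w y) / card W"
proof -
  have "(\<Sum>w\<in>W. \<Sum>s\<in>{-1, 1}. \<Prod>(x, \<tau>)\<leftarrow>[(x, a), (y, b)]. r w x + s * label_sign \<tau> * d w x)
      = (\<Sum>w\<in>W. 2 * (r w x * r w y) + 2 * (label_sign a * label_sign b * (d w x * d w y)))"
    by (intro sum.cong) (simp_all add: algebra_simps)
  then show ?thesis
    using card_W_pos
    by (simp add: avg_alt_def avg_null_def sum.distrib sum_distrib_left [symmetric] field_simps)
qed

text \<open>Of the eight products, the sum over \<open>s\<close> leaves those with an even number of
  factors \<open>d\<close>: the null term and the three positions of the single factor
  \<open>r\<close>.\<close>

lemma avg_alt_diff_3:
  "avg_alt W r d [(x, a), (y, b), (z, c)] - avg_null W r [(x, a), (y, b), (z, c)]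
     = (label_sign b * label_sign c * (\<Sum>w\<in>W. r w x * d w y * d w z)
       + label_sign a * label_sign c * (\<Sum>w\<in>W. r w y * d w x * d w z)
       + label_sign a * label_sign b * (\<Sum>w\<in>W. r w z * d w x * d w y)) / card W"
proof -
  have "(\<Sum>w\<in>W. \<Sum>s\<in>{-1, 1}. \<Prod>(x, \<tau>)\<leftarrow>[(x, a), (y, b), (z, c)]. r w x + s * label_sign \<tau> * d w x)
      = (\<Sum>w\<in>W. 2 * (r w x * (r w y * r w z)) + 2 * (label_sign b * label_sign c * (r w x * d w y * d w z))
         + 2 * (label_sign a * label_sign c * (r w y * d w x * d w z))
         + 2 * (label_sign a * label_sign b * (r w z * d w x * d w y)))"
    by (intro sum.cong) (simp_all add: algebra_simps)
  then show ?thesis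
    using card_W_pos
    by (simp add: avg_alt_def avg_null_def sum.distrib sum_distrib_left [symmetric] field_simps)
qed

lemma sum_avg_alt_diff_2:
  "(\<Sum>l | set l \<subseteq> letters \<and> length l = 2. \<bar>avg_alt W r d l - avg_null W r l\<bar>) \<le> 4 * \<eta>"
proof -
  have "(\<Sum>l | set l \<subseteq> letters \<and> length l = 2. \<bar>avg_alt W r d l - avg_null W r l\<bar>)
      = (\<Sum>x\<in>X. 2 * (\<Sum>y\<in>X. 2 * (\<bar>\<Sum>w\<in>W. d w x * d w y\<bar> / card W)))"
    using finite_X
    by (simp add: numeral_2_eq_2 sum_lists_length_Suc lists_length_0 sum_letters avg_alt_diff_2
        abs_mult mult_2 [symmetric] del: length_0_conv)
  also have "\<dots> = 4 * (\<Sum>x\<in>X. \<Sum>y\<in>X. \<bar>\<Sum>w\<in>W. d w x * d w y\<bar>) / card W"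
    by (simp add: sum_distrib_left sum_divide_distrib)
  also have "\<dots> \<le> 4 * \<eta>"
    using pair_correlation card_W_pos by (simp add: field_simps)
  finally show ?thesis .
qed

text \<open>The constant is eight label patterns times three positions of the
  \<open>r\<close>-factor, each position being \<open>triple\<close> after a permutation of the
  arguments.\<close>

lemma sum_avg_alt_diff_3:
  "(\<Sum>l | set l \<subseteq> letters \<and> length l = 3. \<bar>avg_alt W r d l - avg_null W r l\<bar>) \<le> 24 * \<eta>"
proof -
  let ?T = "\<lambda>x y z. \<bar>\<Sum>w\<in>W. r w x * d w y * d w z\<bar>"
  have pt: "\<bar>avg_alt W r d [(x, a), (y, b), (z, c)] - avg_null W r [(x, a), (y, b), (z, c)]\<bar>
      \<le> (?T x y z + ?T y x z + ?T z x y) / card W" for x y z a b c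
  proof -
    have *: "\<bar>u + v + t\<bar> / k \<le> (\<bar>u'\<bar> + \<bar>v'\<bar> + \<bar>t'\<bar>) / k"
      if "k > 0" "\<bar>u\<bar> = \<bar>u'\<bar>" "\<bar>v\<bar> = \<bar>v'\<bar>" "\<bar>t\<bar> = \<bar>t'\<bar>" for u v t u' v' t' k :: real
      using that by (intro divide_right_mono) linarith+
    show ?thesis
      unfolding avg_alt_diff_3 abs_divide abs_of_nat
      by (rule *) (use card_W_pos in \<open>auto simp: abs_mult label_sign_def\<close>)
  qed
  have "(\<Sum>l | set l \<subseteq> letters \<and> length l = 3. \<bar>avg_alt W r d l - avg_null W r l\<bar>)
      = (\<Sum>p\<in>letters. \<Sum>q\<in>letters. \<Sum>u\<in>letters. \<bar>avg_alt W r d [p, q, u] - avg_null W r [p, q, u]\<bar>)"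
    using finite_X
    by (simp add: numeral_3_eq_3 sum_lists_length_Suc lists_length_0 del: length_0_conv)
  also have "\<dots> \<le> (\<Sum>p\<in>letters. \<Sum>q\<in>letters. \<Sum>u\<in>letters.
        (?T (fst p) (fst q) (fst u) + ?T (fst q) (fst p) (fst u) + ?T (fst u) (fst p) (fst q)) / card W)"
    using pt by (intro sum_mono) (simp add: case_prod_unfold split_paired_all)
  also have "\<dots> = 8 * ((\<Sum>x\<in>X. \<Sum>y\<in>X. \<Sum>z\<in>X. ?T x y z + ?T y x z + ?T z x y) / card W)"
    by (simp add: sum_letters sum_distrib_left [symmetric] sum_divide_distrib [symmetric] sum.distrib)
  also have "(\<Sum>x\<in>X. \<Sum>y\<in>X. \<Sum>z\<in>X. ?T x y z + ?T y x z + ?T z x y)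
      = (\<Sum>x\<in>X. \<Sum>y\<in>X. \<Sum>z\<in>X. ?T x y z) + (\<Sum>x\<in>X. \<Sum>y\<in>X. \<Sum>z\<in>X. ?T y x z)
        + (\<Sum>x\<in>X. \<Sum>y\<in>X. \<Sum>z\<in>X. ?T z x y)"
    by (simp add: sum.distrib)
  also have "(\<Sum>x\<in>X. \<Sum>y\<in>X. \<Sum>z\<in>X. ?T y x z) = (\<Sum>x\<in>X. \<Sum>y\<in>X. \<Sum>z\<in>X. ?T x y z)"
    by (rule sum.swap)
  also have "(\<Sum>x\<in>X. \<Sum>y\<in>X. \<Sum>z\<in>X. ?T z x y) = (\<Sum>x\<in>X. \<Sum>z\<in>X. \<Sum>y\<in>X. ?T z x y)"
    by (intro sum.cong refl sum.swap)
  also have "\<dots> = (\<Sum>z\<in>X. \<Sum>x\<in>X. \<Sum>y\<in>X. ?T z x y)"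
    by (rule sum.swap)
  finally have "(\<Sum>l | set l \<subseteq> letters \<and> length l = 3. \<bar>avg_alt W r d l - avg_null W r l\<bar>)
      \<le> 24 * ((\<Sum>x\<in>X. \<Sum>y\<in>X. \<Sum>z\<in>X. ?T x y z) / card W)"
    by simp
  also have "\<dots> \<le> 24 * \<eta>"
    using triple card_W_pos by (simp add: field_simps)
  finally show ?thesis .
qed

lemma sum_avg_null: "(\<Sum>l | set l \<subseteq> letters \<and> length l = j. avg_null W r l) = 2 ^ j"
proof -
  have "(\<Sum>l | set l \<subseteq> letters \<and> length l = j. avg_null W r l)
      = (\<Sum>w\<in>W. (\<Sum>y\<in>letters. case y of (x, \<tau>) \<Rightarrow> r w x) ^ j) / card W"
    unfolding avg_null_def sum_divide_distrib [symmetric]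
    by (subst sum.swap) (use finite_X in \<open>simp add: sum_lists_prod_list\<close>)
  also have "\<dots> = (\<Sum>w\<in>W. 2 ^ j) / card W"
    by (intro arg_cong2 [where f = "(/)"] sum.cong refl) (simp add: sum_letters sum_distrib_left [symmetric] sum_r)
  also have "\<dots> = 2 ^ j"
    using card_W_pos by simp
  finally show ?thesis .
qed

text \<open>The bound without cancellation, for four and more samples. One factor
  \<open>2 ^ j\<close> is the pointwise ratio of the densities, the other is the mass of
  \<open>avg_null\<close> over the \<open>2 ^ j\<close> label patterns.\<close>

lemma sum_avg_alt_diff:
  "(\<Sum>l | set l \<subseteq> letters \<and> length l = j. \<bar>avg_alt W r d l - avg_null W r l\<bar>) \<le> 2 ^ j * 2 ^ j"
proof -
  have "(\<Sum>l | set l \<subseteq> letters \<and> length l = j. \<bar>avg_alt W r d l - avg_null W r l\<bar>)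
      \<le> (\<Sum>l | set l \<subseteq> letters \<and> length l = j. 2 ^ j * avg_null W r l)"
  proof (rule sum_mono)
    fix l :: "('x \<times> bool) list"
    assume "l \<in> {l. set l \<subseteq> letters \<and> length l = j}"
    then have l: "set l \<subseteq> letters" "length l = j" by auto
    have "1 * avg_null W r l \<le> 2 ^ j * avg_null W r l"
      by (intro mult_right_mono avg_null_nonneg l) auto
    then show "\<bar>avg_alt W r d l - avg_null W r l\<bar> \<le> 2 ^ j * avg_null W r l"
      using avg_alt_bounds [OF l(1)] avg_null_nonneg [OF l(1)] unfolding l(2) by linarith
  qed
  then show ?thesis
    by (simp add: sum_distrib_left [symmetric] sum_avg_null)
qed

text \<open>Since heavy bins have positive probability, the null mixture vanishes only where
  \<open>avg_null\<close> does, and \<open>avg_alt\<close> is dominated by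
  \<open>avg_null\<close>.\<close>

lemma mixture_null_eq_0:
  assumes "0 < h" "h \<le> 1" "0 \<le> \<rho>" "set l \<subseteq> letters"
    and "mixture (params W) (prior h W) letters (null_intensity \<rho> r) l = 0"
  shows "mixture (params W) (prior h W) letters (alt_intensity \<rho> r d) l = 0"
proof -
  have "h * exp (-2) + (1 - h) * exp (-2 * \<rho>) * \<rho> ^ length l > 0"
    using assms by (intro add_pos_nonneg) auto
  then have "avg_null W r l = 0"
    using assms(5) by (simp add: mixture_null)
  then show ?thesis
    using avg_alt_bounds [OF assms(4)] by (simp add: mixture_alt)
qed

text \<open>Here the heavy bins pay off: \<open>p\<close> is bounded below by its heavy part, which
  is free of \<open>\<rho>\<close>. In \<open>(q - p)\<^sup>2 / p\<close> one factor of the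
  deviation is at most \<open>2 ^ length l * avg_null W r l\<close> and cancels the denominator; the
  other is kept, so that an l1 bound on the deviation suffices. The part \<open>2 * q - p\<close>
  sees only total masses.\<close>

lemma chi_square_pointwise:
  fixes l :: "('x \<times> bool) list" and h \<rho> :: real
  defines "p \<equiv> mixture (params W) (prior h W) letters (null_intensity \<rho> r) l"
    and "q \<equiv> mixture (params W) (prior h W) letters (alt_intensity \<rho> r d) l"
  assumes h: "0 < h" "h \<le> 1" and \<rho>: "0 \<le> \<rho>" and l: "set l \<subseteq> letters"
  shows "q\<^sup>2 / p \<le> 2 * q - p + exp 2 / h * ((2 * \<rho>\<^sup>2) ^ length l / fact (length l)
            * \<bar>avg_alt W r d l - avg_null W r l\<bar>)"
proof (cases "avg_null W r l = 0")
  case True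
  then have "p = 0" "q = 0"
    using avg_alt_bounds [OF l] by (simp_all add: p_def q_def mixture_null mixture_alt)
  then show ?thesis using h \<rho> by simp
next
  case False
  let ?R = "avg_null W r l" and ?A = "avg_alt W r d l" and ?j = "length l"
  have R: "?R > 0" using False avg_null_nonneg [OF l] by linarith
  define \<kappa> where "\<kappa> = (1 - h) * exp (-2 * \<rho>) * \<rho> ^ ?j"
  have \<kappa>: "0 \<le> \<kappa>" "\<kappa> \<le> \<rho> ^ ?j"
  proof -
    show "0 \<le> \<kappa>" using h \<rho> by (simp add: \<kappa>_def)
    have "(1 - h) * exp (-2 * \<rho>) \<le> 1"
      using h \<rho> by (intro mult_le_one) auto
    then show "\<kappa> \<le> \<rho> ^ ?j"
      using mult_right_mono [of "(1 - h) * exp (-2 * \<rho>)" 1 "\<rho> ^ ?j"] \<rho> by (simp add: \<kappa>_def)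
  qed
  have p: "p = (h * exp (-2) + \<kappa>) * ?R / fact ?j"
    by (simp add: p_def mixture_null \<kappa>_def)
  have q: "q = (h * exp (-2) * ?R + \<kappa> * ?A) / fact ?j"
    by (simp add: q_def mixture_alt \<kappa>_def)
  have pos: "0 < h * exp (-2) * ?R / fact ?j" using h R by simp
  have p_ge: "h * exp (-2) * ?R / fact ?j \<le> p"
    unfolding p using \<kappa> R by (intro divide_right_mono mult_right_mono) auto
  have qp: "q - p = \<kappa> * (?A - ?R) / fact ?j"
    by (simp add: p q field_simps)
  have dev: "\<bar>?A - ?R\<bar> \<le> 2 ^ ?j * ?R"
  proof -
    have "1 * ?R \<le> 2 ^ ?j * ?R"
      using R by (intro mult_right_mono) auto
    then show ?thesis
      using avg_alt_bounds [OF l] R by linarith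
  qed
  have "p \<noteq> 0" using p_ge pos by linarith
  then have "q\<^sup>2 / p = 2 * q - p + (q - p)\<^sup>2 / p"
    by (simp add: field_simps power2_eq_square)
  also have "(q - p)\<^sup>2 / p \<le> (q - p)\<^sup>2 / (h * exp (-2) * ?R / fact ?j)"
    by (intro divide_left_mono p_ge mult_pos_pos pos less_le_trans [OF pos p_ge]) auto
  also have "(q - p)\<^sup>2 / (h * exp (-2) * ?R / fact ?j)
      = \<kappa>\<^sup>2 * (\<bar>?A - ?R\<bar> * \<bar>?A - ?R\<bar>) / (h * exp (-2) * ?R * fact ?j)"
  proof -
    have "(k * x / f)\<^sup>2 / (a / f) = k\<^sup>2 * (\<bar>x\<bar> * \<bar>x\<bar>) / (a * f)" if "f > 0" for k x a f :: real
      using that by (simp add: power2_eq_square divide_simps)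
    then show ?thesis unfolding qp by simp
  qed
  also have "\<dots> \<le> (\<rho> ^ ?j)\<^sup>2 * ((2 ^ ?j * ?R) * \<bar>?A - ?R\<bar>) / (h * exp (-2) * ?R * fact ?j)"
    using \<kappa> dev R h
    by (intro divide_right_mono mult_mono power_mono) auto
  also have "\<dots> = exp 2 / h * ((2 * \<rho>\<^sup>2) ^ ?j / fact ?j * \<bar>?A - ?R\<bar>)"
    using R h by (simp add: exp_minus field_simps power_mult_distrib power_mult [symmetric] mult.commute)
  finally show ?thesis by simp
qed

text \<open>Lengths zero and one contribute no deviation, lengths two and three cost
  \<open>8 * \<eta> * \<rho> ^ 4\<close> and at most \<open>32 * \<eta> * \<rho> ^ 4\<close>, and
  from length four on a geometric series of ratio \<open>8 * \<rho>\<^sup>2 \<le> 1 / 2\<close>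
  takes over.\<close>

theorem sum_chi_square:
  assumes h: "0 < h" "h \<le> 1" and \<rho>: "0 \<le> \<rho>" "\<rho> \<le> 1 / 4"
  shows "(\<Sum>l\<in>short_lists letters n.
            (mixture (params W) (prior h W) letters (alt_intensity \<rho> r d) l)\<^sup>2 /
            mixture (params W) (prior h W) letters (null_intensity \<rho> r) l)
       \<le> 1 + exp 2 / h * (40 * \<eta> * \<rho> ^ 4 + 512 * \<rho> ^ 8)"
proof -
  let ?p = "mixture (params W) (prior h W) letters (null_intensity \<rho> r)"
  let ?q = "mixture (params W) (prior h W) letters (alt_intensity \<rho> r d)"
  let ?D = "\<lambda>l. \<bar>avg_alt W r d l - avg_null W r l\<bar>"
  define S where "S j = (2 * \<rho>\<^sup>2) ^ j / fact j * (\<Sum>l | set l \<subseteq> letters \<and> length l = j. ?D l)" for j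
  have fin: "finite letters" using finite_X by simp
  have S_nonneg: "S j \<ge> 0" for j
    unfolding S_def by (intro mult_nonneg_nonneg sum_nonneg) auto
  have S_small: "S j = 0" if "j \<le> 1" for j
    unfolding S_def using that by (simp add: avg_alt_diff_short)
  have S2: "S 2 \<le> 8 * \<eta> * \<rho> ^ 4"
  proof -
    have "S 2 \<le> (2 * \<rho>\<^sup>2)\<^sup>2 / fact 2 * (4 * \<eta>)"
      unfolding S_def by (intro mult_left_mono sum_avg_alt_diff_2) auto
    also have "\<dots> = 8 * \<eta> * \<rho> ^ 4"
      by (simp add: power4_eq_xxxx power2_eq_square)
    finally show ?thesis .
  qed
  have S3: "S 3 \<le> 32 * \<eta> * \<rho> ^ 4"
  proof -
    have "S 3 \<le> (2 * \<rho>\<^sup>2) ^ 3 / fact 3 * (24 * \<eta>)"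
      unfolding S_def by (intro mult_left_mono sum_avg_alt_diff_3) auto
    also have "\<dots> = 32 * \<eta> * (\<rho> ^ 4 * \<rho>\<^sup>2)"
    proof -
      have "(2 * \<rho>\<^sup>2) ^ 3 = 8 * (\<rho> ^ 4 * \<rho>\<^sup>2)"
        by (simp add: power3_eq_cube power4_eq_xxxx power2_eq_square)
      then show ?thesis by (simp add: fact_numeral)
    qed
    also have "\<dots> \<le> 32 * \<eta> * (\<rho> ^ 4 * 1)"
      using \<eta>_nonneg \<rho> by (intro mult_left_mono power_le_one) auto
    finally show ?thesis by simp
  qed
  have S_large: "S j \<le> (8 * \<rho>\<^sup>2) ^ j / 24" if "j \<ge> 4" for j
  proof -
    have "S j \<le> (2 * \<rho>\<^sup>2) ^ j / fact j * (2 ^ j * 2 ^ j)"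
      unfolding S_def by (intro mult_left_mono sum_avg_alt_diff) auto
    also have "\<dots> = (8 * \<rho>\<^sup>2) ^ j / fact j"
    proof -
      have "(2 * \<rho>\<^sup>2) ^ j * (2 ^ j * 2 ^ j) = (8 * \<rho>\<^sup>2) ^ j"
        unfolding power_mult_distrib [symmetric] by simp
      then show ?thesis by (metis times_divide_eq_left)
    qed
    also have "\<dots> \<le> (8 * \<rho>\<^sup>2) ^ j / 24"
    proof -
      have "fact 4 \<le> (fact j :: real)"
        using that by (rule fact_mono)
      then have "24 \<le> (fact j :: real)"
        by (simp add: fact_numeral)
      then show ?thesis
        by (intro divide_left_mono) auto
    qed
    finally show ?thesis .
  qed
  have x: "8 * \<rho>\<^sup>2 \<le> 1 / 2"
    using power_mono [OF \<rho>(2,1), of 2] by (simp add: power2_eq_square)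
  \<comment> \<open>The induction carries a bound for the remaining tail, twice its first term
    because the ratio is at most \<open>1 / 2\<close>. At the start this needs
    \<open>2 * 8 ^ 4 / 24 \<le> 512\<close>.\<close>
  have sumS: "(\<Sum>j\<le>m + 3. S j) \<le> 40 * \<eta> * \<rho> ^ 4 + 512 * \<rho> ^ 8 - 2 * ((8 * \<rho>\<^sup>2) ^ (m + 4) / 24)" for m
  proof (induction m)
    case 0
    have "(\<Sum>j\<le>3. S j) = S 0 + S 1 + S 2 + S 3"
      by (simp add: numeral_3_eq_3 numeral_2_eq_2)
    also have "\<dots> \<le> 40 * \<eta> * \<rho> ^ 4"
      using S_small S2 S3 by simp
    also have "\<dots> \<le> 40 * \<eta> * \<rho> ^ 4 + 512 * \<rho> ^ 8 - 2 * ((8 * \<rho>\<^sup>2) ^ 4 / 24)"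
    proof -
      have "(8 * \<rho>\<^sup>2) ^ 4 = 4096 * \<rho> ^ 8"
      proof -
        have "(8 * \<rho>\<^sup>2) ^ 4 = 8 ^ 4 * \<rho> ^ (2 * 4)"
          unfolding power_mult_distrib power_mult ..
        then show ?thesis by simp
      qed
      moreover have "0 \<le> \<rho> ^ 8" by simp
      ultimately show ?thesis by linarith
    qed
    finally show ?case by simp
  next
    case (Suc m)
    have "S (m + 4) \<le> (8 * \<rho>\<^sup>2) ^ (m + 4) / 24"
      by (rule S_large) simp
    moreover have "(8 * \<rho>\<^sup>2) ^ (Suc m + 4) \<le> (1 / 2) * (8 * \<rho>\<^sup>2) ^ (m + 4)"
      unfolding add_Suc power_Suc by (intro mult_right_mono x) simp
    moreover have "(\<Sum>j\<le>Suc m + 3. S j) = (\<Sum>j\<le>m + 3. S j) + S (m + 4)"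
      using sum.atMost_Suc [of S "m + 3"] by (simp add: add.commute [of _ 4])
    ultimately show ?case
      using Suc by linarith
  qed
  have "(\<Sum>j\<le>n. S j) \<le> (\<Sum>j\<le>n + 3. S j)"
    by (rule sum_mono2) (use S_nonneg in auto)
  also have "\<dots> \<le> 40 * \<eta> * \<rho> ^ 4 + 512 * \<rho> ^ 8"
  proof -
    have "0 \<le> (8 * \<rho>\<^sup>2) ^ (n + 4)" by simp
    then show ?thesis using sumS [of n] by linarith
  qed
  finally have S_total: "(\<Sum>j\<le>n. S j) \<le> 40 * \<eta> * \<rho> ^ 4 + 512 * \<rho> ^ 8" .
  have "(\<Sum>l\<in>short_lists letters n. (?q l)\<^sup>2 / ?p l)
      \<le> (\<Sum>l\<in>short_lists letters n. 2 * ?q l - ?p l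
            + exp 2 / h * ((2 * \<rho>\<^sup>2) ^ length l / fact (length l) * ?D l))"
    by (intro sum_mono chi_square_pointwise h \<rho>) (auto simp: short_lists_def)
  also have "\<dots> = 2 * (\<Sum>l\<in>short_lists letters n. ?q l) - (\<Sum>l\<in>short_lists letters n. ?p l)
      + exp 2 / h * (\<Sum>l\<in>short_lists letters n. (2 * \<rho>\<^sup>2) ^ length l / fact (length l) * ?D l)"
    by (simp add: sum.distrib sum_subtractf sum_distrib_left)
  also have "(\<Sum>l\<in>short_lists letters n. (2 * \<rho>\<^sup>2) ^ length l / fact (length l) * ?D l) = (\<Sum>j\<le>n. S j)"
    unfolding sum_short_lists_by_length [OF fin] S_def sum_distrib_left
    by (intro sum.cong) auto
  \<comment> \<open>For every parameter the two hypotheses have the same total intensity, hence the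
    same truncated mass; \<open>2 * \<Sum>q - \<Sum>p\<close> is therefore just the mass of
    \<open>p\<close>.\<close>
  also have "(\<Sum>l\<in>short_lists letters n. ?q l) = (\<Sum>l\<in>short_lists letters n. ?p l)"
    unfolding sum_mixture [OF fin]
    by (intro sum.cong refl) (simp add: sum_alt_intensity sum_null_intensity)
  also have "2 * (\<Sum>l\<in>short_lists letters n. ?p l) - (\<Sum>l\<in>short_lists letters n. ?p l)
      = (\<Sum>t\<in>params W. prior h W t * poisson_cdf (sum (null_intensity \<rho> r t) letters) n)"
    by (simp add: sum_mixture [OF fin])
  also have "\<dots> \<le> (\<Sum>t\<in>params W. prior h W t * 1)"
    using h \<rho> by (intro sum_mono mult_left_mono poisson_cdf_le_1 prior_nonneg sum_nonneg null_intensity_nonneg) auto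
  also have "\<dots> = 1"
    using sum_prior [OF finite_W W_nonempty] by simp
  also have "exp 2 / h * (\<Sum>j\<le>n. S j) \<le> exp 2 / h * (40 * \<eta> * \<rho> ^ 4 + 512 * \<rho> ^ 8)"
    using h S_total by (intro mult_left_mono) auto
  finally show ?thesis by simp
qed

end

section \<open>The randomly scaled diamond\<close>

lemma sum_sign_reversing_le:
  fixes \<sigma> :: "'a \<Rightarrow> real" and pos :: "'a \<Rightarrow> 't"
  assumes fin: "finite \<Omega>" "finite T" and sub: "\<Omega>' \<subseteq> \<Omega>"
    and inj: "inj_on \<phi> \<Omega>'" and maps: "\<phi> ` \<Omega>' \<subseteq> \<Omega>"
    and bound: "\<And>\<omega>. \<omega> \<in> \<Omega> \<Longrightarrow> \<bar>\<sigma> \<omega>\<bar> \<le> 1"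
    and pos: "\<And>\<omega>. \<omega> \<in> \<Omega>' \<Longrightarrow> pos (\<phi> \<omega>) = pos \<omega>"
    and rev: "\<And>\<omega>. \<omega> \<in> \<Omega>' \<Longrightarrow> \<sigma> (\<phi> \<omega>) = - \<sigma> \<omega>"
  shows "(\<Sum>t\<in>T. \<bar>\<Sum>\<omega>\<in>\<Omega>. \<sigma> \<omega> * of_bool (pos \<omega> = t)\<bar>) \<le> card (\<Omega> - \<Omega>')"
proof -
  let ?w = "\<lambda>t \<omega>. \<sigma> \<omega> * of_bool (pos \<omega> = t)"
  have l1: "(\<Sum>t\<in>T. \<bar>\<Sum>\<omega>\<in>A. ?w t \<omega>\<bar>) \<le> card A" if A: "A \<subseteq> \<Omega>" for A
  proof -
    have fA: "finite A" using A fin finite_subset by blast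
    have "(\<Sum>t\<in>T. \<bar>\<Sum>\<omega>\<in>A. ?w t \<omega>\<bar>) \<le> (\<Sum>t\<in>T. \<Sum>\<omega>\<in>A. of_bool (pos \<omega> = t))"
    proof (rule sum_mono)
      fix t
      have "\<bar>\<Sum>\<omega>\<in>A. ?w t \<omega>\<bar> \<le> (\<Sum>\<omega>\<in>A. \<bar>?w t \<omega>\<bar>)"
        by (rule sum_abs)
      also have "\<dots> \<le> (\<Sum>\<omega>\<in>A. of_bool (pos \<omega> = t))"
        using bound A by (intro sum_mono) (auto simp: abs_mult)
      finally show "\<bar>\<Sum>\<omega>\<in>A. ?w t \<omega>\<bar> \<le> (\<Sum>\<omega>\<in>A. of_bool (pos \<omega> = t))" .
    qed
    also have "\<dots> = (\<Sum>\<omega>\<in>A. \<Sum>t\<in>T. of_bool (pos \<omega> = t))"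
      by (rule sum.swap)
    also have "\<dots> \<le> (\<Sum>\<omega>\<in>A. 1)"
      using fin by (intro sum_mono) (simp add: of_bool_def sum.delta)
    finally show ?thesis by simp
  qed
  have "2 * \<bar>\<Sum>\<omega>\<in>\<Omega>. ?w t \<omega>\<bar> \<le> \<bar>\<Sum>\<omega>\<in>\<Omega> - \<Omega>'. ?w t \<omega>\<bar> + \<bar>\<Sum>\<omega>\<in>\<Omega> - \<phi> ` \<Omega>'. ?w t \<omega>\<bar>" for t
  proof -
    have "(\<Sum>\<omega>\<in>\<phi> ` \<Omega>'. ?w t \<omega>) = (\<Sum>\<omega>\<in>\<Omega>'. ?w t (\<phi> \<omega>))"
      using inj by (simp add: sum.reindex)
    also have "\<dots> = - (\<Sum>\<omega>\<in>\<Omega>'. ?w t \<omega>)"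
      unfolding sum_negf [symmetric] by (intro sum.cong refl) (simp add: pos rev)
    finally show ?thesis
      using sum.subset_diff [OF sub fin(1), of "?w t"] sum.subset_diff [OF maps fin(1), of "?w t"]
      by linarith
  qed
  then have "2 * (\<Sum>t\<in>T. \<bar>\<Sum>\<omega>\<in>\<Omega>. ?w t \<omega>\<bar>)
      \<le> (\<Sum>t\<in>T. \<bar>\<Sum>\<omega>\<in>\<Omega> - \<Omega>'. ?w t \<omega>\<bar>) + (\<Sum>t\<in>T. \<bar>\<Sum>\<omega>\<in>\<Omega> - \<phi> ` \<Omega>'. ?w t \<omega>\<bar>)"
    unfolding sum_distrib_left sum.distrib [symmetric] by (intro sum_mono)
  also have "\<dots> \<le> card (\<Omega> - \<Omega>') + card (\<Omega> - \<phi> ` \<Omega>')"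
    using l1 [of "\<Omega> - \<Omega>'"] l1 [of "\<Omega> - \<phi> ` \<Omega>'"] by simp
  also have "card (\<Omega> - \<phi> ` \<Omega>') = card (\<Omega> - \<Omega>')"
    using card_image [OF inj] sub maps fin finite_subset [OF sub]
    by (simp add: card_Diff_subset)
  finally show ?thesis by simp
qed

section \<open>Random scales in one coordinate\<close>

lemma card_PiE_restrict_coordinate:
  assumes "finite I" "i \<in> I" "B \<subseteq> A i"
  shows "card {f \<in> PiE I A. f i \<in> B} * card (A i) = card B * card (PiE I A)"
proof -
  have "{f \<in> PiE I A. f i \<in> B} = PiE I (A(i := B))"
  proof (intro set_eqI iffI)
    fix f assume "f \<in> {f \<in> PiE I A. f i \<in> B}"
    then show "f \<in> PiE I (A(i := B))"
      by (auto simp: PiE_iff extensional_def)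
  next
    fix f assume f: "f \<in> PiE I (A(i := B))"
    have "f j \<in> A j" if "j \<in> I" for j
      using PiE_mem [OF f that] assms(3) by (cases "j = i") auto
    moreover have "f i \<in> B"
      using PiE_mem [OF f assms(2)] by simp
    ultimately show "f \<in> {f \<in> PiE I A. f i \<in> B}"
      using f by (auto simp: PiE_iff)
  qed
  then show ?thesis
    using assms by (simp add: card_PiE prod.remove [of I i] mult_ac)
qed

text \<open>Each range is \<open>D\<close> times longer than the preceding one, so a shift by twice
  a lower scale rarely leaves the range of a higher one. Index \<open>D + 1\<close> is not a level:
  it holds the random displacement of the centre, which has the longest range.\<close>

definition scales :: "nat \<Rightarrow> (nat \<Rightarrow> int) set" where
  "scales D = (\<Pi>\<^sub>E a\<in>{1..D + 1}. {1..int D ^ a})"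

text \<open>The offset \<open>D ^ D\<close> is at least every scale \<open>f a\<close> with
  \<open>a \<le> D\<close>, which keeps all coordinates positive.\<close>

definition coord :: "nat \<Rightarrow> (nat \<Rightarrow> int) \<Rightarrow> nat \<Rightarrow> int \<Rightarrow> int" where
  "coord D f a \<sigma> = int D ^ D + f (D + 1) + \<sigma> * f a"

definition atoms :: "nat \<Rightarrow> (nat \<Rightarrow> int) \<Rightarrow> nat \<Rightarrow> int \<Rightarrow> real" where
  "atoms D f a x = of_bool (coord D f a 1 = x) + of_bool (coord D f a (-1) = x)"

definition signed_atoms :: "nat \<Rightarrow> (nat \<Rightarrow> int) \<Rightarrow> nat \<Rightarrow> int \<Rightarrow> real" where
  "signed_atoms D f a x = of_bool (coord D f a 1 = x) - of_bool (coord D f a (-1) = x)"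

lemma finite_scales [simp]: "finite (scales D)"
  unfolding scales_def by (intro finite_PiE) auto

lemma card_scales_pos: "D \<ge> 1 \<Longrightarrow> card (scales D) > 0"
  unfolding scales_def by (subst card_PiE) (auto intro!: prod_pos)

lemma scales_mem:
  assumes "f \<in> scales D" "a \<in> {1..D + 1}"
  shows "1 \<le> f a" "f a \<le> int D ^ a"
  using assms PiE_mem [of f "{1..D + 1}" "\<lambda>a. {1..int D ^ a}" a] by (auto simp: scales_def)

text \<open>None of the three summands exceeds \<open>D ^ (D + 1)\<close> in absolute value; this
  fixes the side length that a block must have.\<close>

lemma coord_range:
  assumes "D \<ge> 1" "f \<in> scales D" "a \<in> {1..D}" "\<sigma> \<in> {-1, 1}" "3 * int D ^ (D + 1) \<le> N"
  shows "coord D f a \<sigma> \<in> {1..N}"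
proof -
  have "1 \<le> f a" "f a \<le> int D ^ a" "1 \<le> f (D + 1)" "f (D + 1) \<le> int D ^ (D + 1)"
    using scales_mem [of f D a] scales_mem [of f D "D + 1"] assms by auto
  moreover have "int D ^ a \<le> int D ^ D" "int D ^ D \<le> int D ^ (D + 1)"
    using assms by (auto intro: power_increasing)
  ultimately show ?thesis
    using assms(4,5) unfolding coord_def by auto
qed

lemma abs_signed_atoms_le: "\<bar>signed_atoms D f a x\<bar> \<le> atoms D f a x"
  by (auto simp: signed_atoms_def atoms_def)

lemma atoms_nonneg: "0 \<le> atoms D f a x"
  by (auto simp: atoms_def)

lemma sum_atoms:
  assumes "finite S" "\<And>\<sigma>. \<sigma> \<in> {-1, 1} \<Longrightarrow> coord D f a \<sigma> \<in> S"
  shows "(\<Sum>x\<in>S. atoms D f a x) = 2" "(\<Sum>x\<in>S. signed_atoms D f a x) = 0"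
proof -
  have "(\<Sum>x\<in>S. of_bool (coord D f a \<sigma> = x)) = (1::real)" if "\<sigma> \<in> {-1, 1}" for \<sigma>
    using assms that by (simp add: of_bool_def)
  from this [of 1] this [of "-1"]
  show "(\<Sum>x\<in>S. atoms D f a x) = 2" "(\<Sum>x\<in>S. signed_atoms D f a x) = 0"
    by (simp_all add: atoms_def signed_atoms_def sum.distrib sum_subtractf
        del: sum_of_bool_eq of_bool_eq_iff)
qed

text \<open>The two ends have \<open>2 * D ^ (e - 1)\<close> values each, out of
  \<open>D ^ e\<close>. The width is the largest distance by which twice a scale of a lower level
  can move.\<close>

lemma card_boundary_scales:
  assumes D: "D \<ge> 1" and e: "e \<in> {1..D + 1}"
  shows "real (card {f \<in> scales D. f e \<le> 2 * int D ^ (e - 1) \<or> f e > int D ^ e - 2 * int D ^ (e - 1)})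
       \<le> 4 / D * card (scales D)"
proof -
  define B where "B = {v \<in> {1..int D ^ e}. v \<le> 2 * int D ^ (e - 1) \<or> v > int D ^ e - 2 * int D ^ (e - 1)}"
  have eq: "{f \<in> scales D. f e \<le> 2 * int D ^ (e - 1) \<or> f e > int D ^ e - 2 * int D ^ (e - 1)}
      = {f \<in> scales D. f e \<in> B}"
    using scales_mem [OF _ e] by (auto simp: B_def)
  have "card {f \<in> scales D. f e \<in> B} * card {1..int D ^ e} = card B * card (scales D)"
    unfolding scales_def by (rule card_PiE_restrict_coordinate) (use e in \<open>auto simp: B_def\<close>)
  moreover have "card {1..int D ^ e} = D ^ e"
    by (simp add: nat_power_eq)
  ultimately have "card {f \<in> scales D. f e \<in> B} * D ^ e = card B * card (scales D)"
    by (simp only:)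
  from arg_cong [where f = real, OF this]
  have 1: "real (card {f \<in> scales D. f e \<in> B}) * real D ^ e = real (card B) * card (scales D)"
    by (simp only: of_nat_mult of_nat_power)
  have "B \<subseteq> {1..2 * int D ^ (e - 1)} \<union> {int D ^ e - 2 * int D ^ (e - 1) + 1..int D ^ e}"
    by (auto simp: B_def)
  then have "card B \<le> card ({1..2 * int D ^ (e - 1)} \<union> {int D ^ e - 2 * int D ^ (e - 1) + 1..int D ^ e})"
    by (intro card_mono) auto
  also have "\<dots> \<le> card {1..2 * int D ^ (e - 1)} + card {int D ^ e - 2 * int D ^ (e - 1) + 1..int D ^ e}"
    by (rule card_Un_le)
  also have "\<dots> = nat (2 * int D ^ (e - 1)) + nat (2 * int D ^ (e - 1))"
    by simp
  also have "nat (2 * int D ^ (e - 1)) = 2 * D ^ (e - 1)"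
    by (simp add: nat_mult_distrib nat_power_eq)
  finally have "card B \<le> 4 * D ^ (e - 1)"
    by simp
  then have "real (card B) \<le> real (4 * D ^ (e - 1))"
    by (simp only: of_nat_le_iff)
  then have "real (card B) \<le> 4 * real D ^ (e - 1)"
    by simp
  then have "real (card {f \<in> scales D. f e \<in> B}) * real D ^ e \<le> 4 * real D ^ (e - 1) * card (scales D)"
    unfolding 1 by (rule mult_right_mono) simp
  moreover have "real D ^ e = real D ^ (e - 1) * real D"
    using e power_minus_mult [of e "real D"] by simp
  ultimately have "real D ^ (e - 1) * (real (card {f \<in> scales D. f e \<in> B}) * D)
      \<le> real D ^ (e - 1) * (4 * real (card (scales D)))"
    by (simp only: mult_ac)
  then have "real (card {f \<in> scales D. f e \<in> B}) * D \<le> 4 * real (card (scales D))"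
    by (rule mult_left_le_imp_le) (use D in simp)
  then show ?thesis
    using D unfolding eq by (simp add: pos_le_divide_eq)
qed

section \<open>Correlations of three atoms in one coordinate\<close>

definition corr ::
  "nat \<Rightarrow> nat \<Rightarrow> nat \<Rightarrow> nat \<Rightarrow> int \<Rightarrow> int \<Rightarrow> int \<Rightarrow> real" where
  "corr D a b c x y z =
     (\<Sum>f\<in>scales D. atoms D f a x * signed_atoms D f b y * signed_atoms D f c z)"

definition corr_norm :: "int set \<Rightarrow> nat \<Rightarrow> nat \<Rightarrow> nat \<Rightarrow> nat \<Rightarrow> real" where
  "corr_norm S D a b c = (\<Sum>x\<in>S. \<Sum>y\<in>S. \<Sum>z\<in>S. \<bar>corr D a b c x y z\<bar>)"

lemma corr_norm_nonneg: "corr_norm S D a b c \<ge> 0"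
  unfolding corr_norm_def by (intro sum_nonneg) auto

lemma corr_norm_sym: "corr_norm S D a b c = corr_norm S D a c b"
proof -
  have "corr D a c b x y z = corr D a b c x z y" for x y z
    by (simp add: corr_def mult_ac)
  then show ?thesis
    unfolding corr_norm_def by (simp only:) (intro sum.cong refl sum.swap)
qed

text \<open>Each \<open>atoms\<close> and \<open>signed_atoms\<close> is opened into its two signs,
  and only the signs of the two \<open>d\<close>-atoms enter the weight. In this form
  \<open>sum_sign_reversing_le\<close> applies.\<close>

lemma corr_norm_eq_signed_sum:
  fixes S :: "int set"
  assumes "finite S"
    and \<Omega>: "\<Omega> = scales D \<times> {-1, 1::int} \<times> {-1, 1::int} \<times> {-1, 1::int}"
    and pos: "pos = (\<lambda>(f, \<sigma>, \<sigma>', \<sigma>''). (coord D f a \<sigma>, coord D f b \<sigma>', coord D f c \<sigma>''))"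
    and wt: "wt = (\<lambda>(f :: nat \<Rightarrow> int, \<sigma> :: int, \<sigma>', \<sigma>''). of_int \<sigma>' * of_int \<sigma>'' :: real)"
  shows "corr_norm S D a b c = (\<Sum>t\<in>S \<times> S \<times> S. \<bar>\<Sum>\<omega>\<in>\<Omega>. wt \<omega> * of_bool (pos \<omega> = t)\<bar>)"
proof -
  have "corr D a b c x y z = (\<Sum>\<omega>\<in>\<Omega>. wt \<omega> * of_bool (pos \<omega> = (x, y, z)))" for x y z
  proof -
    have "(\<Sum>\<omega>\<in>\<Omega>. wt \<omega> * of_bool (pos \<omega> = (x, y, z))) =
        (\<Sum>f\<in>scales D. \<Sum>\<sigma>\<in>{-1, 1}. \<Sum>\<sigma>'\<in>{-1, 1}. \<Sum>\<sigma>''\<in>{-1, 1}.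
          of_bool (coord D f a \<sigma> = x) * (of_int \<sigma>' * of_bool (coord D f b \<sigma>' = y))
            * (of_int \<sigma>'' * of_bool (coord D f c \<sigma>'' = z)))"
      unfolding \<Omega> sum.cartesian_product'
      by (intro sum.cong refl) (simp add: pos wt)
    also have "\<dots> = corr D a b c x y z"
      unfolding corr_def atoms_def signed_atoms_def
      by (intro sum.cong refl) (simp add: algebra_simps)
    finally show ?thesis by simp
  qed
  then show ?thesis
    by (simp add: corr_norm_def sum.cartesian_product')
qed

text \<open>Nothing is paired, and each scale vector counts with its eight sign patterns.\<close>

lemma corr_norm_trivial:
  assumes "finite S"
  shows "corr_norm S D a b c \<le> 8 * card (scales D)"
proof -
  have "corr_norm S D a b c \<le> card (scales D \<times> {-1, 1::int} \<times> {-1, 1::int} \<times> {-1, 1::int} - {})"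
    unfolding corr_norm_eq_signed_sum [OF assms refl refl refl]
    by (rule sum_sign_reversing_le [where \<phi> = id]) (use assms in auto)
  then show ?thesis by (simp add: card_cartesian_product)
qed

text \<open>Reversing the sign of the atom on the smallest scale can be compensated by shifting the
  centre and the two larger scales, each by a small fraction of its range.\<close>

lemma corr_norm_flip:
  assumes D: "D \<ge> 1" and S: "finite S"
    and lev: "a \<in> {1..D}" "b \<in> {1..D}" "c \<in> {1..D}" and "b < a" "b < c" "a \<noteq> c"
  shows "corr_norm S D a b c \<le> 96 / D * card (scales D)"
proof -
  let ?E = "{D + 1, a, c}"
  define good where "good f \<longleftrightarrow>
      (\<forall>e\<in>?E. 2 * int D ^ (e - 1) < f e \<and> f e \<le> int D ^ e - 2 * int D ^ (e - 1))" for f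
  define G where "G = {f \<in> scales D. good f}"
  define \<Omega> where "\<Omega> = scales D \<times> {-1, 1::int} \<times> {-1, 1::int} \<times> {-1, 1::int}"
  define \<Omega>' where "\<Omega>' = G \<times> {-1, 1::int} \<times> {-1, 1::int} \<times> {-1, 1::int}"
  \<comment> \<open>Flipping \<open>\<sigma>'\<close> moves the atom of level \<open>b\<close> by
    \<open>- 2 * \<sigma>' * f b\<close>, which the new centre undoes. The corrections at
    \<open>a\<close> and \<open>c\<close> undo the motion of the centre for the other two atoms, by
    \<open>\<sigma> * \<sigma> = 1\<close> and \<open>\<sigma>'' * \<sigma>'' = 1\<close>.\<close>
  define shift where "shift f \<sigma> \<sigma>' \<sigma>'' = f(D + 1 := f (D + 1) + 2 * \<sigma>' * f b,
      a := f a - \<sigma> * (2 * \<sigma>' * f b), c := f c - \<sigma>'' * (2 * \<sigma>' * f b))"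
    for f :: "nat \<Rightarrow> int" and \<sigma> \<sigma>' \<sigma>''
  define pos where "pos = (\<lambda>(f, \<sigma>, \<sigma>', \<sigma>''). (coord D f a \<sigma>, coord D f b \<sigma>', coord D f c \<sigma>''))"
  define wt where "wt = (\<lambda>(f :: nat \<Rightarrow> int, \<sigma> :: int, \<sigma>', \<sigma>''). of_int \<sigma>' * of_int \<sigma>'' :: real)"
  define \<phi> where "\<phi> = (\<lambda>(f, \<sigma>, \<sigma>', \<sigma>''). (shift f \<sigma> \<sigma>' \<sigma>'', \<sigma>, - \<sigma>', \<sigma>''))"
  have ne: "b \<noteq> D + 1" "a \<noteq> D + 1" "c \<noteq> D + 1" "b \<noteq> a" "b \<noteq> c" "a \<noteq> c"
    using assms by auto
  have shift_b: "shift f \<sigma> \<sigma>' \<sigma>'' b = f b" for f \<sigma> \<sigma>' \<sigma>''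
    using ne by (simp add: shift_def)
  have maps: "shift f \<sigma> \<sigma>' \<sigma>'' \<in> scales D"
    if f: "f \<in> G" and s: "\<sigma> \<in> {-1, 1}" "\<sigma>' \<in> {-1, 1}" "\<sigma>'' \<in> {-1, 1}" for f \<sigma> \<sigma>' \<sigma>''
  proof -
    have fs: "f \<in> scales D" and g: "good f" using f by (auto simp: G_def)
    have fb: "0 \<le> f b" "f b \<le> int D ^ b"
      using scales_mem [OF fs, of b] lev by auto
    have in_range: "f e + \<delta> * (2 * f b) \<in> {1..int D ^ e}" if e: "e \<in> ?E" and \<delta>: "\<delta> \<in> {-1, 1}" for e \<delta>
    proof -
      \<comment> \<open>Here the separation of the scales is used: the shift is at most
        \<open>2 * D ^ b\<close>, hence within the margin \<open>2 * D ^ (e - 1)\<close> of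
        \<open>good\<close>.\<close>
      have "b \<le> e - 1" using e assms by auto
      then have "int D ^ b \<le> int D ^ (e - 1)" using D by (intro power_increasing) auto
      then have "f b \<le> int D ^ (e - 1)" using fb by linarith
      moreover have "2 * int D ^ (e - 1) < f e" "f e \<le> int D ^ e - 2 * int D ^ (e - 1)"
        using g e by (auto simp: good_def)
      ultimately show ?thesis using \<delta> fb by auto
    qed
    have "shift f \<sigma> \<sigma>' \<sigma>'' e \<in> {1..int D ^ e}" if "e \<in> {1..D + 1}" for e
    proof -
      consider "e = c" | "e = a" "e \<noteq> c" | "e = D + 1" "e \<noteq> a" "e \<noteq> c" | "e \<notin> ?E" by auto
      then show ?thesis
      proof cases
        case 1
        then show ?thesis using in_range [of c "- \<sigma>'' * \<sigma>'"] s by (auto simp: shift_def)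
      next
        case 2
        then show ?thesis using in_range [of a "- \<sigma> * \<sigma>'"] s by (auto simp: shift_def)
      next
        case 3
        then show ?thesis using in_range [of "D + 1" "\<sigma>'"] s ne by (auto simp: shift_def)
      next
        case 4
        then show ?thesis using scales_mem [OF fs that] by (simp add: shift_def)
      qed
    qed
    moreover have "shift f \<sigma> \<sigma>' \<sigma>'' e = undefined" if "e \<notin> {1..D + 1}" for e
      using that fs lev by (auto simp: shift_def scales_def PiE_def extensional_def)
    ultimately show ?thesis
      unfolding scales_def by (intro PiE_I) auto
  qed
  \<comment> \<open>The map leaves \<open>f b\<close> alone and the signs can be read off its value,
    so the size of the shift is known and can be subtracted again.\<close>
  have inj: "inj_on \<phi> \<Omega>'"
  proof (rule inj_onI)
    fix p q assume "p \<in> \<Omega>'" "q \<in> \<Omega>'" and eq: "\<phi> p = \<phi> q"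
    obtain f \<sigma> \<sigma>' \<sigma>'' where p: "p = (f, \<sigma>, \<sigma>', \<sigma>'')" by (metis prod_cases4)
    obtain g \<tau> \<tau>' \<tau>'' where q: "q = (g, \<tau>, \<tau>', \<tau>'')" by (metis prod_cases4)
    have s: "\<tau> = \<sigma>" "\<tau>' = \<sigma>'" "\<tau>'' = \<sigma>''" and sh: "shift f \<sigma> \<sigma>' \<sigma>'' = shift g \<sigma> \<sigma>' \<sigma>''"
      using eq by (auto simp: p q \<phi>_def)
    have b: "f b = g b"
      using shift_b fun_cong [OF sh, of b] by simp
    have "f e = g e" for e
      using fun_cong [OF sh, of e] b ne by (simp add: shift_def split: if_splits)
    then show "p = q" by (auto simp: p q s)
  qed
  have "corr_norm S D a b c = (\<Sum>t\<in>S \<times> S \<times> S. \<bar>\<Sum>\<omega>\<in>\<Omega>. wt \<omega> * of_bool (pos \<omega> = t)\<bar>)"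
    by (rule corr_norm_eq_signed_sum [OF S \<Omega>_def pos_def wt_def])
  also have "\<dots> \<le> card (\<Omega> - \<Omega>')"
  proof (rule sum_sign_reversing_le [where \<phi> = \<phi>, OF _ _ _ inj])
    show "finite \<Omega>" by (simp add: \<Omega>_def)
    show "finite (S \<times> S \<times> S)" using S by simp
    show "\<Omega>' \<subseteq> \<Omega>" unfolding \<Omega>_def \<Omega>'_def G_def by (intro Sigma_mono) auto
    show "\<bar>wt \<omega>\<bar> \<le> 1" if "\<omega> \<in> \<Omega>" for \<omega>
      using that by (auto simp: \<Omega>_def wt_def)
    show "\<phi> ` \<Omega>' \<subseteq> \<Omega>"
    proof (rule image_subsetI)
      fix \<omega> assume "\<omega> \<in> \<Omega>'"
      then obtain f \<sigma> \<sigma>' \<sigma>'' where \<omega>: "\<omega> = (f, \<sigma>, \<sigma>', \<sigma>'')" and f: "f \<in> G"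
        and s: "\<sigma> \<in> {-1, 1}" "\<sigma>' \<in> {-1, 1}" "\<sigma>'' \<in> {-1, 1}"
        unfolding \<Omega>'_def by blast
      show "\<phi> \<omega> \<in> \<Omega>"
        using maps [OF f s] s by (simp add: \<phi>_def \<omega> \<Omega>_def) linarith
    qed
  next
    fix \<omega> assume "\<omega> \<in> \<Omega>'"
    then obtain f \<sigma> \<sigma>' \<sigma>'' where \<omega>: "\<omega> = (f, \<sigma>, \<sigma>', \<sigma>'')"
      and s: "\<sigma> \<in> {-1, 1}" "\<sigma>' \<in> {-1, 1}" "\<sigma>'' \<in> {-1, 1}"
      unfolding \<Omega>'_def by blast
    have "\<sigma> * \<sigma> = 1" "\<sigma>'' * \<sigma>'' = 1" using s by auto
    then have sq: "\<sigma> * (\<sigma> * v) = v" "\<sigma>'' * (\<sigma>'' * v) = v" for v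
      by (simp_all flip: mult.assoc)
    show "pos (\<phi> \<omega>) = pos \<omega>"
      using ne by (simp add: \<omega> \<phi>_def pos_def shift_def coord_def right_diff_distrib sq)
    show "wt (\<phi> \<omega>) = - wt \<omega>"
      by (simp add: \<omega> \<phi>_def wt_def)
  qed
  finally have 1: "corr_norm S D a b c \<le> card (\<Omega> - \<Omega>')" .
  have 2: "card (\<Omega> - \<Omega>') = 8 * card (scales D - G)"
  proof -
    have "\<Omega> - \<Omega>' = (scales D - G) \<times> {-1, 1} \<times> {-1, 1} \<times> {-1, 1::int}"
      by (auto simp: \<Omega>_def \<Omega>'_def)
    then show ?thesis by (simp add: card_cartesian_product)
  qed
  let ?bd = "\<lambda>e. {f \<in> scales D. f e \<le> 2 * int D ^ (e - 1) \<or> f e > int D ^ e - 2 * int D ^ (e - 1)}"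
  \<comment> \<open>A vector outside \<open>G\<close> is near an end of its range at one of three
    indices, each a fraction \<open>4 / D\<close>; the eight sign patterns make this
    \<open>96 / D\<close>.\<close>
  have "card (scales D - G) \<le> card (\<Union>e\<in>?E. ?bd e)"
  proof (rule card_mono)
    show "finite (\<Union>e\<in>?E. ?bd e)" by simp
    show "scales D - G \<subseteq> (\<Union>e\<in>?E. ?bd e)"
      unfolding G_def good_def by force
  qed
  also have "\<dots> \<le> (\<Sum>e\<in>?E. card (?bd e))"
    by (rule card_UN_le) simp
  finally have "real (card (scales D - G)) \<le> real (\<Sum>e\<in>?E. card (?bd e))"
    by (simp only: of_nat_le_iff)
  also have "\<dots> = (\<Sum>e\<in>?E. real (card (?bd e)))"
    by (rule of_nat_sum)
  also have "\<dots> \<le> (\<Sum>e\<in>?E. 4 / D * card (scales D))"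
    using lev by (intro sum_mono card_boundary_scales D) auto
  also have "\<dots> = 12 / D * card (scales D)"
    using ne by simp
  finally show ?thesis using 1 2 by simp
qed

text \<open>If the \<open>r\<close>-atom is not on the smallest scale, a \<open>d\<close>-atom is,
  and by the symmetry in \<open>b\<close> and \<open>c\<close> it may be taken to be the first
  one.\<close>

lemma corr_norm_not_min:
  assumes D: "D \<ge> 1" and S: "finite S"
    and lev: "a \<in> {1..D}" "b \<in> {1..D}" "c \<in> {1..D}" and "a \<noteq> b" "a \<noteq> c" "b \<noteq> c"
    and "b < a \<or> c < a"
  shows "corr_norm S D a b c \<le> 96 / D * card (scales D)"
proof (cases "b < c")
  case True
  then show ?thesis using assms by (intro corr_norm_flip) auto
next
  case False
  then show ?thesis using assms by (subst corr_norm_sym, intro corr_norm_flip) auto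
qed

section \<open>The diamond in the plane\<close>

definition diamond :: "nat \<Rightarrow> (nat \<Rightarrow> int) \<times> (nat \<Rightarrow> int) \<Rightarrow> int \<times> int \<Rightarrow> real" where
  "diamond D = (\<lambda>(f, g) (x, y). (\<Sum>a\<in>{1..D}. atoms D f a x * atoms D g (D + 1 - a) y) / (4 * D))"

definition signed_diamond :: "nat \<Rightarrow> (nat \<Rightarrow> int) \<times> (nat \<Rightarrow> int) \<Rightarrow> int \<times> int \<Rightarrow> real" where
  "signed_diamond D = (\<lambda>(f, g) (x, y).
     (\<Sum>a\<in>{1..D}. signed_atoms D f a x * signed_atoms D g (D + 1 - a) y) / (4 * D))"

text \<open>If \<open>a\<close> is the smallest of three distinct levels, then
  \<open>D + 1 - a\<close> is the largest of the reflected ones; so one of the two factors always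
  has the gain, and the trivial \<open>64\<close> improves to \<open>64 * (12 / D)\<close>.
  Coinciding levels have no gain, but the three equations hold for \<open>D ^ 2\<close> triples
  each. This gives \<open>12 * D ^ 2 + 3 * D ^ 2\<close> in units of \<open>64\<close>.\<close>

lemma sum_corr_norm_le:
  assumes D: "D \<ge> 1" and S: "finite S"
  shows "(\<Sum>a\<in>{1..D}. \<Sum>b\<in>{1..D}. \<Sum>c\<in>{1..D}.
            corr_norm S D a b c * corr_norm S D (D + 1 - a) (D + 1 - b) (D + 1 - c))
       \<le> 960 * D ^ 2 * (card (scales D))\<^sup>2"
proof -
  let ?n = "real (card (scales D))"
  have pt: "corr_norm S D a b c * corr_norm S D (D + 1 - a) (D + 1 - b) (D + 1 - c)
      \<le> 64 * ?n\<^sup>2 * (12 / D + of_bool (a = b) + of_bool (a = c) + of_bool (b = c))"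
    if lev: "a \<in> {1..D}" "b \<in> {1..D}" "c \<in> {1..D}" for a b c
  proof -
    let ?L = "corr_norm S D a b c" and ?L' = "corr_norm S D (D + 1 - a) (D + 1 - b) (D + 1 - c)"
    have triv: "?L \<le> 8 * ?n" "?L' \<le> 8 * ?n"
      using corr_norm_trivial [OF S] by auto
    have nn: "0 \<le> ?L" "0 \<le> ?L'" by (simp_all add: corr_norm_nonneg)
    show ?thesis
    proof (cases "a = b \<or> a = c \<or> b = c")
      case True
      have "?L * ?L' \<le> (8 * ?n) * (8 * ?n)"
        using triv nn by (intro mult_mono) auto
      also have "\<dots> = 64 * ?n\<^sup>2 * 1" by (simp add: power2_eq_square)
      also have "\<dots> \<le> 64 * ?n\<^sup>2 * (12 / D + of_bool (a = b) + of_bool (a = c) + of_bool (b = c))"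
        using True by (intro mult_left_mono) auto
      finally show ?thesis .
    next
      case False
      have "?L \<le> 96 / D * ?n \<or> ?L' \<le> 96 / D * ?n"
      proof (cases "b < a \<or> c < a")
        case True
        then show ?thesis using corr_norm_not_min [OF D S lev] False by auto
      next
        case ngt: False
        have "?L' \<le> 96 / D * ?n"
          using ngt False lev by (intro corr_norm_not_min [OF D S]) auto
        then show ?thesis ..
      qed
      then have "?L * ?L' \<le> (96 / D * ?n) * (8 * ?n)"
      proof
        assume "?L \<le> 96 / D * ?n"
        then show ?thesis using triv nn by (intro mult_mono) auto
      next
        assume "?L' \<le> 96 / D * ?n"
        then have "?L' * ?L \<le> (96 / D * ?n) * (8 * ?n)" using triv nn by (intro mult_mono) auto
        then show ?thesis by (simp add: mult.commute)
      qed
      also have "\<dots> = 64 * ?n\<^sup>2 * (12 / D)" by (simp add: power2_eq_square)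
      also have "\<dots> \<le> 64 * ?n\<^sup>2 * (12 / D + of_bool (a = b) + of_bool (a = c) + of_bool (b = c))"
        by (intro mult_left_mono) auto
      finally show ?thesis .
    qed
  qed
  have "(\<Sum>a\<in>{1..D}. \<Sum>b\<in>{1..D}. \<Sum>c\<in>{1..D}.
            corr_norm S D a b c * corr_norm S D (D + 1 - a) (D + 1 - b) (D + 1 - c))
      \<le> (\<Sum>a\<in>{1..D}. \<Sum>b\<in>{1..D}. \<Sum>c\<in>{1..D}.
            64 * ?n\<^sup>2 * (12 / D + of_bool (a = b) + of_bool (a = c) + of_bool (b = c)))"
    by (intro sum_mono pt)
  also have "\<dots> = 64 * ?n\<^sup>2 * (\<Sum>a\<in>{1..D}. \<Sum>b\<in>{1..D}. \<Sum>c\<in>{1..D}.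
            12 / D + of_bool (a = b) + of_bool (a = c) + of_bool (b = c))"
    by (simp only: sum_distrib_left)
  also have "(\<Sum>a\<in>{1..D}. \<Sum>b\<in>{1..D}. \<Sum>c\<in>{1..D}.
            12 / D + of_bool (a = b) + of_bool (a = c) + of_bool (b = c)) = (15 * D ^ 2 :: real)"
  proof -
    have D': "real D \<noteq> 0" using D by simp
    have d: "(\<Sum>c\<in>{1..D}. of_bool (a = c)) = (1::real)" if "a \<in> {1..D}" for a
      using that by (simp add: of_bool_def)
    have "(\<Sum>b\<in>{1..D}. \<Sum>c\<in>{1..D}. 12 / D + of_bool (a = b) + of_bool (a = c) + of_bool (b = c))
        = (15 * D :: real)" if a: "a \<in> {1..D}" for a
    proof -
      have "(\<Sum>b\<in>{1..D}. \<Sum>c\<in>{1..D}. 12 / D + of_bool (a = b) + of_bool (a = c) + of_bool (b = c))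
          = (\<Sum>b\<in>{1..D}. 12 + real D * of_bool (a = b) + 1 + 1)"
        using D' d a by (intro sum.cong refl)
          (simp add: sum.distrib distrib_left del: sum_of_bool_eq sum_mult_of_bool_eq sum_of_bool_mult_eq)
      also have "\<dots> = 15 * D"
        using d [OF a] by (simp add: sum.distrib sum_distrib_left [symmetric]
            del: sum_of_bool_eq sum_mult_of_bool_eq sum_of_bool_mult_eq)
      finally show ?thesis .
    qed
    then show ?thesis by (simp add: power2_eq_square)
  qed
  also have "64 * ?n\<^sup>2 * (15 * D ^ 2 :: real) = 960 * D ^ 2 * ?n\<^sup>2"
    by (simp add: mult_ac)
  finally show ?thesis by simp
qed

text \<open>The scales of the two coordinates are independent, so for each triple of levels the
  average factors into two one-dimensional correlations. The normalisation
  \<open>(4 * D) ^ 3\<close> turns \<open>960 * D ^ 2\<close> into \<open>15 / D\<close>.\<close>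

lemma diamond_triple:
  assumes D: "D \<ge> 1" and S: "finite S"
  shows "(\<Sum>p\<in>S \<times> S. \<Sum>q\<in>S \<times> S. \<Sum>s\<in>S \<times> S. \<bar>\<Sum>w\<in>scales D \<times> scales D.
            diamond D w p * signed_diamond D w q * signed_diamond D w s\<bar>)
       \<le> 15 / D * card (scales D \<times> scales D)"
proof -
  let ?I = "{1..D}"
  let ?c = "\<lambda>p q s. \<bar>\<Sum>w\<in>scales D \<times> scales D. diamond D w p * signed_diamond D w q * signed_diamond D w s\<bar>"
  have expand: "(\<Sum>w\<in>scales D \<times> scales D.
            diamond D w (x, x') * signed_diamond D w (y, y') * signed_diamond D w (z, z'))
      = (\<Sum>a\<in>?I. \<Sum>b\<in>?I. \<Sum>c\<in>?I. corr D a b c x y z *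
            corr D (D + 1 - a) (D + 1 - b) (D + 1 - c) x' y' z') / (4 * D) ^ 3"
    for x x' y y' z z'
  proof -
    let ?t = "\<lambda>f g a b c. (atoms D f a x * signed_atoms D f b y * signed_atoms D f c z) *
      (atoms D g (D + 1 - a) x' * signed_atoms D g (D + 1 - b) y' * signed_atoms D g (D + 1 - c) z')"
    have "(\<Sum>w\<in>scales D \<times> scales D.
            diamond D w (x, x') * signed_diamond D w (y, y') * signed_diamond D w (z, z'))
        = (\<Sum>f\<in>scales D. \<Sum>g\<in>scales D.
            (\<Sum>a\<in>?I. \<Sum>b\<in>?I. \<Sum>c\<in>?I.
            ?t f g a b c))
          / (4 * D) ^ 3"
    proof -
      have "diamond D (f, g) (x, x') * signed_diamond D (f, g) (y, y') * signed_diamond D (f, g) (z, z')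
          = (\<Sum>a\<in>?I. \<Sum>b\<in>?I. \<Sum>c\<in>?I.
            ?t f g a b c)
            / (4 * D) ^ 3" for f g
      proof -
        have "diamond D (f, g) (x, x') * signed_diamond D (f, g) (y, y') * signed_diamond D (f, g) (z, z')
          = (\<Sum>a\<in>?I. atoms D f a x * atoms D g (D + 1 - a) x') *
            ((\<Sum>b\<in>?I. signed_atoms D f b y * signed_atoms D g (D + 1 - b) y') *
            (\<Sum>c\<in>?I. signed_atoms D f c z * signed_atoms D g (D + 1 - c) z')) / (4 * D) ^ 3"
          by (simp add: diamond_def signed_diamond_def power3_eq_cube)
        also have "(\<Sum>a\<in>?I. atoms D f a x * atoms D g (D + 1 - a) x') *
            ((\<Sum>b\<in>?I. signed_atoms D f b y * signed_atoms D g (D + 1 - b) y') *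
            (\<Sum>c\<in>?I. signed_atoms D f c z * signed_atoms D g (D + 1 - c) z'))
          = (\<Sum>a\<in>?I. \<Sum>b\<in>?I. \<Sum>c\<in>?I. (atoms D f a x * atoms D g (D + 1 - a) x') *
            ((signed_atoms D f b y * signed_atoms D g (D + 1 - b) y') *
            (signed_atoms D f c z * signed_atoms D g (D + 1 - c) z')))"
          by (simp only: sum_product) (simp only: sum_distrib_left)
        finally show ?thesis by (simp only: mult_ac)
      qed
      then show ?thesis
        by (simp add: sum.cartesian_product' sum_divide_distrib)
    qed
    also have "(\<Sum>f\<in>scales D. \<Sum>g\<in>scales D.
            (\<Sum>a\<in>?I. \<Sum>b\<in>?I. \<Sum>c\<in>?I.
            ?t f g a b c))
        = (\<Sum>a\<in>?I. \<Sum>b\<in>?I. \<Sum>c\<in>?I. \<Sum>f\<in>scales D. \<Sum>g\<in>scales D.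
            ?t f g a b c)"
      by (simp only: sum.swap [where A = "scales D" and B = ?I])
    also have "\<dots> = (\<Sum>a\<in>?I. \<Sum>b\<in>?I. \<Sum>c\<in>?I. corr D a b c x y z *
            corr D (D + 1 - a) (D + 1 - b) (D + 1 - c) x' y' z')"
      by (simp only: corr_def sum_product)
    finally show ?thesis .
  qed
  have "(\<Sum>p\<in>S \<times> S. \<Sum>q\<in>S \<times> S. \<Sum>s\<in>S \<times> S. ?c p q s)
      \<le> (\<Sum>p\<in>S \<times> S. \<Sum>q\<in>S \<times> S. \<Sum>s\<in>S \<times> S. \<Sum>a\<in>?I. \<Sum>b\<in>?I. \<Sum>c\<in>?I.
            \<bar>corr D a b c (fst p) (fst q) (fst s)\<bar> *
            \<bar>corr D (D + 1 - a) (D + 1 - b) (D + 1 - c) (snd p) (snd q) (snd s)\<bar> / (4 * D) ^ 3)"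
  proof (intro sum_mono)
    fix p q s
    have "?c p q s
        = \<bar>\<Sum>a\<in>?I. \<Sum>b\<in>?I. \<Sum>c\<in>?I. corr D a b c (fst p) (fst q) (fst s) *
            corr D (D + 1 - a) (D + 1 - b) (D + 1 - c) (snd p) (snd q) (snd s)\<bar> / (4 * D) ^ 3"
      using expand [of "fst p" "snd p" "fst q" "snd q" "fst s" "snd s"] by (simp add: abs_divide)
    also have "\<dots> \<le> (\<Sum>a\<in>?I. \<Sum>b\<in>?I. \<Sum>c\<in>?I. \<bar>corr D a b c (fst p) (fst q) (fst s) *
            corr D (D + 1 - a) (D + 1 - b) (D + 1 - c) (snd p) (snd q) (snd s)\<bar>) / (4 * D) ^ 3"
      by (intro divide_right_mono sum_abs [THEN order_trans] sum_mono) auto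
    finally show "?c p q s
      \<le> (\<Sum>a\<in>?I. \<Sum>b\<in>?I. \<Sum>c\<in>?I. \<bar>corr D a b c (fst p) (fst q) (fst s)\<bar> *
            \<bar>corr D (D + 1 - a) (D + 1 - b) (D + 1 - c) (snd p) (snd q) (snd s)\<bar> / (4 * D) ^ 3)"
      by (simp only: sum_divide_distrib abs_mult)
  qed
  also have "\<dots> = (\<Sum>a\<in>?I. \<Sum>b\<in>?I. \<Sum>c\<in>?I. \<Sum>p\<in>S \<times> S. \<Sum>q\<in>S \<times> S. \<Sum>s\<in>S \<times> S.
            \<bar>corr D a b c (fst p) (fst q) (fst s)\<bar> *
            \<bar>corr D (D + 1 - a) (D + 1 - b) (D + 1 - c) (snd p) (snd q) (snd s)\<bar> / (4 * D) ^ 3)"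
    by (simp only: sum.swap [where A = "S \<times> S" and B = ?I])
  also have "\<dots> = (\<Sum>a\<in>?I. \<Sum>b\<in>?I. \<Sum>c\<in>?I.
      corr_norm S D a b c * corr_norm S D (D + 1 - a) (D + 1 - b) (D + 1 - c) / (4 * D) ^ 3)"
  proof (intro sum.cong refl)
    fix a b c
    have factor: "(\<Sum>p\<in>S \<times> S. \<Sum>q\<in>S \<times> S. \<Sum>s\<in>S \<times> S. A (fst p) (fst q) (fst s) * B (snd p) (snd q) (snd s))
        = (\<Sum>x\<in>S. \<Sum>y\<in>S. \<Sum>z\<in>S. A x y z) * (\<Sum>x\<in>S. \<Sum>y\<in>S. \<Sum>z\<in>S. B x y z)"
      for A B :: "int \<Rightarrow> int \<Rightarrow> int \<Rightarrow> real"
      by (simp add: sum.cartesian_product' sum_product)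
    show "(\<Sum>p\<in>S \<times> S. \<Sum>q\<in>S \<times> S. \<Sum>s\<in>S \<times> S.
            \<bar>corr D a b c (fst p) (fst q) (fst s)\<bar> *
            \<bar>corr D (D + 1 - a) (D + 1 - b) (D + 1 - c) (snd p) (snd q) (snd s)\<bar> / (4 * D) ^ 3)
        = corr_norm S D a b c * corr_norm S D (D + 1 - a) (D + 1 - b) (D + 1 - c) / (4 * D) ^ 3"
      unfolding corr_norm_def factor [symmetric] by (simp only: sum_divide_distrib)
  qed
  also have "\<dots> = (\<Sum>a\<in>?I. \<Sum>b\<in>?I. \<Sum>c\<in>?I.
      corr_norm S D a b c * corr_norm S D (D + 1 - a) (D + 1 - b) (D + 1 - c)) / (4 * D) ^ 3"
    by (simp only: sum_divide_distrib)
  also have "\<dots> \<le> 960 * D ^ 2 * (card (scales D))\<^sup>2 / (4 * D) ^ 3"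
    by (intro divide_right_mono sum_corr_norm_le D S) auto
  also have "\<dots> = 15 / D * card (scales D \<times> scales D)"
    using D by (simp add: card_cartesian_product power2_eq_square power3_eq_cube field_simps)
  finally show ?thesis .
qed

lemma sum_times_sum_swap:
  fixes F :: "'i \<Rightarrow> 'a \<Rightarrow> real" and G :: "'i \<Rightarrow> 'b \<Rightarrow> real"
  shows "(\<Sum>p\<in>A \<times> B. \<Sum>i\<in>I. F i (fst p) * G i (snd p)) = (\<Sum>i\<in>I. sum (F i) A * sum (G i) B)"
  by (subst sum.swap) (simp add: sum_product sum.cartesian_product')

lemma gadget_diamond:
  assumes D: "D \<ge> 1" and N: "3 * int D ^ (D + 1) \<le> N"
  shows "gadget (scales D \<times> scales D) ({1..N} \<times> {1..N}) (diamond D) (signed_diamond D) (15 / D)"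
proof
  show "finite (scales D \<times> scales D)" by simp
  show "scales D \<times> scales D \<noteq> {}"
    using card_scales_pos [OF D] by (auto simp: card_gt_0_iff)
  show "finite ({1..N} \<times> {1..N})" by simp
  show "(\<Sum>x\<in>{1..N} \<times> {1..N}. \<Sum>y\<in>{1..N} \<times> {1..N}. \<Sum>z\<in>{1..N} \<times> {1..N}.
          \<bar>\<Sum>w\<in>scales D \<times> scales D. diamond D w x * signed_diamond D w y * signed_diamond D w z\<bar>)
      \<le> 15 / D * card (scales D \<times> scales D)"
    by (rule diamond_triple [OF D]) simp
next
  fix w :: "(nat \<Rightarrow> int) \<times> (nat \<Rightarrow> int)" and x :: "int \<times> int"
  obtain f g where w: "w = (f, g)" by fastforce
  have "\<bar>\<Sum>a\<in>{1..D}. signed_atoms D f a (fst x) * signed_atoms D g (D + 1 - a) (snd x)\<bar>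
      \<le> (\<Sum>a\<in>{1..D}. atoms D f a (fst x) * atoms D g (D + 1 - a) (snd x))"
    by (intro sum_abs [THEN order_trans] sum_mono)
       (auto simp: abs_mult intro!: mult_mono abs_signed_atoms_le atoms_nonneg)
  then show "\<bar>signed_diamond D w x\<bar> \<le> diamond D w x"
    by (simp add: w diamond_def signed_diamond_def case_prod_unfold abs_divide divide_right_mono)
next
  fix w assume "w \<in> scales D \<times> scales D"
  then obtain f g where w: "w = (f, g)" "f \<in> scales D" "g \<in> scales D" by auto
  have c: "coord D f a \<sigma> \<in> {1..N}" "coord D g (D + 1 - a) \<sigma> \<in> {1..N}"
    if "a \<in> {1..D}" "\<sigma> \<in> {-1, 1}" for a \<sigma>
  proof -
    have a': "D + 1 - a \<in> {1..D}" using that by auto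
    show "coord D f a \<sigma> \<in> {1..N}" "coord D g (D + 1 - a) \<sigma> \<in> {1..N}"
      using coord_range [OF D w(2) that N] coord_range [OF D w(3) a' that(2) N] by auto
  qed
  have "(\<Sum>x\<in>{1..N} \<times> {1..N}. diamond D w x)
      = (\<Sum>p\<in>{1..N} \<times> {1..N}. \<Sum>a\<in>{1..D}. atoms D f a (fst p) * atoms D g (D + 1 - a) (snd p)) / (4 * D)"
    by (simp add: w diamond_def sum_divide_distrib case_prod_unfold)
  also have "\<dots> = (\<Sum>a\<in>{1..D}. 2 * 2) / (4 * D)"
    unfolding sum_times_sum_swap [of "\<lambda>a. atoms D f a" "\<lambda>a. atoms D g (D + 1 - a)"]
    by (intro arg_cong2 [where f = "(/)"] sum.cong refl arg_cong2 [where f = "(*)"] sum_atoms c) auto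
  also have "\<dots> = 1" using D by simp
  finally show "(\<Sum>x\<in>{1..N} \<times> {1..N}. diamond D w x) = 1" .
  have "(\<Sum>x\<in>{1..N} \<times> {1..N}. signed_diamond D w x)
      = (\<Sum>p\<in>{1..N} \<times> {1..N}. \<Sum>a\<in>{1..D}. signed_atoms D f a (fst p) * signed_atoms D g (D + 1 - a) (snd p)) / (4 * D)"
    by (simp add: w signed_diamond_def sum_divide_distrib case_prod_unfold)
  also have "\<dots> = (\<Sum>a\<in>{1..D}. 0 * 0) / (4 * D)"
    unfolding sum_times_sum_swap [of "\<lambda>a. signed_atoms D f a" "\<lambda>a. signed_atoms D g (D + 1 - a)"]
    by (intro arg_cong2 [where f = "(/)"] sum.cong refl arg_cong2 [where f = "(*)"] sum_atoms c) auto
  finally show "(\<Sum>x\<in>{1..N} \<times> {1..N}. signed_diamond D w x) = 0" by simp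
qed

text \<open>Beyond the centre in both coordinates each level has exactly one atom, the one with two
  plus signs: \<open>D\<close> atoms out of \<open>4 * D\<close>. As the quadrant depends on the
  centre only, one rectangle per bin collects all levels at once.\<close>

lemma signed_diamond_quadrant:
  assumes D: "D \<ge> 1" and N: "3 * int D ^ (D + 1) \<le> N" and f: "f \<in> scales D" and g: "g \<in> scales D"
  shows "(\<Sum>p\<in>{int D ^ D + f (D + 1) + 1..N} \<times> {int D ^ D + g (D + 1) + 1..N}.
            signed_diamond D (f, g) p) = 1 / 4"
proof -
  have one: "(\<Sum>x\<in>{int D ^ D + h (D + 1) + 1..N}. signed_atoms D h a x) = 1"
    if h: "h \<in> scales D" and a: "a \<in> {1..D}" for h a
  proof -
    have "1 \<le> h a" using scales_mem [OF h, of a] a by auto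
    moreover have "coord D h a 1 \<in> {1..N}"
      using coord_range [OF D h a _ N] by auto
    ultimately have "coord D h a 1 \<in> {int D ^ D + h (D + 1) + 1..N}"
      "coord D h a (-1) \<notin> {int D ^ D + h (D + 1) + 1..N}"
      by (auto simp: coord_def)
    then have "(\<Sum>x\<in>{int D ^ D + h (D + 1) + 1..N}. of_bool (coord D h a 1 = x)) = (1::real)"
      "(\<Sum>x\<in>{int D ^ D + h (D + 1) + 1..N}. of_bool (coord D h a (-1) = x)) = (0::real)"
      by (simp_all add: of_bool_def sum.delta' del: atLeastAtMost_iff)
    then show ?thesis
      by (simp add: signed_atoms_def sum_subtractf)
  qed
  have "(\<Sum>p\<in>{int D ^ D + f (D + 1) + 1..N} \<times> {int D ^ D + g (D + 1) + 1..N}. signed_diamond D (f, g) p)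
      = (\<Sum>a\<in>{1..D}. (\<Sum>x\<in>{int D ^ D + f (D + 1) + 1..N}. signed_atoms D f a x) *
            (\<Sum>y\<in>{int D ^ D + g (D + 1) + 1..N}. signed_atoms D g (D + 1 - a) y)) / (4 * D)"
    unfolding sum_times_sum_swap [of "\<lambda>a. signed_atoms D f a" "\<lambda>a. signed_atoms D g (D + 1 - a)", symmetric]
    by (simp add: signed_diamond_def case_prod_unfold sum_divide_distrib)
  also have "\<dots> = (\<Sum>a\<in>{1..D}. 1) / (4 * D)"
  proof (intro arg_cong2 [where f = "(/)"] sum.cong refl)
    fix a assume a: "a \<in> {1..D}"
    then have "D + 1 - a \<in> {1..D}" by auto
    then show "(\<Sum>x\<in>{int D ^ D + f (D + 1) + 1..N}. signed_atoms D f a x) *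
        (\<Sum>y\<in>{int D ^ D + g (D + 1) + 1..N}. signed_atoms D g (D + 1 - a) y) = 1"
      using one [OF f a] one [OF g] by simp
  qed
  finally show ?thesis using D by simp
qed

section \<open>Running a tester on a Poisson list\<close>

lemma sum_lists_append:
  assumes "finite A"
  shows "(\<Sum>xs | set xs \<subseteq> A \<and> length xs = k + i. f xs)
       = (\<Sum>us | set us \<subseteq> A \<and> length us = k. \<Sum>vs | set vs \<subseteq> A \<and> length vs = i. f (us @ vs))"
proof (induction k arbitrary: f)
  case 0
  show ?case by (simp add: lists_length_0 del: length_0_conv)
next
  case (Suc k)
  show ?case
    using Suc.IH by (simp add: sum_lists_length_Suc assms)
qed

definition poisson_range :: "real \<Rightarrow> nat \<Rightarrow> nat \<Rightarrow> real" where
  "poisson_range T k n = exp (- T) * (\<Sum>j\<in>{k..n}. T ^ j / fact j)"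

lemma power_2_le_exp: "(2::real) ^ n \<le> exp (real n)"
proof -
  have "(2::real) ^ n \<le> exp 1 ^ n"
    using exp_ge_add_one_self [of 1] by (intro power_mono) auto
  then show ?thesis by (simp add: exp_of_nat_mult [symmetric])
qed

lemma poisson_range_nonneg: "T \<ge> 0 \<Longrightarrow> poisson_range T k n \<ge> 0"
  unfolding poisson_range_def by (intro mult_nonneg_nonneg sum_nonneg) auto

lemma poisson_range_le_1: "T \<ge> 0 \<Longrightarrow> poisson_range T k n \<le> 1"
  using mult_left_mono [OF sum_exp_series_le [of T "{k..n}"], of "exp (- T)"]
  by (simp add: poisson_range_def exp_minus field_simps)

text \<open>Both tails by changing the rate: \<open>T ^ j \<le> 2 ^ k * (T / 2) ^ j\<close> below
  \<open>k\<close>, and \<open>T ^ j \<le> (2 * T) ^ j / 2 ^ n\<close> above \<open>n\<close>. The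
  series then sum to \<open>exp (T / 2)\<close> and \<open>exp (2 * T)\<close>, against the
  prefactor \<open>exp (- T)\<close>.\<close>

lemma poisson_range_ge:
  assumes T: "T \<ge> 0"
  shows "poisson_range T k n \<ge> 1 - 2 ^ k * exp (- T / 2) - exp T / 2 ^ n"
proof -
  let ?f = "\<lambda>j. T ^ j / fact j"
  let ?M = "(\<Sum>j\<in>{k..n}. ?f j) + 2 ^ k * exp (T / 2) + exp (2 * T) / 2 ^ n"
  have low: "(\<Sum>j<k. ?f j) \<le> 2 ^ k * exp (T / 2)"
  proof -
    have "(\<Sum>j<k. ?f j) \<le> (\<Sum>j<k. 2 ^ k * ((T / 2) ^ j / fact j))"
    proof (rule sum_mono)
      fix j assume "j \<in> {..<k}"
      then have "(2::real) ^ j \<le> 2 ^ k" by (intro power_increasing) auto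
      then have "2 ^ j * ((T / 2) ^ j / fact j) \<le> 2 ^ k * ((T / 2) ^ j / fact j)"
        using T by (intro mult_right_mono) auto
      then show "?f j \<le> 2 ^ k * ((T / 2) ^ j / fact j)"
        by (simp add: power_divide)
    qed
    also have "\<dots> \<le> 2 ^ k * exp (T / 2)"
      unfolding sum_distrib_left [symmetric] using T by (intro mult_left_mono sum_exp_series_le) auto
    finally show ?thesis .
  qed
  have high: "(\<Sum>j\<in>{n<..<N}. ?f j) \<le> exp (2 * T) / 2 ^ n" for N
  proof -
    have "(\<Sum>j\<in>{n<..<N}. ?f j) \<le> (\<Sum>j\<in>{n<..<N}. (1 / 2 ^ n) * ((2 * T) ^ j / fact j))"
    proof (rule sum_mono)
      fix j assume "j \<in> {n<..<N}"
      then have "(2::real) ^ n \<le> 2 ^ j" by (intro power_increasing) auto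
      then have "1 \<le> 1 / 2 ^ n * (2::real) ^ j" by simp
      then have "1 * ?f j \<le> (1 / 2 ^ n * 2 ^ j) * ?f j"
        using T by (intro mult_right_mono) auto
      then show "?f j \<le> (1 / 2 ^ n) * ((2 * T) ^ j / fact j)"
        by (simp add: power_mult_distrib)
    qed
    also have "\<dots> \<le> (1 / 2 ^ n) * exp (2 * T)"
      unfolding sum_distrib_left [symmetric] using T by (intro mult_left_mono sum_exp_series_le) auto
    finally show ?thesis by simp
  qed
  have un: "sum ?f (A \<union> B) \<le> sum ?f A + sum ?f B" if "finite A" "finite B" for A B
    using sum.union_inter [OF that, of ?f] sum_nonneg [of "A \<inter> B" ?f] T by simp
  have "(\<Sum>j<N. ?f j) \<le> ?M" for N
  proof -
    have "(\<Sum>j<N. ?f j) \<le> (\<Sum>j\<in>{..<k} \<union> {k..n} \<union> {n<..<N}. ?f j)"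
      using T by (intro sum_mono2) auto
    also have "\<dots> \<le> (\<Sum>j\<in>{..<k} \<union> {k..n}. ?f j) + (\<Sum>j\<in>{n<..<N}. ?f j)"
      by (intro un) auto
    also have "(\<Sum>j\<in>{..<k} \<union> {k..n}. ?f j) \<le> (\<Sum>j<k. ?f j) + (\<Sum>j\<in>{k..n}. ?f j)"
      by (intro un) auto
    finally show ?thesis using low high [of N] by simp
  qed
  moreover have f: "?f = (\<lambda>j. T ^ j /\<^sub>R fact j)"
    by (simp add: fun_eq_iff divide_inverse mult.commute)
  moreover have "summable ?f"
    unfolding f by (rule summable_exp_generic)
  ultimately have "exp T \<le> ?M"
    unfolding exp_def f [symmetric] by (intro suminf_le_const)
  then have "exp (- T) * exp T \<le> exp (- T) * ?M"
    by (intro mult_left_mono) auto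
  also have "\<dots> = poisson_range T k n + 2 ^ k * (exp (- T) * exp (T / 2)) + (exp (- T) * exp (2 * T)) / 2 ^ n"
    unfolding poisson_range_def distrib_left times_divide_eq_right by (simp only: mult_ac)
  also have "exp (- T) * exp (T / 2) = exp (- T / 2)"
    unfolding exp_add [symmetric] by (rule arg_cong [where f = exp]) simp
  also have "exp (- T) * exp (2 * T) = exp T"
    unfolding exp_add [symmetric] by (rule arg_cong [where f = exp]) simp
  also have "exp (- T) * exp T = 1"
    unfolding exp_add [symmetric] by simp
  finally show ?thesis by linarith
qed

text \<open>Given that a Poisson list has at least \<open>k\<close> entries, its first
  \<open>k\<close> are independent draws from the normalised intensity: summing out the rest of a
  list of length \<open>j\<close> gives a power of \<open>sum m A\<close>. So the distribution of
  the length separates from the expectation of \<open>G\<close>.\<close>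

lemma sum_short_lists_take:
  fixes G :: "'a list \<Rightarrow> real"
  assumes A: "finite A" and T: "sum m A > 0"
  shows "(\<Sum>xs\<in>short_lists A n. (\<Prod>x\<leftarrow>xs. m x) * (if k \<le> length xs then G (take k xs) else 0) / fact (length xs))
       = (\<Sum>j\<in>{k..n}. sum m A ^ j / fact j)
           * (\<Sum>us | set us \<subseteq> A \<and> length us = k. (\<Prod>x\<leftarrow>us. m x / sum m A) * G us)"
proof -
  let ?T = "sum m A"
  let ?H = "\<Sum>us | set us \<subseteq> A \<and> length us = k. (\<Prod>x\<leftarrow>us. m x / ?T) * G us"
  have scale: "(\<Prod>x\<leftarrow>us. m x / ?T) = (\<Prod>x\<leftarrow>us. m x) / ?T ^ length us" for us
    by (induction us) auto
  have inner: "(\<Sum>xs | set xs \<subseteq> A \<and> length xs = j.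
        (\<Prod>x\<leftarrow>xs. m x) * (if k \<le> length xs then G (take k xs) else 0) / fact (length xs))
      = (if k \<le> j then ?T ^ j / fact j * ?H else 0)" for j
  proof (cases "k \<le> j")
    case True
    then obtain i where j: "j = k + i" using le_Suc_ex by blast
    have "(\<Sum>xs | set xs \<subseteq> A \<and> length xs = j.
        (\<Prod>x\<leftarrow>xs. m x) * (if k \<le> length xs then G (take k xs) else 0) / fact (length xs))
      = (\<Sum>us | set us \<subseteq> A \<and> length us = k. \<Sum>vs | set vs \<subseteq> A \<and> length vs = i.
          ((\<Prod>x\<leftarrow>us. m x) * G us / fact j) * (\<Prod>x\<leftarrow>vs. m x))"
      unfolding j sum_lists_append [OF A] by (intro sum.cong refl) auto
    also have "\<dots> = (\<Sum>us | set us \<subseteq> A \<and> length us = k. ((\<Prod>x\<leftarrow>us. m x) * G us / fact j) * ?T ^ i)"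
      by (simp only: sum_distrib_left [symmetric] sum_lists_prod_list [OF A])
    also have "\<dots> = (\<Sum>us | set us \<subseteq> A \<and> length us = k. ?T ^ j / fact j * ((\<Prod>x\<leftarrow>us. m x / ?T) * G us))"
      using T by (intro sum.cong refl) (simp add: scale j power_add)
    also have "\<dots> = ?T ^ j / fact j * ?H"
      by (simp only: sum_distrib_left)
    finally show ?thesis using True by simp
  next
    case False
    then show ?thesis by (intro trans [OF sum.neutral]) auto
  qed
  have "(\<Sum>j\<le>n. if k \<le> j then ?T ^ j / fact j * ?H else 0) = (\<Sum>j\<in>{k..n}. ?T ^ j / fact j * ?H)"
    by (intro sum.mono_neutral_cong_right) auto
  then show ?thesis
    unfolding sum_short_lists_by_length [OF A] inner sum_distrib_right .
qed

text \<open>The cut is made for each label separately, since this shape splits exactly under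
  \<open>sum_shuffles\<close>; a bound on the joint length would couple the labels.\<close>

definition two_sided :: "('z \<Rightarrow> bool) \<Rightarrow> 'z set \<Rightarrow> nat \<Rightarrow> 'z list set" where
  "two_sided lab Z n =
     {zs. set zs \<subseteq> Z \<and> length (filter lab zs) \<le> n \<and> length (filter (\<lambda>z. \<not> lab z) zs) \<le> n}"

lemma two_sided_subset: "two_sided lab Z n \<subseteq> short_lists Z (2 * n)"
proof
  fix zs assume "zs \<in> two_sided lab Z n"
  then show "zs \<in> short_lists Z (2 * n)"
    using sum_length_filter_compl [of lab zs] by (auto simp: two_sided_def short_lists_def)
qed

text \<open>A tester for fixed sample sizes is run on the first samples of a Poisson list; if there
  are too few, this counts as the verdict \<open>False\<close>.\<close>

definition on_prefixes ::
  "('z \<Rightarrow> bool) \<Rightarrow> nat \<Rightarrow> nat \<Rightarrow> ('z list \<Rightarrow> 'z list \<Rightarrow> real) \<Rightarrow> 'z list \<Rightarrow> real" where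
  "on_prefixes lab k k' G zs =
     (if k \<le> length (filter lab zs) \<and> k' \<le> length (filter (\<lambda>z. \<not> lab z) zs)
      then G (take k (filter lab zs)) (take k' (filter (\<lambda>z. \<not> lab z) zs)) else 0)"

lemma prod_list_filter_split:
  fixes m :: "'z \<Rightarrow> 'c::comm_monoid_mult"
  shows "(\<Prod>z\<leftarrow>zs. m z) = (\<Prod>z\<leftarrow>filter lab zs. m z) * (\<Prod>z\<leftarrow>filter (\<lambda>z. \<not> lab z) zs. m z)"
  by (induction zs) (auto simp: mult_ac)

lemma sum_poisson_on_prefixes:
  fixes m :: "'z \<Rightarrow> real" and lab Z
  defines "A \<equiv> {z \<in> Z. lab z}" and "B \<equiv> {z \<in> Z. \<not> lab z}"
  assumes Z: "finite Z" and T: "sum m A > 0" "sum m B > 0"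
  shows "(\<Sum>zs\<in>two_sided lab Z n. poisson_weight Z m zs * on_prefixes lab k k' G zs)
       = poisson_range (sum m A) k n * poisson_range (sum m B) k' n *
         (\<Sum>us | set us \<subseteq> A \<and> length us = k. \<Sum>vs | set vs \<subseteq> B \<and> length vs = k'.
            (\<Prod>x\<leftarrow>us. m x / sum m A) * (\<Prod>x\<leftarrow>vs. m x / sum m B) * G us vs)"
proof -
  let ?S = "sum m A" and ?T = "sum m B"
  have fA: "finite A" and fB: "finite B" and Z_eq: "Z = A \<union> B" and dis: "A \<inter> B = {}"
    using Z by (auto simp: A_def B_def)
  have sumZ: "sum m Z = ?S + ?T"
    unfolding Z_eq using fA fB dis by (rule sum.union_disjoint)
  define h where "h xs ys = exp (- ?S) * exp (- ?T) * ((\<Prod>x\<leftarrow>xs. m x) * (\<Prod>x\<leftarrow>ys. m x) *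
      (if k \<le> length xs then if k' \<le> length ys then G (take k xs) (take k' ys) else 0 else 0))"
    for xs ys
  have filt: "filter lab zs = filter (\<lambda>z. z \<in> A) zs" "filter (\<lambda>z. \<not> lab z) zs = filter (\<lambda>z. z \<notin> A) zs"
    if "set zs \<subseteq> A \<union> B" for zs
    using that by (auto intro!: filter_cong simp: A_def B_def)
  have F: "two_sided lab Z n = {zs. set zs \<subseteq> A \<union> B \<and> length (filter (\<lambda>z. z \<in> A) zs) \<le> n
            \<and> length (filter (\<lambda>z. z \<notin> A) zs) \<le> n}"
    unfolding two_sided_def Z_eq using filt by auto
  have "(\<Sum>zs\<in>two_sided lab Z n. poisson_weight Z m zs * on_prefixes lab k k' G zs)
      = (\<Sum>zs\<in>two_sided lab Z n. h (filter (\<lambda>z. z \<in> A) zs) (filter (\<lambda>z. z \<notin> A) zs) / fact (length zs))"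
  proof (rule sum.cong [OF refl])
    fix zs assume "zs \<in> two_sided lab Z n"
    then have zs: "set zs \<subseteq> A \<union> B" by (auto simp: F)
    have "(\<Prod>z\<leftarrow>zs. m z) = (\<Prod>z\<leftarrow>filter (\<lambda>z. z \<in> A) zs. m z) * (\<Prod>z\<leftarrow>filter (\<lambda>z. z \<notin> A) zs. m z)"
      by (rule prod_list_filter_split)
    then show "poisson_weight Z m zs * on_prefixes lab k k' G zs
        = h (filter (\<lambda>z. z \<in> A) zs) (filter (\<lambda>z. z \<notin> A) zs) / fact (length zs)"
      by (simp add: poisson_weight_def on_prefixes_def h_def filt [OF zs] sumZ exp_diff exp_minus
          divide_inverse)
  qed
  also have "\<dots> = (\<Sum>xs\<in>short_lists A n. \<Sum>ys\<in>short_lists B n.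
            h xs ys / (fact (length xs) * fact (length ys)))"
    unfolding F by (rule sum_shuffles [OF fA fB dis])
  also have "\<dots> = (\<Sum>xs\<in>short_lists A n. exp (- ?S) * ((\<Prod>x\<leftarrow>xs. m x) * (if k \<le> length xs then
      exp (- ?T) * (\<Sum>ys\<in>short_lists B n. (\<Prod>x\<leftarrow>ys. m x) *
          (if k' \<le> length ys then G (take k xs) (take k' ys) else 0) / fact (length ys)) else 0)
      / fact (length xs)))"
    by (intro sum.cong refl) (simp add: h_def sum_distrib_left sum_divide_distrib mult_ac)
  also have "\<dots> = (\<Sum>xs\<in>short_lists A n. exp (- ?S) * ((\<Prod>x\<leftarrow>xs. m x) * (if k \<le> length xs then
      poisson_range ?T k' n * (\<Sum>vs | set vs \<subseteq> B \<and> length vs = k'. (\<Prod>x\<leftarrow>vs. m x / ?T) * G (take k xs) vs) else 0)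
      / fact (length xs)))"
    by (simp only: sum_short_lists_take [OF fB T(2)] poisson_range_def mult.assoc)
  also have "\<dots> = exp (- ?S) * (\<Sum>xs\<in>short_lists A n. (\<Prod>x\<leftarrow>xs. m x) * (if k \<le> length xs then
      poisson_range ?T k' n * (\<Sum>vs | set vs \<subseteq> B \<and> length vs = k'. (\<Prod>x\<leftarrow>vs. m x / ?T) * G (take k xs) vs) else 0)
      / fact (length xs))"
    by (simp only: sum_distrib_left)
  also have "\<dots> = poisson_range ?S k n * (\<Sum>us | set us \<subseteq> A \<and> length us = k. (\<Prod>x\<leftarrow>us. m x / ?S) *
      (poisson_range ?T k' n * (\<Sum>vs | set vs \<subseteq> B \<and> length vs = k'. (\<Prod>x\<leftarrow>vs. m x / ?T) * G us vs)))"
    by (subst sum_short_lists_take [OF fA T(1), where G =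
        "\<lambda>us. poisson_range ?T k' n * (\<Sum>vs | set vs \<subseteq> B \<and> length vs = k'. (\<Prod>x\<leftarrow>vs. m x / ?T) * G us vs)"])
       (simp only: poisson_range_def mult.assoc)
  also have "\<dots> = poisson_range ?S k n * poisson_range ?T k' n *
         (\<Sum>us | set us \<subseteq> A \<and> length us = k. \<Sum>vs | set vs \<subseteq> B \<and> length vs = k'.
            (\<Prod>x\<leftarrow>us. m x / ?S) * (\<Prod>x\<leftarrow>vs. m x / ?T) * G us vs)"
    unfolding sum_distrib_left by (intro sum.cong refl) (simp add: mult_ac)
  finally show ?thesis .
qed

lemma sum_poisson_two_sided:
  fixes m :: "'z \<Rightarrow> real" and lab Z
  defines "A \<equiv> {z \<in> Z. lab z}" and "B \<equiv> {z \<in> Z. \<not> lab z}"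
  assumes Z: "finite Z" and T: "sum m A > 0" "sum m B > 0"
  shows "(\<Sum>zs\<in>two_sided lab Z n. poisson_weight Z m zs)
       = poisson_range (sum m A) 0 n * poisson_range (sum m B) 0 n"
  using sum_poisson_on_prefixes [where m = m and Z = Z and lab = lab and n = n and k = 0 and k' = 0
      and G = "\<lambda>_ _. 1", OF Z, folded A_def B_def, OF T]
  by (simp add: on_prefixes_def lists_length_0 del: length_0_conv)

section \<open>Testers as finite sums over sample lists\<close>

lemma pmf_replicate_pmf:
  "pmf (replicate_pmf n p) xs = (if length xs = n then \<Prod>x\<leftarrow>xs. pmf p x else 0)"
proof (induction n arbitrary: xs)
  case 0
  then show ?case by (auto simp: indicator_def)
next
  case (Suc n)
  have eq: "replicate_pmf (Suc n) p = map_pmf (\<lambda>(x, xs). x # xs) (pair_pmf p (replicate_pmf n p))"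
    by (simp add: pair_pmf_def map_bind_pmf)
  show ?case
  proof (cases xs)
    case Nil
    then show ?thesis
      by (simp add: pmf_eq_0_set_pmf set_replicate_pmf del: replicate_pmf.simps)
  next
    case (Cons y ys)
    have "inj (\<lambda>(x :: 'a, xs). x # xs)"
      by (auto simp: inj_on_def)
    from pmf_map_inj' [OF this, of "pair_pmf p (replicate_pmf n p)" "(y, ys)"]
    show ?thesis
      unfolding eq Cons using Suc.IH [of ys] by (simp add: pmf_pair)
  qed
qed

lemma replicate_pmf_map_pmf: "replicate_pmf n (map_pmf f p) = map_pmf (map f) (replicate_pmf n p)"
  by (induction n) (simp_all add: map_bind_pmf bind_map_pmf)

lemma pmf_bind_finite:
  assumes "finite A" "set_pmf M \<subseteq> A"
  shows "pmf (bind_pmf M f) i = (\<Sum>x\<in>A. pmf M x * pmf (f x) i)"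
  unfolding pmf_bind using assms
  by (subst integral_measure_pmf_real [of A]) (auto simp: mult.commute)

definition normalized_pmf :: "'z set \<Rightarrow> ('z \<Rightarrow> real) \<Rightarrow> 'z pmf" where
  "normalized_pmf A m = embed_pmf (\<lambda>z. if z \<in> A then m z / sum m A else 0)"

lemma pmf_normalized_pmf:
  assumes "finite A" "\<And>z. z \<in> A \<Longrightarrow> m z \<ge> 0" "sum m A > 0"
  shows "pmf (normalized_pmf A m) z = (if z \<in> A then m z / sum m A else 0)"
  unfolding normalized_pmf_def
proof (rule pmf_embed_pmf)
  show "0 \<le> (if x \<in> A then m x / sum m A else 0)" for x
    using assms by auto
  have "(\<integral>\<^sup>+ x. ennreal (if x \<in> A then m x / sum m A else 0) \<partial>count_space UNIV)
      = (\<Sum>x\<in>A. ennreal (m x / sum m A))"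
    using assms(1) by (subst nn_integral_count_space' [of A]) auto
  also have "\<dots> = ennreal (\<Sum>x\<in>A. m x / sum m A)"
    using assms by (intro sum_ennreal) auto
  also have "(\<Sum>x\<in>A. m x / sum m A) = 1"
    using assms(3) by (simp add: sum_divide_distrib [symmetric])
  finally show "(\<integral>\<^sup>+ x. ennreal (if x \<in> A then m x / sum m A else 0) \<partial>count_space UNIV) = 1"
    by simp
qed

lemma set_normalized_pmf:
  assumes "finite A" "\<And>z. z \<in> A \<Longrightarrow> m z \<ge> 0" "sum m A > 0"
  shows "set_pmf (normalized_pmf A m) \<subseteq> A"
  using pmf_normalized_pmf [OF assms] by (auto simp: set_pmf_eq split: if_splits)

lemma pmf_run_tester:
  fixes T :: tester and cell :: "'z \<Rightarrow> nat \<times> nat"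
  assumes A: "finite A" "\<And>z. z \<in> A \<Longrightarrow> m z \<ge> 0" "sum m A > 0"
    and B: "finite B" "\<And>z. z \<in> B \<Longrightarrow> m z \<ge> 0" "sum m B > 0"
  shows "pmf (run_tester T k k' (map_pmf cell (normalized_pmf A m)) (map_pmf cell (normalized_pmf B m))) True
       = (\<Sum>us | set us \<subseteq> A \<and> length us = k. \<Sum>vs | set vs \<subseteq> B \<and> length vs = k'.
            (\<Prod>x\<leftarrow>us. m x / sum m A) * (\<Prod>x\<leftarrow>vs. m x / sum m B) * pmf (T (map cell us) (map cell vs)) True)"
proof -
  have fin: "finite {us. set us \<subseteq> A \<and> length us = j}" "finite {us. set us \<subseteq> B \<and> length us = j}" for j
    using A B by (simp_all add: finite_lists_length_eq)
  have sub: "set_pmf (replicate_pmf j (normalized_pmf A m)) \<subseteq> {us. set us \<subseteq> A \<and> length us = j}"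
    "set_pmf (replicate_pmf j (normalized_pmf B m)) \<subseteq> {us. set us \<subseteq> B \<and> length us = j}" for j
    using set_normalized_pmf [OF A] set_normalized_pmf [OF B] by (auto simp: set_replicate_pmf)
  have pm: "pmf (replicate_pmf k (normalized_pmf A m)) us = (\<Prod>x\<leftarrow>us. m x / sum m A)"
    if "us \<in> {us. set us \<subseteq> A \<and> length us = k}" for us
    using that pmf_normalized_pmf [OF A]
    by (auto simp: pmf_replicate_pmf intro!: arg_cong [where f = prod_list])
  have pm': "pmf (replicate_pmf k' (normalized_pmf B m)) us = (\<Prod>x\<leftarrow>us. m x / sum m B)"
    if "us \<in> {us. set us \<subseteq> B \<and> length us = k'}" for us
    using that pmf_normalized_pmf [OF B]
    by (auto simp: pmf_replicate_pmf intro!: arg_cong [where f = prod_list])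
  have "run_tester T k k' (map_pmf cell (normalized_pmf A m)) (map_pmf cell (normalized_pmf B m))
      = bind_pmf (replicate_pmf k (normalized_pmf A m)) (\<lambda>us.
          bind_pmf (replicate_pmf k' (normalized_pmf B m)) (\<lambda>vs. T (map cell us) (map cell vs)))"
    by (simp add: run_tester_def replicate_pmf_map_pmf bind_map_pmf)
  then show ?thesis
    by (simp add: pmf_bind_finite [OF fin(1) sub(1)] pmf_bind_finite [OF fin(2) sub(2)] pm pm'
        sum_distrib_left mult.assoc del: mem_Collect_eq)
qed

section \<open>Indistinguishability\<close>

lemma sum_product_prior:
  assumes "finite B" "finite \<Theta>" "sum \<pi> \<Theta> = 1"
  shows "sum (product_prior B \<pi>) (B \<rightarrow>\<^sub>E \<Theta>) = 1"
  using prod_sum_PiE [of B "\<lambda>_. \<Theta>" "\<lambda>_. \<pi>"] assms by (simp add: product_prior_def)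

text \<open>Only bin \<open>b\<close> carries a weight; every other factor of the product is a total
  mass, which is one.\<close>

lemma sum_product_prior_marginal:
  fixes \<pi> g :: "'t \<Rightarrow> real"
  assumes "finite B" "finite \<Theta>" "sum \<pi> \<Theta> = 1" "b \<in> B"
  shows "(\<Sum>\<theta>\<in>B \<rightarrow>\<^sub>E \<Theta>. product_prior B \<pi> \<theta> * g (\<theta> b)) = (\<Sum>t\<in>\<Theta>. \<pi> t * g t)"
proof -
  let ?w = "\<lambda>c t. \<pi> t * (if c = b then g t else 1)"
  have "(\<Sum>\<theta>\<in>B \<rightarrow>\<^sub>E \<Theta>. product_prior B \<pi> \<theta> * g (\<theta> b)) = (\<Sum>\<theta>\<in>B \<rightarrow>\<^sub>E \<Theta>. \<Prod>c\<in>B. ?w c (\<theta> c))"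
    using assms(1,4) by (intro sum.cong refl) (simp add: product_prior_def prod.distrib prod.delta')
  also have "\<dots> = (\<Prod>c\<in>B. \<Sum>t\<in>\<Theta>. ?w c t)"
    by (rule prod_sum_PiE [symmetric]) (use assms in auto)
  also have "\<dots> = (\<Sum>t\<in>\<Theta>. ?w b t) * (\<Prod>c\<in>B - {b}. \<Sum>t\<in>\<Theta>. ?w c t)"
    using assms by (intro prod.remove) auto
  also have "(\<Prod>c\<in>B - {b}. \<Sum>t\<in>\<Theta>. ?w c t) = 1"
    using assms by (intro prod.neutral) auto
  finally show ?thesis by simp
qed

lemma product_prior_nonneg: "(\<And>t. \<pi> t \<ge> 0) \<Longrightarrow> product_prior B \<pi> \<theta> \<ge> (0::real)"
  unfolding product_prior_def by (intro prod_nonneg) auto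

lemma sum_mixture_weighted:
  "(\<Sum>zs\<in>F. mixture \<Theta> \<pi> Z m zs * f zs) = (\<Sum>t\<in>\<Theta>. \<pi> t * (\<Sum>zs\<in>F. poisson_weight Z (m t) zs * f zs))"
  unfolding mixture_def sum_distrib_right sum_distrib_left by (subst sum.swap) (simp add: mult_ac)

lemma sum_prior_heavy:
  assumes "finite W" "W \<noteq> {}"
  shows "(\<Sum>t\<in>params W. prior h W t * of_bool (fst t)) = h"
  using assms
  by (simp add: sum_params prior_def card_gt_0_iff field_simps
      del: sum_of_bool_eq sum_mult_of_bool_eq sum_of_bool_mult_eq)

lemma on_prefixes_nonneg: "(\<And>us vs. 0 \<le> G us vs) \<Longrightarrow> 0 \<le> on_prefixes lab k k' G zs"
  by (simp add: on_prefixes_def)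

lemma on_prefixes_le_1: "(\<And>us vs. G us vs \<le> 1) \<Longrightarrow> on_prefixes lab k k' G zs \<le> 1"
  by (simp add: on_prefixes_def)

section \<open>Intensities on all bins\<close>

lemma sum_labelled:
  assumes "finite B" "finite X"
  shows "(\<Sum>z\<in>{z \<in> B \<times> X \<times> (UNIV :: bool set). snd (snd z) = \<tau>}. f z) = (\<Sum>b\<in>B. \<Sum>x\<in>X. f (b, x, \<tau>))"
proof -
  have "{z \<in> B \<times> X \<times> (UNIV :: bool set). snd (snd z) = \<tau>} = B \<times> X \<times> {\<tau>}" by auto
  then show ?thesis by (simp add: sum.cartesian_product')
qed

text \<open>The extra bin \<^term>\<open>None\<close> is an atom of known mass.  It keeps the total intensity, and hence
  the number of samples, bounded from below although the number of heavy bins is random.\<close>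

fun with_anchor :: "real \<Rightarrow> 'x \<Rightarrow> ('t \<Rightarrow> 'x \<times> bool \<Rightarrow> real) \<Rightarrow> 'b option \<Rightarrow> 't \<Rightarrow> 'x \<times> bool \<Rightarrow> real" where
  "with_anchor A x0 m None t y = (if fst y = x0 then A else 0)"
| "with_anchor A x0 m (Some b) t y = m t y"

definition intensity ::
  "real \<Rightarrow> 'x \<Rightarrow> ('t \<Rightarrow> 'x \<times> bool \<Rightarrow> real) \<Rightarrow> ('b option \<Rightarrow> 't) \<Rightarrow> 'b option \<times> 'x \<times> bool \<Rightarrow> real" where
  "intensity A x0 m \<theta> = (\<lambda>(b, y). with_anchor A x0 m b (\<theta> b) y)"

definition labelled :: "'b option set \<Rightarrow> 'x set \<Rightarrow> bool \<Rightarrow> ('b option \<times> 'x \<times> bool) set" where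
  "labelled B X \<tau> = {z \<in> B \<times> X \<times> UNIV. snd (snd z) = \<tau>}"

definition accept_prob ::
  "tester \<Rightarrow> nat \<Rightarrow> nat \<Rightarrow> ('b option \<times> 'x \<times> bool \<Rightarrow> nat \<times> nat) \<Rightarrow> 'b option set \<Rightarrow> 'x set
     \<Rightarrow> ('b option \<times> 'x \<times> bool \<Rightarrow> real) \<Rightarrow> real" where
  "accept_prob T k k' cell B X m =
     pmf (run_tester T k k' (map_pmf cell (normalized_pmf (labelled B X True) m))
            (map_pmf cell (normalized_pmf (labelled B X False) m))) True"

definition bins :: "'b set \<Rightarrow> 'b option set" where
  "bins I = insert None (Some ` I)"

definition heavy_count :: "'b set \<Rightarrow> ('b option \<Rightarrow> bool \<times> 'w \<times> real) \<Rightarrow> real" where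
  "heavy_count I \<theta> = (\<Sum>i\<in>I. of_bool (fst (\<theta> (Some i))))"

lemma finite_bins [simp]: "finite I \<Longrightarrow> finite (bins I)"
  by (simp add: bins_def)

lemma sum_bins: "finite I \<Longrightarrow> (\<Sum>b\<in>bins I. f b) = f None + (\<Sum>i\<in>I. f (Some i))"
  by (auto simp: bins_def sum.reindex)

lemma prod_bins: "finite I \<Longrightarrow> (\<Prod>b\<in>bins I. f b) = f None * (\<Prod>i\<in>I. f (Some i))"
  by (auto simp: bins_def prod.reindex)

lemma finite_labelled [simp]: "finite B \<Longrightarrow> finite X \<Longrightarrow> finite (labelled B X \<tau>)"
  by (simp add: labelled_def)

context gadget
begin

lemma sum_label_null:
  assumes "t \<in> params W"
  shows "(\<Sum>x\<in>X. null_intensity \<rho> r t (x, \<tau>)) = (if fst t then 1 else \<rho>)"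
  using assms sum_r by (auto simp: params_def null_intensity_def sum_distrib_left [symmetric])

lemma sum_label_alt:
  assumes "t \<in> params W"
  shows "(\<Sum>x\<in>X. alt_intensity \<rho> r d t (x, \<tau>)) = (if fst t then 1 else \<rho>)"
  using assms sum_r sum_d
  by (auto simp: params_def alt_intensity_def sum_distrib_left [symmetric] sum.distrib sum_subtractf sum_negf)

text \<open>The mass of either label under either hypothesis: it depends on the parameters only
  through the set of heavy bins. Hence \<open>p\<close> and \<open>q\<close> are normalised by the
  same number, and the Poisson factors of the two hypotheses coincide.\<close>

definition total :: "real \<Rightarrow> real \<Rightarrow> 'b set \<Rightarrow> ('b option \<Rightarrow> bool \<times> 'w \<times> real) \<Rightarrow> real" where
  "total A \<rho> I \<theta> = A + (\<Sum>i\<in>I. if fst (\<theta> (Some i)) then 1 else \<rho>)"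

lemma sum_intensity:
  assumes m: "\<And>t \<tau>. t \<in> params W \<Longrightarrow> (\<Sum>x\<in>X. m t (x, \<tau>)) = (if fst t then 1 else \<rho>)"
    and I: "finite I" and x0: "x0 \<in> X" and \<theta>: "\<theta> \<in> bins I \<rightarrow>\<^sub>E params W"
  shows "sum (intensity A x0 m \<theta>) (labelled (bins I) X \<tau>) = total A \<rho> I \<theta>"
proof -
  have "\<theta> (Some i) \<in> params W" if "i \<in> I" for i
    using PiE_mem [OF \<theta>, of "Some i"] that by (simp add: bins_def)
  then show ?thesis
    unfolding labelled_def using I finite_X x0
    by (simp add: sum_labelled sum_bins intensity_def m total_def)
qed

lemma total_ge: "0 \<le> \<rho> \<Longrightarrow> A \<le> total A \<rho> I \<theta>"
  unfolding total_def by (simp add: sum_nonneg)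

lemma total_le: "0 \<le> \<rho> \<Longrightarrow> \<rho> \<le> 1 \<Longrightarrow> total A \<rho> I \<theta> \<le> A + card I"
  using sum_bounded_above [of I "\<lambda>i. if fst (\<theta> (Some i)) then 1 else \<rho>" 1]
  unfolding total_def by auto

lemma intensity_nonneg:
  assumes "\<And>t y. t \<in> params W \<Longrightarrow> y \<in> letters \<Longrightarrow> m t y \<ge> 0" "A \<ge> 0"
    and "\<theta> \<in> bins I \<rightarrow>\<^sub>E params W" "z \<in> bins I \<times> letters"
  shows "intensity A x0 m \<theta> z \<ge> 0"
proof -
  obtain b y where z: "z = (b, y)" "b \<in> bins I" "y \<in> letters" using assms(4) by auto
  have "\<theta> b \<in> params W" using assms(3) z by (auto dest: PiE_mem)
  then show ?thesis using assms z by (cases b) (auto simp: intensity_def)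
qed

text \<open>For fixed parameters the expected verdict factors into the probability that enough
  samples of each label arrive and the acceptance probability of the tester on exactly
  \<open>k\<close> and \<open>k'\<close> samples.\<close>

lemma weighted_accept:
  fixes cell :: "'b option \<times> 'x \<times> bool \<Rightarrow> nat \<times> nat"
  assumes m: "\<And>t \<tau>. t \<in> params W \<Longrightarrow> (\<Sum>x\<in>X. m t (x, \<tau>)) = (if fst t then 1 else \<rho>)"
    and m0: "\<And>t y. t \<in> params W \<Longrightarrow> y \<in> letters \<Longrightarrow> m t y \<ge> 0"
    and I: "finite I" and x0: "x0 \<in> X" and A: "A > 0" and \<rho>: "\<rho> \<ge> 0"
    and \<theta>: "\<theta> \<in> bins I \<rightarrow>\<^sub>E params W"
  shows "(\<Sum>zs\<in>two_sided (\<lambda>z. snd (snd z)) (bins I \<times> letters) n.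
            poisson_weight (bins I \<times> letters) (intensity A x0 m \<theta>) zs *
            on_prefixes (\<lambda>z. snd (snd z)) k k' (\<lambda>us vs. pmf (T (map cell us) (map cell vs)) True) zs)
       = poisson_range (total A \<rho> I \<theta>) k n * poisson_range (total A \<rho> I \<theta>) k' n *
           accept_prob T k k' cell (bins I) X (intensity A x0 m \<theta>)" (is "?lhs = _")
    and "(\<Sum>zs\<in>two_sided (\<lambda>z. snd (snd z)) (bins I \<times> letters) n.
            poisson_weight (bins I \<times> letters) (intensity A x0 m \<theta>) zs)
       = poisson_range (total A \<rho> I \<theta>) 0 n * poisson_range (total A \<rho> I \<theta>) 0 n"
proof -
  let ?m = "intensity A x0 m \<theta>"
  have lab: "{z \<in> bins I \<times> letters. snd (snd z)} = labelled (bins I) X True"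
    "{z \<in> bins I \<times> letters. \<not> snd (snd z)} = labelled (bins I) X False"
    by (auto simp: labelled_def)
  have s: "sum ?m (labelled (bins I) X \<tau>) = total A \<rho> I \<theta>" for \<tau>
    using m I x0 \<theta> by (rule sum_intensity)
  have pos: "total A \<rho> I \<theta> > 0"
    using total_ge [OF \<rho>, of A I \<theta>] A by linarith
  have nn: "?m z \<ge> 0" if "z \<in> labelled (bins I) X \<tau>" for z \<tau>
    using that A m0 \<theta> by (intro intensity_nonneg [of m A \<theta> I]) (auto simp: labelled_def)
  have fin: "finite (bins I \<times> letters)" using I finite_X by simp
  have finl: "finite (labelled (bins I) X \<tau>)" for \<tau> using I finite_X by simp
  show "?lhs = poisson_range (total A \<rho> I \<theta>) k n * poisson_range (total A \<rho> I \<theta>) k' n *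
           accept_prob T k k' cell (bins I) X ?m"
    unfolding accept_prob_def
    by (subst sum_poisson_on_prefixes [OF fin], unfold lab s)
       (use pos in \<open>simp_all add: pmf_run_tester [OF finl nn _ finl nn] s\<close>)
  show "(\<Sum>zs\<in>two_sided (\<lambda>z. snd (snd z)) (bins I \<times> letters) n. poisson_weight (bins I \<times> letters) ?m zs)
       = poisson_range (total A \<rho> I \<theta>) 0 n * poisson_range (total A \<rho> I \<theta>) 0 n"
    by (subst sum_poisson_two_sided [OF fin], unfold lab s) (use pos in simp_all)
qed

text \<open>The verdicts are averaged over the two priors and compared through the L1 distance of
  the mixtures. The anchor alone yields \<open>20 * (k + k')\<close> expected samples of each label,
  so a shortage is unlikely. The expected number of heavy bins is
  \<open>h * card I = \<Lambda> / 400\<close>, so by Markov's inequality the bound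
  \<open>\<Lambda> / 4\<close> in \<open>alt\<close> fails with probability at most
  \<open>1 / 100\<close>.\<close>

theorem indistinguishable:
  fixes T :: tester and cell :: "'b option \<times> 'x \<times> bool \<Rightarrow> nat \<times> nat" and I :: "'b set"
    and k k' :: nat and h \<rho> :: real
  defines "\<Lambda> \<equiv> 40 * real (k + k')"
  assumes I: "finite I" and x0: "x0 \<in> X" and M: "k + k' \<ge> 1"
    and h: "h * (400 * card I) = \<Lambda>" "h \<le> 1" and \<rho>: "0 \<le> \<rho>" "\<rho> \<le> 1 / 4"
    and small: "card I * (exp 2 / h * (40 * \<eta> * \<rho> ^ 4 + 512 * \<rho> ^ 8)) \<le> 1 / 200"
    and null: "\<And>\<theta>. \<theta> \<in> bins I \<rightarrow>\<^sub>E params W \<Longrightarrow>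
        accept_prob T k k' cell (bins I) X (intensity (\<Lambda> / 2) x0 (null_intensity \<rho> r) \<theta>) \<ge> 2 / 3"
    and alt: "\<And>\<theta>. \<theta> \<in> bins I \<rightarrow>\<^sub>E params W \<Longrightarrow> heavy_count I \<theta> \<le> \<Lambda> / 4 \<Longrightarrow>
        accept_prob T k k' cell (bins I) X (intensity (\<Lambda> / 2) x0 (alt_intensity \<rho> r d) \<theta>) \<le> 1 / 3"
  shows False
proof -
  let ?A = "\<Lambda> / 2" and ?\<Theta> = "bins I \<rightarrow>\<^sub>E params W"
  let ?pi = "product_prior (bins I) (prior h W)"
  let ?m0 = "null_intensity \<rho> r" and ?m1 = "alt_intensity \<rho> r d"
  let ?i0 = "intensity ?A x0 ?m0" and ?i1 = "intensity ?A x0 ?m1"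
  let ?Z = "bins I \<times> letters"
  let ?tot = "total ?A \<rho> I"
  let ?test = "on_prefixes (\<lambda>z. snd (snd z)) k k' (\<lambda>us vs. pmf (T (map cell us) (map cell vs)) True)"
  have \<Lambda>: "\<Lambda> \<ge> 40" using M by (simp add: \<Lambda>_def)
  have h0: "h > 0"
  proof (rule ccontr)
    assume "\<not> h > 0"
    then have "h * (400 * card I) \<le> 0" by (intro mult_nonpos_nonneg) auto
    then show False using h \<Lambda> by linarith
  qed
  have fin: "finite (bins I)" "finite (params W)" "finite letters" "finite ?\<Theta>"
    using I finite_W finite_X by (auto intro!: finite_PiE)
  have sum_pi: "sum ?pi ?\<Theta> = 1"
    using fin sum_prior [OF finite_W W_nonempty] by (intro sum_product_prior) auto
  have pi_nonneg: "?pi \<theta> \<ge> 0" for \<theta>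
    using h h0 by (intro product_prior_nonneg prior_nonneg) auto
  \<comment> \<open>A cut-off for which the upper tail of every possible total is at most
    \<open>1 / 1000\<close>; no later bound depends on its size.\<close>
  obtain n where n: "exp (?A + card I) * 1000 < 2 ^ n"
    using real_arch_pow [of 2] by auto
  have tail: "poisson_range (?tot \<theta>) j n \<ge> 99 / 100" if "j \<le> k + k'" for \<theta> j
  proof -
    have lo: "?tot \<theta> \<ge> 20 * real (k + k')" using total_ge [of \<rho> ?A I \<theta>] \<rho> by (simp add: \<Lambda>_def)
    have hi: "?tot \<theta> \<le> ?A + card I" using \<rho> by (intro total_le) auto
    \<comment> \<open>Half of the total is at least \<open>10 * (k + k')\<close>, so its exponential
      exceeds \<open>2 ^ j\<close> by the factor \<open>2 ^ 9\<close>; this and the cut-off stay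
      below \<open>1 / 100\<close>.\<close>
    have "(2::real) ^ j * 2 ^ 9 \<le> 2 ^ (k + k') * 2 ^ (9 * (k + k'))"
      using that M by (intro mult_mono power_increasing) auto
    also have "\<dots> = 2 ^ (10 * (k + k'))"
      by (simp flip: power_add)
    also have "\<dots> \<le> exp (real (10 * (k + k')))"
      by (rule power_2_le_exp)
    also have "\<dots> \<le> exp (?tot \<theta> / 2)"
      using lo by simp
    finally have "2 ^ j * 512 \<le> exp (?tot \<theta> / 2)" by simp
    then have "2 ^ j * exp (- ?tot \<theta> / 2) \<le> 1 / 512"
      by (simp add: exp_minus field_simps)
    moreover have "exp (?tot \<theta>) / 2 ^ n \<le> 1 / 1000"
    proof -
      have "exp (?tot \<theta>) * 1000 \<le> exp (?A + card I) * 1000" using hi by simp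
      also have "\<dots> \<le> 2 ^ n" using n by simp
      finally show ?thesis by (simp add: field_simps)
    qed
    moreover have "poisson_range (?tot \<theta>) j n \<ge> 1 - 2 ^ j * exp (- ?tot \<theta> / 2) - exp (?tot \<theta>) / 2 ^ n"
      using lo by (intro poisson_range_ge) linarith
    ultimately show ?thesis by linarith
  qed
  have tot_nonneg: "?tot \<theta> \<ge> 0" for \<theta>
    using total_ge [of \<rho> ?A I \<theta>] \<rho> \<Lambda> by linarith
  have tail_le: "poisson_range (?tot \<theta>) j n \<le> 1" for \<theta> j
    by (rule poisson_range_le_1 [OF tot_nonneg])
  have tail2: "49 / 50 \<le> poisson_range (?tot \<theta>) j n * poisson_range (?tot \<theta>) j' n"
    "poisson_range (?tot \<theta>) j n * poisson_range (?tot \<theta>) j' n \<le> 1"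
    if "j \<le> k + k'" "j' \<le> k + k'" for \<theta> j j'
  proof -
    have "(99 / 100) * (99 / 100) \<le> poisson_range (?tot \<theta>) j n * poisson_range (?tot \<theta>) j' n"
      using tail [OF that(1)] tail [OF that(2)] poisson_range_nonneg [OF tot_nonneg]
      by (intro mult_mono) auto
    then show "49 / 50 \<le> poisson_range (?tot \<theta>) j n * poisson_range (?tot \<theta>) j' n" by simp
    show "poisson_range (?tot \<theta>) j n * poisson_range (?tot \<theta>) j' n \<le> 1"
      using tail_le poisson_range_nonneg [OF tot_nonneg] by (intro mult_le_one) auto
  qed
  define F where "F = two_sided (\<lambda>z. snd (snd z)) ?Z n"
  have F_sub: "F \<subseteq> short_lists ?Z (2 * n)"
    unfolding F_def by (rule two_sided_subset)
  define P where "P = mixture ?\<Theta> ?pi ?Z ?i0"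
  define Q where "Q = mixture ?\<Theta> ?pi ?Z ?i1"
  have PW: "(\<Sum>zs\<in>F. P zs * f zs) = (\<Sum>\<theta>\<in>?\<Theta>. ?pi \<theta> * (\<Sum>zs\<in>F. poisson_weight ?Z (?i0 \<theta>) zs * f zs))"
    and QW: "(\<Sum>zs\<in>F. Q zs * f zs) = (\<Sum>\<theta>\<in>?\<Theta>. ?pi \<theta> * (\<Sum>zs\<in>F. poisson_weight ?Z (?i1 \<theta>) zs * f zs))" for f
    unfolding P_def Q_def by (rule sum_mixture_weighted)+
  have m0: "\<And>t y. t \<in> params W \<Longrightarrow> y \<in> letters \<Longrightarrow> ?m0 t y \<ge> 0"
    "\<And>t y. t \<in> params W \<Longrightarrow> y \<in> letters \<Longrightarrow> ?m1 t y \<ge> 0"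
    using \<rho> null_intensity_nonneg alt_intensity_nonneg by auto
  have A0: "?A > 0" using \<Lambda> by simp
  note acc0 = weighted_accept [where n = n, OF sum_label_null m0(1) I x0 A0 \<rho>(1), folded F_def]
  note acc1 = weighted_accept [where n = n, OF sum_label_alt m0(2) I x0 A0 \<rho>(1), folded F_def]
  have sumP: "(\<Sum>zs\<in>F. P zs) \<le> 1"
  proof -
    have "(\<Sum>zs\<in>F. P zs) = (\<Sum>\<theta>\<in>?\<Theta>. ?pi \<theta> * (poisson_range (?tot \<theta>) 0 n * poisson_range (?tot \<theta>) 0 n))"
      using PW [of "\<lambda>_. 1"] by (simp add: acc0(2))
    also have "\<dots> \<le> (\<Sum>\<theta>\<in>?\<Theta>. ?pi \<theta> * 1)"
      using tail2(2) pi_nonneg by (intro sum_mono mult_left_mono) auto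
    finally show ?thesis using sum_pi by simp
  qed
  have sumQ: "(\<Sum>zs\<in>F. Q zs) \<ge> 1 - 1 / 50"
  proof -
    have "(\<Sum>\<theta>\<in>?\<Theta>. ?pi \<theta> * (49 / 50)) \<le> (\<Sum>\<theta>\<in>?\<Theta>. ?pi \<theta> * (poisson_range (?tot \<theta>) 0 n * poisson_range (?tot \<theta>) 0 n))"
      using tail2(1) pi_nonneg by (intro sum_mono mult_left_mono) auto
    also have "\<dots> = (\<Sum>zs\<in>F. Q zs)"
      using QW [of "\<lambda>_. 1"] by (simp add: acc1(2))
    finally show ?thesis using sum_pi by (simp flip: sum_divide_distrib sum_distrib_right)
  qed
  \<comment> \<open>The anchor is the same under both hypotheses and adds no divergence.\<close>
  define c where "c b = (if b = None then 0 else exp 2 / h * (40 * \<eta> * \<rho> ^ 4 + 512 * \<rho> ^ 8))"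
    for b :: "'b option"
  have close: "(\<Sum>zs\<in>F. \<bar>P zs - Q zs\<bar>)\<^sup>2 \<le> (\<Prod>b\<in>bins I. 1 + c b) - 1 + 2 * (1 / 50)"
  proof -
    have PQ: "P = mixture ?\<Theta> ?pi ?Z (\<lambda>\<theta> (b, y). with_anchor ?A x0 ?m0 b (\<theta> b) y)"
      "Q = mixture ?\<Theta> ?pi ?Z (\<lambda>\<theta> (b, y). with_anchor ?A x0 ?m1 b (\<theta> b) y)"
      by (simp_all add: P_def Q_def intensity_def [abs_def])
    show ?thesis
      unfolding PQ
    proof (rule product_mixtures_close [OF fin(1-3)])
      show "prior h W t \<ge> 0" for t using h h0 by (intro prior_nonneg) auto
      show "with_anchor ?A x0 ?m0 b t y \<ge> 0" if "t \<in> params W" "y \<in> letters" for b :: "'b option" and t y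
        using that m0 A0 by (cases b) auto
      show "mixture (params W) (prior h W) letters (with_anchor ?A x0 ?m1 b) l = 0"
        if "set l \<subseteq> letters" "mixture (params W) (prior h W) letters (with_anchor ?A x0 ?m0 b) l = 0"
        for b :: "'b option" and l
      proof (cases b)
        case None
        have "with_anchor ?A x0 ?m1 b = with_anchor ?A x0 ?m0 b"
          by (simp add: None fun_eq_iff)
        then show ?thesis using that by simp
      next
        case (Some i)
        have "with_anchor ?A x0 m b = m" for m :: "bool \<times> 'w \<times> real \<Rightarrow> 'x \<times> bool \<Rightarrow> real"
          by (simp add: Some fun_eq_iff)
        then show ?thesis
          using that mixture_null_eq_0 [OF h0 h(2) \<rho>(1) that(1)] by simp
      qed
      show "(\<Sum>l\<in>short_lists letters (2 * n). (mixture (params W) (prior h W) letters (with_anchor ?A x0 ?m1 b) l)\<^sup>2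
            / mixture (params W) (prior h W) letters (with_anchor ?A x0 ?m0 b) l) \<le> 1 + c b"
        for b :: "'b option"
      proof (cases b)
        case None
        let ?p = "mixture (params W) (prior h W) letters (with_anchor ?A x0 ?m0 b)"
        have eq: "with_anchor ?A x0 ?m1 b = with_anchor ?A x0 ?m0 b"
          by (simp add: None fun_eq_iff)
        have "(\<Sum>l\<in>short_lists letters (2 * n). (?p l)\<^sup>2 / ?p l) = (\<Sum>l\<in>short_lists letters (2 * n). ?p l)"
          by (simp add: power2_eq_square)
        also have "\<dots> = (\<Sum>t\<in>params W. prior h W t * poisson_cdf (sum (with_anchor ?A x0 ?m0 b t) letters) (2 * n))"
          by (rule sum_mixture [OF fin(3)])
        also have "\<dots> \<le> (\<Sum>t\<in>params W. prior h W t * 1)"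
          using h h0 A0 by (intro sum_mono mult_left_mono poisson_cdf_le_1 prior_nonneg sum_nonneg) (auto simp: None)
        also have "\<dots> = 1" using sum_prior [OF finite_W W_nonempty] by simp
        finally show ?thesis unfolding eq by (simp add: c_def None)
      next
        case (Some i)
        have "with_anchor ?A x0 m b = m" for m :: "bool \<times> 'w \<times> real \<Rightarrow> 'x \<times> bool \<Rightarrow> real"
          by (simp add: Some fun_eq_iff)
        then show ?thesis
          using sum_chi_square [OF h0 h(2) \<rho>, of "2 * n"] by (simp add: c_def Some)
      qed
      show "F \<subseteq> short_lists ?Z (2 * n)" by (fact F_sub)
    qed (use sumP sumQ in \<open>simp_all add: PQ\<close>)
  qed
  \<comment> \<open>By \<open>(1 + x) ^ n \<le> exp (n * x) \<le> 1 + n * x + (n *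
    x)\<^sup>2\<close> with \<open>n * x \<le> 1 / 200\<close>.\<close>
  have "(\<Prod>b\<in>bins I. 1 + c b) \<le> 1 + 1 / 100"
  proof -
    define x where "x = exp 2 / h * (40 * \<eta> * \<rho> ^ 4 + 512 * \<rho> ^ 8)"
    have x: "x \<ge> 0" "card I * x \<le> 1 / 200"
      using h0 \<rho> \<eta>_nonneg small by (auto simp: x_def intro!: divide_nonneg_pos mult_nonneg_nonneg add_nonneg_nonneg)
    have "(\<Prod>b\<in>bins I. 1 + c b) = (1 + x) ^ card I"
      using I by (simp add: prod_bins c_def x_def)
    also have "\<dots> \<le> exp x ^ card I"
      using x by (intro power_mono) auto
    also have "\<dots> = exp (card I * x)"
      by (simp add: exp_of_nat_mult)
    also have "\<dots> \<le> 1 + card I * x + (card I * x)\<^sup>2"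
      using x by (intro exp_bound) auto
    also have "(card I * x)\<^sup>2 \<le> 1 / 200"
    proof -
      have "(card I * x) * (card I * x) \<le> (1 / 200) * 1"
        using x by (intro mult_mono) auto
      then show ?thesis by (simp add: power2_eq_square)
    qed
    finally show ?thesis using x(2) by simp
  qed
  \<comment> \<open>\<open>1 / 100 + 2 / 50 = 0.05\<close>, which is below
    \<open>0.24 ^ 2 = 0.0576\<close>.\<close>
  with close have "(\<Sum>zs\<in>F. \<bar>P zs - Q zs\<bar>)\<^sup>2 \<le> (6 / 25)\<^sup>2"
    by (simp add: power2_eq_square)
  then have dist: "(\<Sum>zs\<in>F. \<bar>P zs - Q zs\<bar>) \<le> 6 / 25"
    by (rule power2_le_imp_le) simp
  have test01: "0 \<le> ?test zs" "?test zs \<le> 1" for zs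
    by (intro on_prefixes_nonneg on_prefixes_le_1; simp add: pmf_le_1)+
  have "(\<Sum>zs\<in>F. P zs * ?test zs) - (\<Sum>zs\<in>F. Q zs * ?test zs) = (\<Sum>zs\<in>F. (P zs - Q zs) * ?test zs)"
    by (simp add: sum_subtractf left_diff_distrib)
  also have "\<dots> \<le> (\<Sum>zs\<in>F. \<bar>P zs - Q zs\<bar> * 1)"
  proof (rule sum_mono)
    fix zs
    have "(P zs - Q zs) * ?test zs \<le> \<bar>P zs - Q zs\<bar> * ?test zs"
      by (rule mult_right_mono [OF abs_ge_self test01(1)])
    also have "\<dots> \<le> \<bar>P zs - Q zs\<bar> * 1"
      by (rule mult_left_mono [OF test01(2) abs_ge_zero])
    finally show "(P zs - Q zs) * ?test zs \<le> \<bar>P zs - Q zs\<bar> * 1" .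
  qed
  finally have gap: "(\<Sum>zs\<in>F. P zs * ?test zs) \<le> (\<Sum>zs\<in>F. Q zs * ?test zs) + 6 / 25"
    using dist by simp
  have "49 / 50 * (2 / 3) = (\<Sum>\<theta>\<in>?\<Theta>. ?pi \<theta> * (49 / 50 * (2 / 3)))"
    unfolding sum_distrib_right [symmetric] sum_pi by simp
  also have "\<dots> \<le> (\<Sum>\<theta>\<in>?\<Theta>. ?pi \<theta> * (poisson_range (?tot \<theta>) k n * poisson_range (?tot \<theta>) k' n *
            accept_prob T k k' cell (bins I) X (?i0 \<theta>)))"
  proof (intro sum_mono mult_left_mono pi_nonneg)
    fix \<theta> assume "\<theta> \<in> ?\<Theta>"
    then show "49 / 50 * (2 / 3) \<le> poisson_range (?tot \<theta>) k n * poisson_range (?tot \<theta>) k' n *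
            accept_prob T k k' cell (bins I) X (?i0 \<theta>)"
      using tail2 [of k k' \<theta>] null by (intro mult_mono) auto
  qed
  also have "\<dots> = (\<Sum>zs\<in>F. P zs * ?test zs)"
    unfolding PW by (intro sum.cong refl) (simp add: acc0(1))
  finally have lower: "49 / 50 * (2 / 3) \<le> (\<Sum>zs\<in>F. P zs * ?test zs)" .
  have "(\<Sum>zs\<in>F. Q zs * ?test zs) = (\<Sum>\<theta>\<in>?\<Theta>. ?pi \<theta> * (poisson_range (?tot \<theta>) k n * poisson_range (?tot \<theta>) k' n *
            accept_prob T k k' cell (bins I) X (?i1 \<theta>)))"
    unfolding QW by (intro sum.cong refl) (simp add: acc1(1))
  \<comment> \<open>Markov's inequality before averaging: where \<open>alt\<close> does not apply,
    the added term exceeds one and so covers any acceptance probability.\<close>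
  also have "\<dots> \<le> (\<Sum>\<theta>\<in>?\<Theta>. ?pi \<theta> * (1 / 3 + 4 / \<Lambda> * heavy_count I \<theta>))"
  proof (intro sum_mono mult_left_mono pi_nonneg)
    fix \<theta> assume \<theta>: "\<theta> \<in> ?\<Theta>"
    let ?a = "accept_prob T k k' cell (bins I) X (?i1 \<theta>)"
    have a: "0 \<le> ?a" "?a \<le> 1" by (simp_all add: accept_prob_def pmf_le_1)
    have "poisson_range (?tot \<theta>) k n * poisson_range (?tot \<theta>) k' n * ?a \<le> 1 * ?a"
      using tail2 [of k k' \<theta>] a by (intro mult_right_mono) auto
    also have "1 * ?a \<le> 1 / 3 + 4 / \<Lambda> * heavy_count I \<theta>"
    proof (cases "heavy_count I \<theta> \<le> \<Lambda> / 4")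
      case True
      have "0 \<le> 4 / \<Lambda> * heavy_count I \<theta>"
        using \<Lambda> by (simp add: heavy_count_def sum_nonneg del: sum_of_bool_eq)
      then show ?thesis using alt [OF \<theta> True] by simp
    next
      case False
      then have "4 / \<Lambda> * heavy_count I \<theta> \<ge> 1"
        using \<Lambda> by (simp add: field_simps)
      then show ?thesis using a by linarith
    qed
    finally show "poisson_range (?tot \<theta>) k n * poisson_range (?tot \<theta>) k' n * ?a \<le> 1 / 3 + 4 / \<Lambda> * heavy_count I \<theta>" .
  qed
  also have "\<dots> = 1 / 3 * (\<Sum>\<theta>\<in>?\<Theta>. ?pi \<theta>) + 4 / \<Lambda> * (\<Sum>\<theta>\<in>?\<Theta>. ?pi \<theta> * heavy_count I \<theta>)"
    unfolding sum_distrib_left sum.distrib [symmetric] by (intro sum.cong refl) (simp add: algebra_simps)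
  also have "(\<Sum>\<theta>\<in>?\<Theta>. ?pi \<theta> * heavy_count I \<theta>)
      = (\<Sum>i\<in>I. \<Sum>\<theta>\<in>?\<Theta>. ?pi \<theta> * of_bool (fst (\<theta> (Some i))))"
    unfolding heavy_count_def sum_distrib_left by (rule sum.swap)
  also have "\<dots> = (\<Sum>i\<in>I. h)"
  proof (rule sum.cong [OF refl])
    fix i assume "i \<in> I"
    then have "Some i \<in> bins I" by (simp add: bins_def)
    then show "(\<Sum>\<theta>\<in>?\<Theta>. ?pi \<theta> * of_bool (fst (\<theta> (Some i)))) = h"
      using sum_product_prior_marginal [of "bins I" "params W" "prior h W" "Some i" "\<lambda>t. of_bool (fst t)"]
        fin sum_prior [OF finite_W W_nonempty] sum_prior_heavy [OF finite_W W_nonempty]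
      by simp
  qed
  also have "1 / 3 * (\<Sum>\<theta>\<in>?\<Theta>. ?pi \<theta>) + 4 / \<Lambda> * (\<Sum>i\<in>I. h) = 1 / 3 + 1 / 100"
    using h(1) \<Lambda> unfolding sum_pi by (simp add: field_simps)
  \<comment> \<open>The null side is at least \<open>0.98 * 2 / 3 > 0.65\<close>, while the
    alternative allows at most \<open>1 / 3 + 0.01 + 0.24 < 0.59\<close>.\<close>
  finally show False
    using gap lower by simp
qed

end

section \<open>Embedding the bins into the grid\<close>

lemma prob_map_normalized_pmf:
  assumes "finite A" "\<And>z. z \<in> A \<Longrightarrow> m z \<ge> 0" "sum m A > 0"
  shows "measure_pmf.prob (map_pmf cell (normalized_pmf A m)) S
       = (\<Sum>z\<in>A. m z * of_bool (cell z \<in> S)) / sum m A"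
proof -
  let ?P = "normalized_pmf A m"
  have "measure_pmf.prob (map_pmf cell ?P) S = measure_pmf.prob ?P (cell -` S)"
    by simp
  also have "\<dots> = measure_pmf.prob ?P (cell -` S \<inter> set_pmf ?P)"
    by (rule measure_Int_set_pmf [symmetric])
  also have "cell -` S \<inter> set_pmf ?P = {z \<in> A. cell z \<in> S} \<inter> set_pmf ?P"
    using set_normalized_pmf [OF assms] by auto
  also have "measure_pmf.prob ?P \<dots> = measure_pmf.prob ?P {z \<in> A. cell z \<in> S}"
    by (rule measure_Int_set_pmf)
  also have "\<dots> = (\<Sum>z\<in>{z \<in> A. cell z \<in> S}. pmf ?P z)"
    by (rule measure_measure_pmf_finite) (use assms in simp)
  also have "\<dots> = (\<Sum>z\<in>A. m z / sum m A * of_bool (cell z \<in> S))"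
    using assms(1) by (intro sum.mono_neutral_cong_left) (auto simp: pmf_normalized_pmf [OF assms])
  finally show ?thesis by (simp add: sum_divide_distrib)
qed

section \<open>Lower bounds for the rectangle distance\<close>

lemma sum_prob_disjoint_le_1:
  assumes "finite I" "disjoint_family_on R I"
  shows "(\<Sum>i\<in>I. measure_pmf.prob p (R i)) \<le> 1"
  using measure_pmf.finite_measure_finite_Union [of I R p] measure_pmf.prob_le_1 [of p "\<Union> (R ` I)"] assms
  by simp

text \<open>Empty rectangles pad the family to exactly \<open>k\<close> members. The supremum is one
  over a bounded set, as \<open>cSup_upper\<close> requires: disjoint sets have total mass at most
  one under each distribution, so \<open>2\<close> is an upper bound.\<close>

lemma Ak_dist_ge:
  fixes p q :: "(nat \<times> nat) pmf"
  assumes I: "finite I" "card I \<le> k"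
    and rect: "\<And>i. i \<in> I \<Longrightarrow> axis_rectangle (R i)" and disj: "disjoint_family_on R I"
  shows "(\<Sum>i\<in>I. \<bar>measure_pmf.prob p (R i) - measure_pmf.prob q (R i)\<bar>) \<le> Ak_dist k p q"
proof -
  let ?D = "\<lambda>S. \<bar>measure_pmf.prob p S - measure_pmf.prob q S\<bar>"
  obtain e where e: "bij_betw e {0..<card I} I"
    using ex_bij_betw_nat_finite [OF I(1)] by auto
  define R' where "R' i = (if i < card I then R (e i) else {1..0} \<times> {1..0})" for i
  have mem: "e i \<in> I" if "i < card I" for i
    using e that by (auto simp: bij_betw_def)
  have rect': "axis_rectangle (R' i)" for i
  proof (cases "i < card I")
    case True
    then show ?thesis using rect [OF mem] by (simp add: R'_def)
  next
    case False
    then have "R' i = {1..0} \<times> {1..0}" by (simp add: R'_def)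
    then show ?thesis unfolding axis_rectangle_def by blast
  qed
  have disj': "disjoint_family_on R' {..<k}"
    unfolding disjoint_family_on_def
  proof (intro ballI impI)
    fix i j assume "i \<in> {..<k}" "j \<in> {..<k}" "i \<noteq> j"
    show "R' i \<inter> R' j = {}"
    proof (cases "i < card I \<and> j < card I")
      case True
      then have "e i \<noteq> e j"
        using e \<open>i \<noteq> j\<close> by (auto simp: bij_betw_def inj_on_def)
      then show ?thesis
        using True disj mem by (auto simp: R'_def disjoint_family_on_def)
    qed (auto simp: R'_def)
  qed
  have "(\<Sum>i\<in>I. ?D (R i)) = (\<Sum>i\<in>{0..<card I}. ?D (R (e i)))"
    using sum.reindex_bij_betw [OF e, of "\<lambda>i. ?D (R i)"] by simp
  also have "\<dots> = (\<Sum>i<k. ?D (R' i))"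
    using I(2) by (intro sum.mono_neutral_cong_left) (auto simp: R'_def)
  also have "\<dots> \<le> Ak_dist k p q"
    unfolding Ak_dist_def
  proof (rule cSup_upper)
    show "(\<Sum>i<k. ?D (R' i)) \<in> {\<Sum>i<k. ?D (R i) |R.
            (\<forall>i<k. axis_rectangle (R i)) \<and> disjoint_family_on R {..<k}}"
      using rect' disj' by blast
    show "bdd_above {\<Sum>i<k. ?D (R i) |R. (\<forall>i<k. axis_rectangle (R i)) \<and> disjoint_family_on R {..<k}}"
    proof (rule bdd_aboveI)
      fix x assume "x \<in> {\<Sum>i<k. ?D (R i) |R. (\<forall>i<k. axis_rectangle (R i)) \<and> disjoint_family_on R {..<k}}"
      then obtain R where x: "x = (\<Sum>i<k. ?D (R i))" and R: "disjoint_family_on R {..<k}"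
        by blast
      have "x \<le> (\<Sum>i<k. measure_pmf.prob p (R i) + measure_pmf.prob q (R i))"
        unfolding x by (intro sum_mono) (auto simp: abs_le_iff intro: add_increasing add_increasing2)
      also have "\<dots> \<le> 1 + 1"
        unfolding sum.distrib by (intro add_mono sum_prob_disjoint_le_1 R) auto
      finally show "x \<le> 2" by simp
    qed
  qed
  finally show ?thesis .
qed

text \<open>Bin \<open>(i, j)\<close> becomes the block of side \<open>N\<close> that starts one
  past \<open>(i * N, j * N)\<close>, as local coordinates run from 1 to \<open>N\<close>. The
  anchor is put at the corner \<open>(V, V)\<close>, which lies outside all \<open>g * g\<close>
  blocks as soon as \<open>g * N < V\<close>.\<close>

fun cell :: "nat \<Rightarrow> nat \<Rightarrow> (nat \<times> nat) option \<times> (int \<times> int) \<times> bool \<Rightarrow> nat \<times> nat" where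
  "cell V N (None, _, _) = (V, V)"
| "cell V N (Some (i, j), (x, y), _) = (i * N + nat x, j * N + nat y)"

lemma cell_label: "cell V N (b, p, \<tau>) = cell V N (b, p, \<tau>')"
  by (cases b; cases p; auto)

section \<open>Blocks and quadrants in the grid\<close>

lemma block_eq:
  fixes i i' N x :: nat
  assumes "i * N < i' * N + x" "i' * N + x \<le> i * N + N" "1 \<le> x" "x \<le> N"
  shows "i' = i"
proof (rule ccontr)
  assume "i' \<noteq> i"
  then consider "Suc i \<le> i'" | "Suc i' \<le> i" by linarith
  then show False
  proof cases
    case 1
    then have "Suc i * N \<le> i' * N" by (rule mult_le_mono1)
    then show False using assms by simp
  next
    case 2
    then have "Suc i' * N \<le> i * N" by (rule mult_le_mono1)
    then show False using assms by simp
  qed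
qed

definition quadrant :: "nat \<Rightarrow> nat \<times> nat \<Rightarrow> int \<Rightarrow> int \<Rightarrow> (nat \<times> nat) set" where
  "quadrant N = (\<lambda>(i, j) u v. {i * N + nat u + 1..i * N + N} \<times> {j * N + nat v + 1..j * N + N})"

lemma cell_in_quadrant:
  assumes "g * N < V" "i < g" "j < g" "x \<in> {1..int N}" "y \<in> {1..int N}" "u \<ge> 0" "v \<ge> 0"
  shows "cell V N (b, (x, y), \<tau>) \<in> quadrant N (i, j) u v \<longleftrightarrow> b = Some (i, j) \<and> u < x \<and> v < y"
proof (cases b)
  case None
  have "Suc i * N \<le> g * N" using assms by (intro mult_le_mono1) auto
  then show ?thesis using assms None by (simp add: quadrant_def)
next
  case (Some b')
  obtain i' j' where b': "b' = (i', j')" by fastforce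
  have "i' = i \<and> j' = j" if "cell V N (b, (x, y), \<tau>) \<in> quadrant N (i, j) u v"
  proof
    show "i' = i" by (rule block_eq [of i N i' "nat x"]) (use that assms in \<open>auto simp: Some b' quadrant_def\<close>)
    show "j' = j" by (rule block_eq [of j N j' "nat y"]) (use that assms in \<open>auto simp: Some b' quadrant_def\<close>)
  qed
  then show ?thesis using assms by (auto simp: Some b' quadrant_def)
qed

lemma cell_in_grid:
  assumes "g * N < V" "b \<in> bins ({..<g} \<times> {..<g})" "p \<in> {1..int N} \<times> {1..int N}"
  shows "cell V N (b, p, \<tau>) \<in> grid V"
proof (cases b)
  case None
  then show ?thesis using assms by (simp add: grid_def)
next
  case (Some b')
  obtain i j where b': "b' = (i, j)" by fastforce
  then have "i < g" "j < g" using assms Some by (auto simp: bins_def)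
  then have "Suc i * N \<le> g * N" "Suc j * N \<le> g * N" by (intro mult_le_mono1; simp)+
  then show ?thesis using assms by (auto simp: Some b' grid_def)
qed

lemma quadrants_disjoint:
  "disjoint_family_on (\<lambda>b. quadrant N b (u b) (v b)) I"
proof -
  have *: "i = i'" if "i * N < a" "a \<le> i * N + N" "i' * N < a" "a \<le> i' * N + N" for a i i' :: nat
    using that block_eq [of i N i' "a - i' * N"] by auto
  show ?thesis
    unfolding disjoint_family_on_def
  proof (intro ballI impI)
    fix b b' :: "nat \<times> nat"
    assume "b \<noteq> b'"
    obtain i j i' j' where b: "b = (i, j)" "b' = (i', j')" by fastforce
    show "quadrant N b (u b) (v b) \<inter> quadrant N b' (u b') (v b') = {}"
    proof (rule ccontr)
      assume "\<not> ?thesis"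
      then obtain x y where "(x, y) \<in> quadrant N b (u b) (v b)" "(x, y) \<in> quadrant N b' (u b') (v b')"
        by auto
      then have "i = i'" "j = j'"
        using *[of i x i'] *[of j y j'] by (auto simp: b quadrant_def)
      then show False using \<open>b \<noteq> b'\<close> b by simp
    qed
  qed
qed

lemma pmf_bool_True_False: "pmf p True + pmf p False = 1" for p :: "bool pmf"
  using sum_pmf_eq_1 [of "UNIV :: bool set" p, OF finite subset_UNIV] by (simp add: UNIV_bool add.commute)

text \<open>A light bin adds \<open>\<rho> / (2 * total)\<close> to the distance. With at least
  \<open>K / 2\<close> light bins and a total of at most \<open>40 * M\<close>, this sums to
  \<open>K * \<rho> / (160 * M)\<close>, so the constant 320 in \<open>\<rho>\<close> gives
  \<open>2 * \<epsilon>\<close>, twice what is needed. The assumption \<open>20 * M \<le> K\<close>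
  keeps the heavy bins below one half of all bins, and together with
  \<open>\<epsilon> \<le> 1 / 64\<close> it yields \<open>\<rho> \<le> 1 / 4\<close>.\<close>

lemma no_tester:
  fixes V k g N D mp mq :: nat and \<epsilon> :: real and T :: tester
  defines "M \<equiv> real (mp + mq)" and "K \<equiv> real (g * g)"
  defines "\<rho> \<equiv> 320 * M * \<epsilon> / K"
  assumes D: "D \<ge> 1" and N: "3 * D ^ (D + 1) \<le> N" and V: "g * N < V" and k: "g * g \<le> k"
    and M: "mp + mq \<ge> 1" and KM: "20 * M \<le> K" and \<epsilon>: "0 < \<epsilon>" "\<epsilon> \<le> 1 / 64"
    and small: "10 * K\<^sup>2 * exp 2 / M * (40 * (15 / D) * \<rho> ^ 4 + 512 * \<rho> ^ 8) \<le> 1 / 200"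
    and T: "Ak_closeness_tester V k \<epsilon> mp mq T"
  shows False
proof -
  define I where "I = {..<g} \<times> {..<g}"
  define X where "X = {1..int N} \<times> {1..int N}"
  define W where "W = scales D \<times> scales D"
  define \<Lambda> where "\<Lambda> = 40 * M"
  let ?r = "diamond D" and ?d = "signed_diamond D"
  have M1: "M \<ge> 1" using M by (simp add: M_def)
  have K: "K > 0" using KM M1 by linarith
  have cardI: "finite I" "real (card I) = K" by (simp_all add: I_def K_def)
  have N': "3 * int D ^ (D + 1) \<le> int N"
    using N by (metis of_nat_le_iff of_nat_mult of_nat_numeral of_nat_power)
  have G: "gadget W X ?r ?d (15 / D)"
    unfolding W_def X_def by (rule gadget_diamond [OF D N'])
  interpret gadget W X ?r ?d "15 / D" by (fact G)
  have "1 \<le> 3 * D ^ (D + 1)" using D by simp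
  then have "N \<ge> 1" using N by linarith
  then have x0: "(1, 1) \<in> X" by (simp add: X_def)
  have \<rho>: "0 < \<rho>" "\<rho> \<le> 1 / 4"
  proof -
    show "0 < \<rho>" using M1 K \<epsilon> by (simp add: \<rho>_def)
    have "\<epsilon> * (20 * M) \<le> (1 / 64) * K" using KM \<epsilon> M1 K by (intro mult_mono) auto
    then show "\<rho> \<le> 1 / 4" using K by (simp add: \<rho>_def field_simps)
  qed
  \<comment> \<open>The expected number \<open>K * h\<close> of heavy bins becomes
    \<open>M / 10\<close>.\<close>
  define h where "h = \<Lambda> / (400 * K)"
  have h: "h * (400 * card I) = \<Lambda>" "h \<le> 1"
    using K KM M1 by (auto simp: h_def cardI \<Lambda>_def field_simps)
  have A: "\<Lambda> / 2 > 0" using M1 by (simp add: \<Lambda>_def)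
  let ?B = "bins I"
  let ?L = "\<lambda>\<tau>. labelled ?B X \<tau>"
  have finL: "finite (?L \<tau>)" for \<tau> using cardI by (simp add: X_def)
  have cell_L: "cell V N ` ?L \<tau> \<subseteq> grid V" for \<tau>
    using cell_in_grid [OF V] by (auto simp: labelled_def X_def I_def)
  \<comment> \<open>Collected for both hypotheses at once. Since the normalising constant does not
    depend on the label, a difference of probabilities is a difference of intensities over
    \<open>total\<close>.\<close>
  have facts:
    "sum (intensity (\<Lambda> / 2) (1, 1) m \<theta>) (?L \<tau>) = total (\<Lambda> / 2) \<rho> I \<theta>"
    "total (\<Lambda> / 2) \<rho> I \<theta> > 0"
    "\<And>z. z \<in> ?L \<tau> \<Longrightarrow> intensity (\<Lambda> / 2) (1, 1) m \<theta> z \<ge> 0"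
    "set_pmf (map_pmf (cell V N) (normalized_pmf (?L \<tau>) (intensity (\<Lambda> / 2) (1, 1) m \<theta>))) \<subseteq> grid V"
    "measure_pmf.prob (map_pmf (cell V N) (normalized_pmf (?L \<tau>) (intensity (\<Lambda> / 2) (1, 1) m \<theta>))) S
      = (\<Sum>b\<in>?B. \<Sum>x\<in>X. with_anchor (\<Lambda> / 2) (1, 1) m b (\<theta> b) (x, \<tau>) * of_bool (cell V N (b, x, \<tau>) \<in> S))
          / total (\<Lambda> / 2) \<rho> I \<theta>"
    if \<theta>: "\<theta> \<in> ?B \<rightarrow>\<^sub>E params W" and m: "m = null_intensity \<rho> ?r \<or> m = alt_intensity \<rho> ?r ?d" for \<theta> m \<tau> S
  proof -
    let ?m = "intensity (\<Lambda> / 2) (1, 1) m \<theta>"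
    have s: "(\<Sum>x\<in>X. m t (x, \<tau>)) = (if fst t then 1 else \<rho>)" if "t \<in> params W" for t \<tau>
      using m by (elim disjE) (simp_all only: sum_label_null [OF that] sum_label_alt [OF that])
    have nn: "m t y \<ge> 0" if "t \<in> params W" "y \<in> letters" for t y
      using m \<rho> null_intensity_nonneg [OF that] alt_intensity_nonneg [OF that] by (elim disjE) simp_all
    show 1: "sum ?m (?L \<tau>) = total (\<Lambda> / 2) \<rho> I \<theta>"
      using s cardI(1) x0 \<theta> by (rule sum_intensity)
    show 2: "total (\<Lambda> / 2) \<rho> I \<theta> > 0"
      using total_ge [of \<rho> "\<Lambda> / 2" I \<theta>] \<rho> A by linarith
    show 3: "?m z \<ge> 0" if "z \<in> ?L \<tau>" for z
      using that A nn \<theta> by (intro intensity_nonneg [of m "\<Lambda> / 2" \<theta> I]) (auto simp: labelled_def)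
    have pos: "sum ?m (?L \<tau>) > 0" using 1 2 by simp
    show "set_pmf (map_pmf (cell V N) (normalized_pmf (?L \<tau>) ?m)) \<subseteq> grid V"
      using set_normalized_pmf [OF finL 3 pos] cell_L [of \<tau>] by auto
    show "measure_pmf.prob (map_pmf (cell V N) (normalized_pmf (?L \<tau>) ?m)) S
      = (\<Sum>b\<in>?B. \<Sum>x\<in>X. with_anchor (\<Lambda> / 2) (1, 1) m b (\<theta> b) (x, \<tau>) * of_bool (cell V N (b, x, \<tau>) \<in> S))
          / total (\<Lambda> / 2) \<rho> I \<theta>"
    proof -
      have "measure_pmf.prob (map_pmf (cell V N) (normalized_pmf (?L \<tau>) ?m)) S
          = (\<Sum>z\<in>?L \<tau>. ?m z * of_bool (cell V N z \<in> S)) / sum ?m (?L \<tau>)"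
        by (rule prob_map_normalized_pmf [OF finL 3 pos])
      also have "(\<Sum>z\<in>?L \<tau>. ?m z * of_bool (cell V N z \<in> S))
          = (\<Sum>b\<in>?B. \<Sum>x\<in>X. with_anchor (\<Lambda> / 2) (1, 1) m b (\<theta> b) (x, \<tau>) * of_bool (cell V N (b, x, \<tau>) \<in> S))"
        unfolding labelled_def sum_labelled [OF finite_bins [OF cardI(1)] finite_X]
        by (simp add: intensity_def)
      finally show ?thesis unfolding 1 .
    qed
  qed
  show False
  proof (rule indistinguishable [where I = I and ?x0.0 = "(1, 1)" and k = mp and k' = mq and h = h
        and \<rho> = \<rho> and cell = "cell V N" and T = T])
    show "finite I" "(1, 1) \<in> X" "1 \<le> mp + mq" "h \<le> 1" "0 \<le> \<rho>" "\<rho> \<le> 1 / 4"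
      using cardI x0 M h \<rho> by auto
    show "h * real (400 * card I) = 40 * real (mp + mq)"
      using h by (simp add: \<Lambda>_def M_def)
    have "card I * (exp 2 / h) = 10 * K\<^sup>2 * exp 2 / M"
      using K M1 by (simp add: cardI h_def \<Lambda>_def power2_eq_square)
    then show "card I * (exp 2 / h * (40 * (15 / D) * \<rho> ^ 4 + 512 * \<rho> ^ 8)) \<le> 1 / 200"
      using small by (metis mult.assoc)
  next
    fix \<theta> assume \<theta>: "\<theta> \<in> ?B \<rightarrow>\<^sub>E params W"
    note f = facts [OF \<theta> disjI1 [OF refl]]
    let ?p = "\<lambda>\<tau>. map_pmf (cell V N) (normalized_pmf (?L \<tau>) (intensity (\<Lambda> / 2) (1, 1) (null_intensity \<rho> ?r) \<theta>))"
    \<comment> \<open>The null intensity ignores the label, so after the labels are forgotten by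
      \<open>cell\<close> the two distributions are equal.\<close>
    have lab: "with_anchor (\<Lambda> / 2) (1, 1) (null_intensity \<rho> ?r) b t (x, True)
        = with_anchor (\<Lambda> / 2) (1, 1) (null_intensity \<rho> ?r) b t (x, False)" for b :: "(nat \<times> nat) option" and t x
      by (cases b; cases t) (auto simp: null_intensity_def)
    have "?p True = ?p False"
    proof (rule pmf_eqI)
      fix c
      have "measure_pmf.prob (?p True) {c} = measure_pmf.prob (?p False) {c}"
        unfolding f(5) lab by (simp only: cell_label [of V N _ _ True False])
      then show "pmf (?p True) c = pmf (?p False) c"
        by (simp add: measure_pmf_single)
    qed
    then show "2 / 3 \<le> accept_prob T mp mq (cell V N) ?B X
        (intensity (40 * real (mp + mq) / 2) (1, 1) (null_intensity \<rho> ?r) \<theta>)"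
      using T f(4) [of True] f(4) [of False]
      unfolding accept_prob_def Ak_closeness_tester_def \<Lambda>_def M_def by blast
  next
    fix \<theta> assume \<theta>: "\<theta> \<in> ?B \<rightarrow>\<^sub>E params W" and "heavy_count I \<theta> \<le> 40 * real (mp + mq) / 4"
    then have heavy: "heavy_count I \<theta> \<le> \<Lambda> / 4" by (simp add: \<Lambda>_def M_def)
    note f = facts [OF \<theta> disjI2 [OF refl]]
    let ?m = "alt_intensity \<rho> ?r ?d"
    let ?w = "\<lambda>b x \<tau>. with_anchor (\<Lambda> / 2) (1, 1) ?m b (\<theta> b) (x, \<tau>)"
    let ?p = "\<lambda>\<tau>. map_pmf (cell V N) (normalized_pmf (?L \<tau>) (intensity (\<Lambda> / 2) (1, 1) ?m \<theta>))"
    let ?tot = "total (\<Lambda> / 2) \<rho> I \<theta>"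
    \<comment> \<open>\<open>u\<close> and \<open>v\<close> are the centre of the hidden diamond,
      taken from index \<open>D + 1\<close> of the two scale vectors.\<close>
    define u where "u i = int D ^ D + fst (fst (snd (\<theta> (Some i)))) (D + 1)" for i
    define v where "v i = int D ^ D + snd (fst (snd (\<theta> (Some i)))) (D + 1)" for i
    define R where "R i = quadrant N i (u i) (v i)" for i
    \<comment> \<open>In a light bin the labels differ by \<open>2 * \<rho> * s\<close> times the
      signed diamond, which has mass \<open>1 / 4\<close> on the quadrant. The absolute value
      removes the random sign, so the bins add up although their signs are independent.\<close>
    have diff: "\<bar>measure_pmf.prob (?p True) (R i) - measure_pmf.prob (?p False) (R i)\<bar>
        = (1 - of_bool (fst (\<theta> (Some i)))) * (\<rho> / (2 * ?tot))" if i: "i \<in> I" for i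
    proof -
      have \<theta>i: "\<theta> (Some i) \<in> params W" using PiE_mem [OF \<theta>, of "Some i"] i by (simp add: bins_def)
      obtain hv f1 f2 s where t: "\<theta> (Some i) = (hv, (f1, f2), s)" by (metis prod.collapse)
      have fs: "f1 \<in> scales D" "f2 \<in> scales D" and s: "s \<in> {-1, 1}"
        using \<theta>i by (auto simp: t params_def W_def)
      have uv: "u i = int D ^ D + f1 (D + 1)" "v i = int D ^ D + f2 (D + 1)"
        by (simp_all add: u_def v_def t)
      have uv0: "u i \<ge> 0" "v i \<ge> 0"
        using scales_mem [OF fs(1), of "D + 1"] scales_mem [OF fs(2), of "D + 1"] by (auto simp: uv)
      have in_R: "cell V N (b, x, \<tau>) \<in> R i \<longleftrightarrow> b = Some i \<and> u i < fst x \<and> v i < snd x" if "x \<in> X" for b x \<tau>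
        using cell_in_quadrant [OF V, of "fst i" "snd i" "fst x" "snd x" "u i" "v i" b \<tau>] that i uv0
        by (auto simp: R_def X_def I_def)
      have prob: "measure_pmf.prob (?p \<tau>) (R i) = (\<Sum>x\<in>X. ?m (\<theta> (Some i)) (x, \<tau>) *
            of_bool (u i < fst x \<and> v i < snd x)) / ?tot" for \<tau>
      proof -
        have "(\<Sum>b\<in>?B. \<Sum>x\<in>X. ?w b x \<tau> * of_bool (cell V N (b, x, \<tau>) \<in> R i))
            = (\<Sum>b\<in>?B. if b = Some i then \<Sum>x\<in>X. ?w b x \<tau> * of_bool (u i < fst x \<and> v i < snd x) else 0)"
          by (intro sum.cong refl) (simp add: in_R cong: sum.cong)
        also have "\<dots> = (\<Sum>x\<in>X. ?w (Some i) x \<tau> * of_bool (u i < fst x \<and> v i < snd x))"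
          using cardI(1) i by (simp add: sum.delta bins_def)
        finally show ?thesis unfolding f(5) by simp
      qed
      have "measure_pmf.prob (?p True) (R i) - measure_pmf.prob (?p False) (R i)
          = (\<Sum>x\<in>X. (?m (\<theta> (Some i)) (x, True) - ?m (\<theta> (Some i)) (x, False)) *
            of_bool (u i < fst x \<and> v i < snd x)) / ?tot"
        unfolding prob by (simp only: diff_divide_distrib sum_subtractf left_diff_distrib)
      also have "(\<Sum>x\<in>X. (?m (\<theta> (Some i)) (x, True) - ?m (\<theta> (Some i)) (x, False)) *
            of_bool (u i < fst x \<and> v i < snd x))
          = (1 - of_bool hv) * (2 * \<rho> * s) * (\<Sum>x\<in>X. ?d (f1, f2) x * of_bool (u i < fst x \<and> v i < snd x))"
        unfolding sum_distrib_left
        by (intro sum.cong refl) (simp add: t alt_intensity_def algebra_simps)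
      also have "(\<Sum>x\<in>X. ?d (f1, f2) x * of_bool (u i < fst x \<and> v i < snd x))
          = (\<Sum>x\<in>{u i + 1..int N} \<times> {v i + 1..int N}. ?d (f1, f2) x)"
        using uv0 by (intro sum.mono_neutral_cong_right) (auto simp: X_def)
      also have "\<dots> = 1 / 4"
        unfolding uv by (rule signed_diamond_quadrant [OF D N' fs])
      finally show ?thesis
        using s \<rho> f(2) by (auto simp: t abs_mult abs_divide)
    qed
    have "(\<Sum>i\<in>I. \<bar>measure_pmf.prob (?p True) (R i) - measure_pmf.prob (?p False) (R i)\<bar>)
        \<le> Ak_dist k (?p True) (?p False)"
    proof (rule Ak_dist_ge)
      show "card I \<le> k" using k by (simp add: I_def)
      show "disjoint_family_on R I"
        unfolding R_def by (rule quadrants_disjoint)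
    qed (use cardI in \<open>auto simp: R_def quadrant_def axis_rectangle_def\<close>)
    moreover have "\<epsilon> \<le> (\<Sum>i\<in>I. \<bar>measure_pmf.prob (?p True) (R i) - measure_pmf.prob (?p False) (R i)\<bar>)"
    proof -
      have "(\<Sum>i\<in>I. \<bar>measure_pmf.prob (?p True) (R i) - measure_pmf.prob (?p False) (R i)\<bar>)
          = (\<Sum>i\<in>I. (1 - of_bool (fst (\<theta> (Some i)))) * (\<rho> / (2 * ?tot)))"
        by (intro sum.cong refl diff)
      also have "\<dots> = (K - heavy_count I \<theta>) * (\<rho> / (2 * ?tot))"
        by (simp only: sum_distrib_right [symmetric] sum_subtractf heavy_count_def sum_constant cardI(2) mult_1_right)
      finally have eq: "(\<Sum>i\<in>I. \<bar>measure_pmf.prob (?p True) (R i) - measure_pmf.prob (?p False) (R i)\<bar>)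
          = (K - heavy_count I \<theta>) * (\<rho> / (2 * ?tot))" .
      \<comment> \<open>The anchor takes \<open>\<Lambda> / 2\<close>, the heavy bins at most
        \<open>\<Lambda> / 4\<close>, and the light ones at most
        \<open>K * \<rho> = 320 * M * \<epsilon> \<le> 5 * M\<close>.\<close>
      have tot: "?tot \<le> \<Lambda>"
      proof -
        have "(\<Sum>i\<in>I. if fst (\<theta> (Some i)) then 1 else \<rho>) \<le> (\<Sum>i\<in>I. of_bool (fst (\<theta> (Some i))) + \<rho>)"
          using \<rho> by (intro sum_mono) auto
        also have "\<dots> = heavy_count I \<theta> + K * \<rho>"
          by (simp only: sum.distrib heavy_count_def sum_constant cardI(2))
        finally have "?tot \<le> \<Lambda> / 2 + (\<Lambda> / 4 + K * \<rho>)"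
          using heavy by (simp add: total_def)
        moreover have "K * \<rho> \<le> \<Lambda> / 4"
        proof -
          have "K * \<rho> = 320 * M * \<epsilon>" using K by (simp add: \<rho>_def)
          also have "\<dots> \<le> 320 * M * (1 / 64)" using \<epsilon> M1 by (intro mult_left_mono) auto
          finally show ?thesis using M1 by (simp add: \<Lambda>_def)
        qed
        ultimately show ?thesis by simp
      qed
      have "\<epsilon> \<le> 2 * \<epsilon>" using \<epsilon> by simp
      also have "\<dots> = (K / 2) * (\<rho> / (2 * \<Lambda>))"
        using K M1 by (simp add: \<rho>_def \<Lambda>_def)
      also have "\<dots> \<le> (K - heavy_count I \<theta>) * (\<rho> / (2 * ?tot))"
      proof (intro mult_mono)
        show "K / 2 \<le> K - heavy_count I \<theta>"
          using heavy KM by (simp add: \<Lambda>_def)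
        then show "0 \<le> K - heavy_count I \<theta>" using K by linarith
        show "\<rho> / (2 * \<Lambda>) \<le> \<rho> / (2 * ?tot)"
          using tot \<rho> f(2) A by (intro divide_left_mono) auto
        show "0 \<le> \<rho> / (2 * \<Lambda>)" using \<rho> A by simp
      qed
      finally show ?thesis unfolding eq .
    qed
    ultimately have "Ak_dist k (?p True) (?p False) \<ge> \<epsilon>" by linarith
    then have "pmf (run_tester T mp mq (?p True) (?p False)) False \<ge> 2 / 3"
      using T f(4) [of True] f(4) [of False] unfolding Ak_closeness_tester_def by blast
    then show "accept_prob T mp mq (cell V N) ?B X
        (intensity (40 * real (mp + mq) / 2) (1, 1) ?m \<theta>) \<le> 1 / 3"
      using pmf_bool_True_False [of "run_tester T mp mq (?p True) (?p False)"]
      unfolding accept_prob_def \<Lambda>_def M_def by linarith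
  qed
qed

section \<open>The lower bound\<close>

text \<open>Without samples the verdict is \<open>T [] []\<close> for all distributions, yet equal
  and distinct point masses force opposite verdicts. This supplies the one sample that the Poisson
  estimates start from.\<close>

lemma no_samples_insufficient:
  assumes "V \<ge> 2" "k \<ge> 1" "\<epsilon> \<le> 1" "Ak_closeness_tester V k \<epsilon> 0 0 T"
  shows False
proof -
  let ?p = "return_pmf (1, 1) :: (nat \<times> nat) pmf" and ?q = "return_pmf (1, 2) :: (nat \<times> nat) pmf"
  have grid: "set_pmf ?p \<subseteq> grid V" "set_pmf ?q \<subseteq> grid V"
    using assms by (auto simp: grid_def)
  have "(\<Sum>i\<in>{0::nat}. \<bar>measure_pmf.prob ?p ({1..1} \<times> {1..1}) - measure_pmf.prob ?q ({1..1} \<times> {1..1})\<bar>)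
      \<le> Ak_dist k ?p ?q"
  proof (rule Ak_dist_ge)
    show "axis_rectangle ({1..1} \<times> {1..1} :: (nat \<times> nat) set)"
      unfolding axis_rectangle_def by blast
  qed (use assms in \<open>auto simp: disjoint_family_on_def\<close>)
  then have "\<epsilon> \<le> Ak_dist k ?p ?q"
    using assms by (simp add: indicator_def)
  then have "pmf (run_tester T 0 0 ?p ?q) False \<ge> 2 / 3" "pmf (run_tester T 0 0 ?p ?p) True \<ge> 2 / 3"
    using assms(4) grid unfolding Ak_closeness_tester_def by blast+
  then show False
    using pmf_bool_True_False [of "T [] []"] by (simp add: run_tester_def bind_return_pmf)
qed

text \<open>\<open>D\<close> is \<open>ln (ln V)\<close> rounded up, which already dominates the
  quotient in the bound once \<open>ln (ln (ln V)) \<ge> 1\<close>. The logarithm of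
  \<open>D ^ (D + 1)\<close> is then far below that of \<open>V\<close>, so the constant 12, chosen
  for \<open>grid_choice\<close>, costs nothing for large \<open>V\<close>.\<close>

lemma scale_choice:
  obtains V0 :: nat where "V0 \<ge> 16"
    "\<And>V. V \<ge> V0 \<Longrightarrow> \<exists>D. D \<ge> 1 \<and> 0 < ln (ln (real V)) / ln (ln (ln (real V)))
        \<and> ln (ln (real V)) / ln (ln (ln (real V))) \<le> real D \<and> 12 * real D ^ (D + 1) \<le> sqrt (real V)"
proof -
  have "eventually (\<lambda>x::real. 1 \<le> ln (ln (ln x)) \<and> 1 \<le> ln (ln x) \<and>
      12 * (ln (ln x) + 1) powr (ln (ln x) + 2) \<le> sqrt x) at_top"
    by (intro eventually_conj; real_asymp)
  then have "eventually (\<lambda>V::nat. 1 \<le> ln (ln (ln (real V))) \<and> 1 \<le> ln (ln (real V)) \<and>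
      12 * (ln (ln (real V)) + 1) powr (ln (ln (real V)) + 2) \<le> sqrt (real V)) sequentially"
    by (rule eventually_compose_filterlim [OF _ filterlim_real_sequentially])
  then obtain V1 where V1: "\<And>V. V \<ge> V1 \<Longrightarrow> 1 \<le> ln (ln (ln (real V))) \<and> 1 \<le> ln (ln (real V)) \<and>
      12 * (ln (ln (real V)) + 1) powr (ln (ln (real V)) + 2) \<le> sqrt (real V)"
    unfolding eventually_sequentially by blast
  show ?thesis
  proof (rule that [of "max 16 V1"])
    fix V :: nat assume "V \<ge> max 16 V1"
    define u where "u = ln (ln (real V))"
    have u: "1 \<le> ln u" "1 \<le> u" "12 * (u + 1) powr (u + 2) \<le> sqrt (real V)"
      using V1 [of V] \<open>V \<ge> max 16 V1\<close> by (auto simp: u_def)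
    define D where "D = nat \<lceil>u\<rceil>"
    have D: "u \<le> real D" "real D \<le> u + 1" "D \<ge> 1"
      using u unfolding D_def by linarith+
    have "real D ^ (D + 1) = real D powr real (D + 1)"
      using D(3) by (intro powr_realpow [symmetric]) simp
    also have "\<dots> \<le> (u + 1) powr real (D + 1)"
      using D by (intro powr_mono2) auto
    also have "\<dots> \<le> (u + 1) powr (u + 2)"
      using D u by (intro powr_mono) auto
    finally have "12 * real D ^ (D + 1) \<le> sqrt (real V)"
      using u(3) by linarith
    moreover have "u / ln u \<le> u"
      using u by (simp add: divide_le_eq mult_le_cancel_left1)
    then have "u / ln u \<le> real D" using D by linarith
    moreover have "0 < u / ln u" using u by (intro divide_pos_pos) linarith+
    ultimately show "\<exists>D. D \<ge> 1 \<and> 0 < ln (ln (real V)) / ln (ln (ln (real V)))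
        \<and> ln (ln (real V)) / ln (ln (ln (real V))) \<le> real D \<and> 12 * real D ^ (D + 1) \<le> sqrt (real V)"
      using D(3) unfolding u_def by blast
  qed simp
qed

text \<open>A row is divided by \<open>g + 1\<close> although only \<open>g\<close> blocks are used:
  this leaves the last cell free for the anchor. From \<open>k \<le> V\<close> the side satisfies
  \<open>sqrt V < 2 * (N + 1)\<close>; the factor 12 in place of 6 absorbs the rounding.\<close>

lemma grid_choice:
  assumes k: "1 \<le> k" "k \<le> V" and V: "V \<ge> 16" and s: "12 * s \<le> sqrt (real V)" "s \<ge> 1"
  obtains g N :: nat where "g * g \<le> k" "real k \<le> 4 * real (g * g)" "g * N < V" "3 * s \<le> real N"
proof -
  define g where "g = nat \<lfloor>sqrt (real k)\<rfloor>"
  define N where "N = V div (g + 1)"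
  have sk: "sqrt (real k) \<ge> 1" using k by simp
  have g: "real g \<le> sqrt (real k)" "sqrt (real k) < real g + 1" "g \<ge> 1"
    using sk unfolding g_def by linarith+
  have sV: "sqrt (real V) \<ge> 4"
    using V real_le_rsqrt [of 4 "real V"] by simp
  have sq: "sqrt (real V) * sqrt (real V) = real V" by simp
  have "real g * real g \<le> sqrt (real k) * sqrt (real k)"
    using g sk by (intro mult_mono) auto
  then have "real (g * g) \<le> real k" by simp
  then have 1: "g * g \<le> k" by (simp only: of_nat_le_iff)
  have "real g \<ge> 1" using g(3) by simp
  then have "sqrt (real k) \<le> 2 * real g" using g(2) by linarith
  then have "sqrt (real k) * sqrt (real k) \<le> (2 * real g) * (2 * real g)"
    using sk by (intro mult_mono) auto
  then have 2: "real k \<le> 4 * real (g * g)" by simp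
  have gV: "real g + 1 \<le> 2 * sqrt (real V)"
  proof -
    have "sqrt (real k) \<le> sqrt (real V)" using k by simp
    then show ?thesis using g sV by linarith
  qed
  have "V = N * (g + 1) + V mod (g + 1)"
    unfolding N_def by (rule div_mult_mod_eq [symmetric])
  also have "\<dots> < N * (g + 1) + (g + 1)"
    by (intro add_strict_left_mono mod_less_divisor) simp
  finally have "V < (N + 1) * (g + 1)"
    by (simp only: add_mult_distrib mult_1)
  then have "real V < real ((N + 1) * (g + 1))"
    by (simp only: of_nat_less_iff)
  also have "\<dots> = (real N + 1) * (real g + 1)" by (simp add: algebra_simps)
  also have "\<dots> \<le> (real N + 1) * (2 * sqrt (real V))"
    using gV by (intro mult_left_mono) auto
  finally have "sqrt (real V) * sqrt (real V) < (2 * (real N + 1)) * sqrt (real V)"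
    unfolding sq by (simp add: mult_ac)
  then have "sqrt (real V) < 2 * (real N + 1)"
    by (rule mult_right_less_imp_less) simp
  with s(1) have "12 * s < 2 * (real N + 1)" by (rule le_less_trans)
  then have 3: "3 * s \<le> real N"
    using s(2) by (simp add: algebra_simps)
  have "N \<ge> 1" using 3 s by (cases N) auto
  have "(g + 1) * N \<le> V" unfolding N_def by (rule times_div_less_eq_dividend)
  then have "g * N < V" using \<open>N \<ge> 1\<close> by simp
  then show ?thesis using that 1 2 3 by blast
qed

text \<open>Inserting \<open>\<rho>\<close> reduces the divergence to the quotients
  \<open>M ^ 3 * \<epsilon> ^ 4 / (K\<^sup>2 * D)\<close> and
  \<open>M ^ 7 * \<epsilon> ^ 8 / K ^ 6\<close>. The third power of the first bound on
  \<open>M\<close> and the seventh power of the second clear all fractional exponents and bound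
  exactly these quotients.\<close>

lemma chi_square_total_small:
  fixes M K \<epsilon> L \<rho> D k :: real
  assumes pos: "M \<ge> 1" "K > 0" "\<epsilon> > 0" "L > 0" "k > 0" and L: "L \<le> D" and k: "k \<le> 4 * K"
    and \<rho>: "\<rho> = 320 * M * \<epsilon> / K"
    and M1: "M \<le> 1 / 10 ^ 8 * (k powr (2/3) * \<epsilon> powr (-4/3) * L powr (1/3))"
    and M2: "M \<le> 1 / 10 ^ 8 * (k powr (6/7) * \<epsilon> powr (-8/7))"
  shows "10 * K\<^sup>2 * exp 2 / M * (40 * (15 / D) * \<rho> ^ 4 + 512 * \<rho> ^ 8) \<le> 1 / 200"
proof -
  have D: "D > 0" using L pos by linarith
  have pow: "(x powr (real i / real j)) ^ j = x ^ i" if "x > 0" "j > 0" for x :: real and i j :: nat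
  proof -
    have "(x powr (real i / real j)) ^ j = (x powr (real i / real j)) powr real j"
      using that(1) by (intro powr_realpow [symmetric]) simp
    also have "\<dots> = x powr (real i / real j * real j)" by (rule powr_powr)
    also have "real i / real j * real j = real i" using that(2) by simp
    also have "x powr real i = x ^ i" using that(1) by (rule powr_realpow)
    finally show ?thesis .
  qed
  have root: "(k powr (2/3)) ^ 3 = k ^ 2" "(\<epsilon> powr (4/3)) ^ 3 = \<epsilon> ^ 4" "(L powr (1/3)) ^ 3 = L"
    "(k powr (6/7)) ^ 7 = k ^ 6" "(\<epsilon> powr (8/7)) ^ 7 = \<epsilon> ^ 8"
    using pow [of k 3 2] pow [of \<epsilon> 3 4] pow [of L 3 1] pow [of k 7 6] pow [of \<epsilon> 7 8] pos by simp_all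
  have inv: "\<epsilon> powr (-4/3) = 1 / \<epsilon> powr (4/3)" "\<epsilon> powr (-8/7) = 1 / \<epsilon> powr (8/7)"
    using powr_minus_divide [of \<epsilon> "4/3"] powr_minus_divide [of \<epsilon> "8/7"] by simp_all
  have "M ^ 3 \<le> (1 / 10 ^ 8 * (k powr (2/3) * \<epsilon> powr (-4/3) * L powr (1/3))) ^ 3"
    using M1 pos(1) by (intro power_mono) linarith+
  also have "\<dots> = (1 / 10 ^ 8) ^ 3 * (k\<^sup>2 * (1 ^ 3 / \<epsilon> ^ 4) * L)"
    unfolding inv power_mult_distrib power_divide [of 1 "\<epsilon> powr (4/3)"] root ..
  finally have "M ^ 3 * \<epsilon> ^ 4 \<le> (1 / 10 ^ 8) ^ 3 * (k\<^sup>2 * (1 ^ 3 / \<epsilon> ^ 4) * L) * \<epsilon> ^ 4"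
    using pos(3) by (intro mult_right_mono) simp_all
  also have "\<dots> = (1 / 10 ^ 8) ^ 3 * (k\<^sup>2 * L)"
    using pos(3) by simp
  also have "\<dots> \<le> (1 / 10 ^ 8) ^ 3 * ((4 * K)\<^sup>2 * D)"
    using pos k L by (intro mult_left_mono mult_mono power_mono) simp_all
  also have "\<dots> = 16 / 10 ^ 24 * (K\<^sup>2 * D)"
    unfolding power_mult_distrib power_divide by simp
  finally have A: "M ^ 3 * \<epsilon> ^ 4 \<le> 16 / 10 ^ 24 * (K\<^sup>2 * D)" .
  have "M ^ 7 \<le> (1 / 10 ^ 8 * (k powr (6/7) * \<epsilon> powr (-8/7))) ^ 7"
    using M2 pos(1) by (intro power_mono) linarith+
  also have "\<dots> = (1 / 10 ^ 8) ^ 7 * (k ^ 6 * (1 ^ 7 / \<epsilon> ^ 8))"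
    unfolding inv power_mult_distrib power_divide [of 1 "\<epsilon> powr (8/7)"] root ..
  finally have "M ^ 7 * \<epsilon> ^ 8 \<le> (1 / 10 ^ 8) ^ 7 * (k ^ 6 * (1 ^ 7 / \<epsilon> ^ 8)) * \<epsilon> ^ 8"
    using pos(3) by (intro mult_right_mono) simp_all
  also have "\<dots> = (1 / 10 ^ 8) ^ 7 * k ^ 6"
    using pos(3) by simp
  also have "\<dots> \<le> (1 / 10 ^ 8) ^ 7 * (4 * K) ^ 6"
    using pos k by (intro mult_left_mono power_mono) simp_all
  also have "\<dots> = 4096 / 10 ^ 56 * K ^ 6"
    unfolding power_mult_distrib power_divide by simp
  finally have B: "M ^ 7 * \<epsilon> ^ 8 \<le> 4096 / 10 ^ 56 * K ^ 6" .
  have e: "exp 2 \<le> (9::real)"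
  proof -
    have "exp 2 = exp 1 * exp (1::real)" by (simp flip: exp_add)
    also have "\<dots> \<le> 3 * 3" using exp_le by (intro mult_mono) auto
    finally show ?thesis by simp
  qed
  have "10 * K\<^sup>2 * exp 2 / M * (40 * (15 / D) * \<rho> ^ 4 + 512 * \<rho> ^ 8)
      = exp 2 * (6000 * 320 ^ 4 * (M ^ 3 * \<epsilon> ^ 4 / (K\<^sup>2 * D)) + 5120 * 320 ^ 8 * (M ^ 7 * \<epsilon> ^ 8 / K ^ 6))"
  proof -
    have "M ^ 4 = M * M ^ 3" "K ^ 4 = K\<^sup>2 * K\<^sup>2"
      by (simp_all add: power4_eq_xxxx power3_eq_cube power2_eq_square)
    then have r4: "\<rho> ^ 4 = 320 ^ 4 * (M * (M ^ 3 * \<epsilon> ^ 4)) / (K\<^sup>2 * K\<^sup>2)"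
      unfolding \<rho> by (simp only: power_mult_distrib power_divide mult.assoc)
    have "M ^ 8 = M * M ^ 7" using power_Suc [of M 7] by simp
    moreover have "K ^ 8 = K\<^sup>2 * K ^ 6" by (simp flip: power_add)
    ultimately have r8: "\<rho> ^ 8 = 320 ^ 8 * (M * (M ^ 7 * \<epsilon> ^ 8)) / (K\<^sup>2 * K ^ 6)"
      unfolding \<rho> by (simp only: power_mult_distrib power_divide mult.assoc)
    have gen: "10 * k2 * e / M * (40 * (15 / D) * (c4 * (M * a) / (k2 * k2)) + 512 * (c8 * (M * b) / (k2 * k6)))
        = e * (6000 * c4 * (a / (k2 * D)) + 5120 * c8 * (b / k6))"
      if "k2 > 0" "k6 > 0" for k2 k6 e c4 c8 a b :: real
      using that pos D by (simp add: divide_simps) (simp add: algebra_simps)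
    show ?thesis unfolding r4 r8 by (rule gen) (use pos in auto)
  qed
  also have "\<dots> \<le> 9 * (6000 * 320 ^ 4 * (16 / 10 ^ 24) + 5120 * 320 ^ 8 * (4096 / 10 ^ 56))"
  proof -
    have a: "M ^ 3 * \<epsilon> ^ 4 / (K\<^sup>2 * D) \<le> 16 / 10 ^ 24"
      using A pos D by (subst pos_divide_le_eq) auto
    have b: "M ^ 7 * \<epsilon> ^ 8 / K ^ 6 \<le> 4096 / 10 ^ 56"
      using B pos by (subst pos_divide_le_eq) auto
    have "0 \<le> M ^ 3 * \<epsilon> ^ 4 / (K\<^sup>2 * D)" "0 \<le> M ^ 7 * \<epsilon> ^ 8 / K ^ 6"
      using pos D by auto
    then show ?thesis
      by (intro mult_mono [OF e] add_mono mult_left_mono [OF a] mult_left_mono [OF b]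
          add_nonneg_nonneg mult_nonneg_nonneg) simp_all
  qed
  also have "\<dots> \<le> 1 / 200" by simp
  finally show ?thesis .
qed

theorem mainTheorem2:
  shows "\<exists>c>0. \<exists>\<epsilon>\<^sub>0>0. \<forall>(V::nat) (k::nat) (\<epsilon>::real) m\<^sub>p m\<^sub>q T.
           V > 0 \<longrightarrow> 1 \<le> k \<longrightarrow> k \<le> V \<longrightarrow> 0 < \<epsilon> \<longrightarrow> \<epsilon> < \<epsilon>\<^sub>0 \<longrightarrow>
           Ak_closeness_tester V k \<epsilon> m\<^sub>p m\<^sub>q T \<longrightarrow>
           real (m\<^sub>p + m\<^sub>q) \<ge> c * sample_bound V k \<epsilon>"
proof -
  obtain V0 :: nat where V0: "V0 \<ge> 16" and
    scale: "\<And>V. V \<ge> V0 \<Longrightarrow> \<exists>D. D \<ge> 1 \<and> 0 < ln (ln (real V)) / ln (ln (ln (real V)))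
        \<and> ln (ln (real V)) / ln (ln (ln (real V))) \<le> real D \<and> 12 * real D ^ (D + 1) \<le> sqrt (real V)"
    using scale_choice by blast
  \<comment> \<open>\<open>1 / V0\<close> settles \<open>V < V0\<close>, where
    \<open>c * k < 1\<close> and at least one sample is drawn. \<open>1 / 10 ^ 8\<close> is small
    enough for the divergence bound, and through the entry \<open>k\<close> of the minimum also for
    \<open>20 * M \<le> K\<close>.\<close>
  define c where "c = min (1 / 10 ^ 8) (1 / real V0)"
  have c: "c > 0" "c \<le> 1 / 10 ^ 8" "c \<le> 1 / real V0"
    using V0 by (auto simp: c_def)
  have "real (mp + mq) \<ge> c * sample_bound V k \<epsilon>"
    if V: "V > 0" and k: "1 \<le> k" "k \<le> V" and \<epsilon>: "0 < \<epsilon>" "\<epsilon> < 1 / 64"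
      and T: "Ak_closeness_tester V k \<epsilon> mp mq T" for V k mp mq :: nat and \<epsilon> :: real and T
  proof (rule ccontr)
    assume "\<not> ?thesis"
    then have less: "real (mp + mq) < c * sample_bound V k \<epsilon>" by simp
    let ?L = "ln (ln (real V)) / ln (ln (ln (real V)))"
    have bounds: "sample_bound V k \<epsilon> \<le> real k powr (2/3) * \<epsilon> powr (-4/3) * ?L powr (1/3)"
      "sample_bound V k \<epsilon> \<le> real k powr (6/7) * \<epsilon> powr (-8/7)"
      "sample_bound V k \<epsilon> \<le> real k"
      unfolding sample_bound_def by (rule Min_le; simp)+
    have sb: "sample_bound V k \<epsilon> > 0"
    proof (rule ccontr)
      assume "\<not> ?thesis"
      then have "c * sample_bound V k \<epsilon> \<le> 0" using c by (intro mult_nonneg_nonpos) auto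
      then show False using less by linarith
    qed
    have "V \<ge> 2"
    proof (rule ccontr)
      assume "\<not> ?thesis"
      then have "V = 1" using V by simp
      then show False using sb bounds(1) by simp
    qed
    have M: "mp + mq \<ge> 1"
    proof (rule ccontr)
      assume "\<not> ?thesis"
      then have "mp = 0" "mq = 0" by auto
      then show False using no_samples_insufficient [of V k \<epsilon> T] T \<open>V \<ge> 2\<close> k \<epsilon> by simp
    qed
    have up: "real (mp + mq) \<le> x * y" if "sample_bound V k \<epsilon> \<le> y" "c \<le> x" for x y
    proof -
      have "c * sample_bound V k \<epsilon> \<le> x * y"
        using that c sb by (intro mult_mono) auto
      then show ?thesis using less by linarith
    qed
    have "V \<ge> V0"
    proof (rule ccontr)
      assume "\<not> ?thesis"
      then have "real k < real V0" using k by simp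
      have "c * sample_bound V k \<epsilon> \<le> 1 / real V0 * real k"
        using bounds(3) c sb by (intro mult_mono) auto
      also have "\<dots> < 1" using \<open>real k < real V0\<close> by simp
      finally show False using less M by linarith
    qed
    then obtain D where D: "D \<ge> 1" "0 < ?L" "?L \<le> real D" "12 * real D ^ (D + 1) \<le> sqrt (real V)"
      using scale by blast
    have "real D ^ (D + 1) \<ge> 1" using D(1) by (intro one_le_power) simp
    then obtain g N where gN: "g * g \<le> k" "real k \<le> 4 * real (g * g)" "g * N < V"
        "3 * real D ^ (D + 1) \<le> real N"
      using grid_choice [OF k _ D(4)] V0 \<open>V \<ge> V0\<close> by (metis order_trans)
    have "real (3 * D ^ (D + 1)) \<le> real N" using gN(4) by simp
    then have N: "3 * D ^ (D + 1) \<le> N" by (simp only: of_nat_le_iff)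
    have K: "real (g * g) > 0" using gN(2) k by linarith
    show False
    proof (rule no_tester [OF D(1) N gN(3,1) M _ \<epsilon>(1) _ _ T])
      have "real (mp + mq) \<le> 1 / 10 ^ 8 * real k"
        using up bounds(3) c(2) by blast
      then show "20 * real (mp + mq) \<le> real (g * g)"
        using gN(2) by simp
      show "\<epsilon> \<le> 1 / 64" using \<epsilon> by simp
      show "10 * (real (g * g))\<^sup>2 * exp 2 / real (mp + mq) *
          (40 * (15 / real D) * (320 * real (mp + mq) * \<epsilon> / real (g * g)) ^ 4
            + 512 * (320 * real (mp + mq) * \<epsilon> / real (g * g)) ^ 8) \<le> 1 / 200"
        using M k by (intro chi_square_total_small [where k = "real k" and L = ?L and \<epsilon> = \<epsilon>] up bounds c K D \<epsilon> gN refl) auto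
    qed
  qed
  then show ?thesis
    using c(1) by (intro exI [of _ c] exI [of _ "1 / 64"] conjI allI impI) auto
qed

end
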